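(* There exist constants $\Delta > \delta > 0$ such that, for every integer $n \ge 2$, there exists a Littlewood polynomial $P(z)$ of degree $n$ with \[ \delta \sqrt{n} \le |P(z)| \le \Delta \sqrt{n} \] for all $z \in \mathbb{C}$ with $|z| = 1$.
   Context: A Littlewood polynomial of degree $n$ is a polynomial $P(z)=\sum_{k=0}^{n}\varepsilon_k z^k$ with $\varepsilon_k\in\{-1,1\}$ for all $0\le k\le n$. *)

theory Defs
  imports Complex_Main
begin

definition littlewood_signs :: "nat \<Rightarrow> (nat \<Rightarrow> int) \<Rightarrow> bool" where
  "littlewood_signs n eps \<longleftrightarrow> (\<forall>k\<le>n. eps k = 1 \<or> eps k = -1)"

definition littlewood_eval :: "nat \<Rightarrow> (nat \<Rightarrow> int) \<Rightarrow> complex \<Rightarrow> complex" where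
  "littlewood_eval n eps z = (\<Sum>k\<le>n. of_int (eps k) * z ^ k)"

end

theory Submission
  imports Defs "HOL-Analysis.Analysis" "HOL-Computational_Algebra.Polynomial"
begin

text \<open>
Put signs on the exponents around the middle degree \<open>L\<close> so that the coefficients at \<open>L + k\<close> and
\<open>L - k\<close> agree for \<open>k\<close> in a small set \<open>C\<close> of even numbers and are opposite for the other \<open>k\<close>.
Up to a unimodular factor the polynomial is then a cosine polynomial (frequencies \<open>C\<close>) plus \<open>\<i>\<close>
times a sine polynomial.  The cosine part is built from a Rudin-Shapiro pair whose two members are
modulated by \<open>z^T\<close> and \<open>z^(2 T)\<close>; since the two are never simultaneously small, it is of order
\<open>sqrt L\<close> outside few short arcs.  On these arcs the sine part is made large: prescribe a sum of
Fejer bumps with signs that are constant on clusters of arcs, choose the signs by a Spencer-type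
discrepancy theorem so that all Fourier coefficients of the sum are at most 1 in modulus, and round
these coefficients to signs by the same discrepancy theorem, which costs only \<open>O(sqrt L)\<close> uniformly.
Finitely many small degrees are covered by \<open>-1 + z + \<dots> + z^n\<close>, which has no zero on the unit circle.
\<close>

section \<open>Discrepancy\<close>

text \<open>The sine part has to beat its own rounding error on the bad arcs. Rounding coefficients
  in \<open>[-1, 1]\<close> to signs costs up to \<open>C * sqrt L\<close> with an absolute
  \<open>C\<close>, so the bumps must be higher than that, yet their coefficients must stay in
  \<open>[-1, 1]\<close>. The free parameter \<open>A\<close> resolves this. A window of
  \<open>9 * A\<close> cells contains at most 8 bad cells however large \<open>A\<close> is, so
  about \<open>T\<close> signs face \<open>12 * A * T\<close> frequencies, and the discrepancy bound
  improves as this ratio tends to 0. Independent random signs would give typical coefficients of the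
  right size but lose a logarithm in the maximum. Enlarging \<open>A\<close> shrinks
  \<open>\<eta>\<close>, the level below which the cosine part counts as small; this is not
  circular, because the bounds on the sine part do not depend on \<open>\<eta>\<close>, and only the
  final lower constant pays. Signs are constant on clusters because neighbouring bumps of opposite
  sign could cancel, while clusters \<open>A\<close> cells apart interact only through Fejer tails
  of size \<open>O(1 / A)\<close>.\<close>

definition sg :: "'a set \<Rightarrow> 'a \<Rightarrow> real" where
  "sg X j = (if j \<in> X then 1 else -1)"

section \<open>Moments of random signed sums\<close>

lemma sum_Pow_insert:
  assumes "finite J" "j \<notin> J"
  shows "(\<Sum>X\<in>Pow (insert j J). f X) = (\<Sum>X\<in>Pow J. f X) + (\<Sum>X\<in>Pow J. f (insert j X) :: real)"
proof -
  have inj: "inj_on (insert j) (Pow J)"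
    using assms(2) by (auto simp: inj_on_def)
  have "(\<Sum>X\<in>Pow (insert j J). f X) = (\<Sum>X\<in>Pow J. f X) + (\<Sum>X\<in>insert j ` Pow J. f X)"
    unfolding Pow_insert using assms by (intro sum.union_disjoint) auto
  then show ?thesis
    by (simp add: sum.reindex[OF inj])
qed

lemma signed_sum_insert:
  assumes "finite J" "j \<notin> J" "X \<subseteq> J"
  shows "(\<Sum>i\<in>insert j J. a i * sg X i) = (\<Sum>i\<in>J. a i * sg X i) - a j"
    and "(\<Sum>i\<in>insert j J. a i * sg (insert j X) i) = (\<Sum>i\<in>J. a i * sg X i) + a j"
proof -
  have "j \<notin> X" using assms by auto
  then show "(\<Sum>i\<in>insert j J. a i * sg X i) = (\<Sum>i\<in>J. a i * sg X i) - a j"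
    using assms by (simp add: sg_def)
  have "(\<Sum>i\<in>J. a i * sg (insert j X) i) = (\<Sum>i\<in>J. a i * sg X i)"
    using assms by (intro sum.cong) (auto simp: sg_def)
  then show "(\<Sum>i\<in>insert j J. a i * sg (insert j X) i) = (\<Sum>i\<in>J. a i * sg X i) + a j"
    using assms by (simp add: sg_def)
qed

text \<open>Summing over \<open>Pow J\<close> is \<open>2 ^ card J\<close> times an expectation over
  independent signs. A new index replaces \<open>S\<close> by \<open>S - a j\<close> and
  \<open>S + a j\<close>, and the cross terms of the squares cancel.\<close>

lemma second_moment_signed_sums:
  assumes "finite J" "\<And>j. j \<in> J \<Longrightarrow> \<bar>a j\<bar> \<le> (1::real)"
  shows "(\<Sum>X\<in>Pow J. (\<Sum>j\<in>J. a j * sg X j)\<^sup>2) \<le> real (card J) * 2 ^ card J"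
  using assms
proof (induction J rule: finite_induct)
  case (insert j J)
  let ?S = "\<lambda>X. \<Sum>i\<in>J. a i * sg X i"
  have a: "(a j)\<^sup>2 \<le> 1" using insert.prems[of j] by (simp add: abs_square_le_1)
  have "(\<Sum>X\<in>Pow (insert j J). (\<Sum>i\<in>insert j J. a i * sg X i)\<^sup>2)
      = (\<Sum>X\<in>Pow J. (?S X - a j)\<^sup>2 + (?S X + a j)\<^sup>2)"
    unfolding sum_Pow_insert[OF insert.hyps] sum.distrib
    using insert.hyps signed_sum_insert[OF insert.hyps] by auto
  also have "\<dots> = (\<Sum>X\<in>Pow J. 2 * (?S X)\<^sup>2 + 2 * (a j)\<^sup>2)"
    by (intro sum.cong) (auto simp: power2_eq_square algebra_simps)
  also have "\<dots> = 2 * (\<Sum>X\<in>Pow J. (?S X)\<^sup>2) + 2 ^ card J * (2 * (a j)\<^sup>2)"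
    using insert.hyps by (simp add: sum.distrib sum_distrib_left card_Pow)
  also have "\<dots> \<le> 2 * (real (card J) * 2 ^ card J) + 2 ^ card J * (2 * 1)"
    using insert a by (intro add_mono mult_left_mono) auto
  also have "\<dots> = real (card (insert j J)) * 2 ^ card (insert j J)"
    using insert.hyps by (simp add: algebra_simps)
  finally show ?case .
qed simp

lemma fourth_moment_signed_sums:
  assumes "finite J" "\<And>j. j \<in> J \<Longrightarrow> \<bar>a j\<bar> \<le> (1::real)"
  shows "(\<Sum>X\<in>Pow J. (\<Sum>j\<in>J. a j * sg X j) ^ 4) \<le> 3 * (real (card J))\<^sup>2 * 2 ^ card J"
  using assms
proof (induction J rule: finite_induct)
  case (insert j J)
  let ?S = "\<lambda>X. \<Sum>i\<in>J. a i * sg X i"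
  let ?n = "real (card J)"
  have a: "(a j)\<^sup>2 \<le> 1" using insert.prems[of j] by (simp add: abs_square_le_1)
  then have a4: "(a j) ^ 4 \<le> 1"
    using power_le_one[of "(a j)\<^sup>2" 2] by (simp flip: power_mult)
  have second: "(\<Sum>X\<in>Pow J. (?S X)\<^sup>2) \<le> ?n * 2 ^ card J"
    using insert by (intro second_moment_signed_sums) auto
  have "(\<Sum>X\<in>Pow (insert j J). (\<Sum>i\<in>insert j J. a i * sg X i) ^ 4)
      = (\<Sum>X\<in>Pow J. (?S X - a j) ^ 4 + (?S X + a j) ^ 4)"
    unfolding sum_Pow_insert[OF insert.hyps] sum.distrib
    using insert.hyps signed_sum_insert[OF insert.hyps] by auto
  also have "\<dots> = (\<Sum>X\<in>Pow J. 2 * (?S X) ^ 4 + 12 * (a j)\<^sup>2 * (?S X)\<^sup>2 + 2 * (a j) ^ 4)"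
    by (intro sum.cong) (auto simp: power2_eq_square power4_eq_xxxx algebra_simps)
  also have "\<dots> = 2 * (\<Sum>X\<in>Pow J. (?S X) ^ 4) + (a j)\<^sup>2 * (12 * (\<Sum>X\<in>Pow J. (?S X)\<^sup>2))
                  + (a j) ^ 4 * (2 * 2 ^ card J)"
    using insert.hyps by (simp add: sum.distrib sum_distrib_left card_Pow algebra_simps)
  also have "\<dots> \<le> 2 * (3 * ?n\<^sup>2 * 2 ^ card J) + 1 * (12 * (?n * 2 ^ card J)) + 1 * (2 * 2 ^ card J)"
    using insert a a4 second by (intro add_mono mult_mono) (auto intro!: sum_nonneg)
  \<comment> \<open>Up to the power of 2 this is \<open>3 n^2 + 6 n + 1 \<le> 3 (n + 1)^2\<close>;
    the 3 is the fourth moment of a standard Gaussian.\<close>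
  also have "\<dots> \<le> 3 * (real (card (insert j J)))\<^sup>2 * 2 ^ card (insert j J)"
    using insert.hyps by (simp add: algebra_simps power2_eq_square)
  finally show ?case .
qed simp

text \<open>Integer vectors are counted with the weight \<open>\<rho> ^ \<bar>r i\<bar>\<close> per coordinate.\<close>

lemma card_small_int_vectors:
  fixes \<rho> :: real and s :: nat
  assumes "finite I" "0 < \<rho>" "\<rho> < 1"
  shows "real (card {r \<in> I \<rightarrow>\<^sub>E {- int s..int s}. (\<Sum>i\<in>I. nat \<bar>r i\<bar>) \<le> s}) * \<rho> ^ s
    \<le> ((1 + \<rho>) / (1 - \<rho>)) ^ card I" (is "real (card ?F) * _ \<le> _")
proof -
  let ?B = "I \<rightarrow>\<^sub>E {- int s..int s}"
  have finB: "finite ?B" using assms by (intro finite_PiE) auto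
  have geo: "(\<Sum>k<n. \<rho> ^ k) \<le> 1 / (1 - \<rho>)" for n
    using assms by (auto simp: sum_gp_strict divide_simps)
  have one: "(\<Sum>v\<in>{- int s..int s}. \<rho> ^ nat \<bar>v\<bar>) \<le> (1 + \<rho>) / (1 - \<rho>)"
  proof -
    have "{- int s..int s} = (\<lambda>k. int k) ` {..s} \<union> (\<lambda>k. - int (Suc k)) ` {..<s}"
    proof (intro set_eqI iffI)
      fix x assume x: "x \<in> {- int s..int s}"
      show "x \<in> (\<lambda>k. int k) ` {..s} \<union> (\<lambda>k. - int (Suc k)) ` {..<s}"
      proof (cases "x \<ge> 0")
        case True
        then have "x = int (nat x)" "nat x \<le> s" using x by auto
        then show ?thesis by blast
      next
        case False
        then have "x = - int (Suc (nat (-x-1)))" "nat (-x-1) < s" using x by auto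
        then show ?thesis by blast
      qed
    qed auto
    then have "(\<Sum>v\<in>{- int s..int s}. \<rho> ^ nat \<bar>v\<bar>)
       = (\<Sum>v\<in>(\<lambda>k. int k) ` {..s}. \<rho> ^ nat \<bar>v\<bar>) + (\<Sum>v\<in>(\<lambda>k. - int (Suc k)) ` {..<s}. \<rho> ^ nat \<bar>v\<bar>)"
      by (simp only:) (rule sum.union_disjoint, auto)
    also have "\<dots> = (\<Sum>k\<le>s. \<rho> ^ k) + (\<Sum>k<s. \<rho> ^ Suc k)"
      by (subst sum.reindex, force simp: inj_on_def, subst sum.reindex, force simp: inj_on_def)
        (simp add: nat_add_distrib)
    also have "\<dots> = (\<Sum>k<Suc s. \<rho> ^ k) + \<rho> * (\<Sum>k<s. \<rho> ^ k)"
      by (simp add: lessThan_Suc_atMost sum_distrib_left)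
    also have "\<dots> \<le> 1 / (1 - \<rho>) + \<rho> * (1 / (1 - \<rho>))"
      using assms by (intro add_mono mult_left_mono geo) auto
    finally show ?thesis by (simp add: add_divide_distrib)
  qed
  have "real (card ?F) * \<rho> ^ s = (\<Sum>r\<in>?F. \<rho> ^ s)" by simp
  also have "\<dots> \<le> (\<Sum>r\<in>?F. \<Prod>i\<in>I. \<rho> ^ nat \<bar>r i\<bar>)"
    unfolding power_sum[symmetric] using assms by (intro sum_mono power_decreasing) auto
  also have "\<dots> \<le> (\<Sum>r\<in>?B. \<Prod>i\<in>I. \<rho> ^ nat \<bar>r i\<bar>)"
    using finB assms by (intro sum_mono2) (auto intro!: prod_nonneg)
  also have "\<dots> = (\<Prod>i\<in>I. \<Sum>v\<in>{- int s..int s}. \<rho> ^ nat \<bar>v\<bar>)"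
    using assms by (subst prod_sum_PiE) auto
  also have "\<dots> \<le> (\<Prod>i\<in>I. (1 + \<rho>) / (1 - \<rho>))"
    using assms one by (intro prod_mono) (auto intro!: sum_nonneg)
  finally show "real (card ?F) * \<rho> ^ s \<le> ((1 + \<rho>) / (1 - \<rho>)) ^ card I" by simp
qed

section \<open>Counting in Hamming balls\<close>

lemma sum_power_card_Pow:
  assumes "finite J"
  shows "(\<Sum>X\<in>Pow J. (x::real) ^ card X) = (1 + x) ^ card J"
  using assms
proof (induction J rule: finite_induct)
  case (insert j J)
  have "(\<Sum>X\<in>Pow J. x ^ card (insert j X)) = (\<Sum>X\<in>Pow J. x * x ^ card X)"
  proof (intro sum.cong refl)
    fix X assume "X \<in> Pow J"
    then have "finite X" "j \<notin> X" using insert.hyps finite_subset by auto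
    then show "x ^ card (insert j X) = x * x ^ card X" by simp
  qed
  then show ?case
    using insert by (simp add: sum_Pow_insert[OF insert.hyps] sum_distrib_left[symmetric] algebra_simps)
qed simp

text \<open>Exponential weighting: each member of the ball has weight at least \<open>x ^ k\<close>,
  and the weights of all subsets multiply out to \<open>(1 + x) ^ card J\<close>.\<close>

lemma hamming_ball_card:
  assumes "finite J" "X0 \<subseteq> J" "0 < x" "x \<le> (1::real)"
  shows "real (card {X. X \<subseteq> J \<and> card (sym_diff X X0) \<le> k}) * x ^ k \<le> (1 + x) ^ card J"
proof -
  let ?B = "{X. X \<subseteq> J \<and> card (sym_diff X X0) \<le> k}"
  have fin: "finite ?B" using assms(1) by auto
  have "real (card ?B) * x ^ k = (\<Sum>X\<in>?B. x ^ k)" by simp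
  also have "\<dots> \<le> (\<Sum>X\<in>?B. x ^ card (sym_diff X X0))"
    using assms by (intro sum_mono power_decreasing) auto
  also have "\<dots> = (\<Sum>Y\<in>(\<lambda>X. sym_diff X X0) ` ?B. x ^ card Y)"
    by (subst sum.reindex) (auto simp: inj_on_def)
  also have "\<dots> \<le> (\<Sum>Y\<in>Pow J. x ^ card Y)"
    using assms by (intro sum_mono2) auto
  finally show ?thesis using sum_power_card_Pow[OF assms(1)] by simp
qed

text \<open>Weight \<open>1/4\<close> and \<open>4 \<le> (11/10) ^ 16\<close> give the base
  \<open>5/4 * 11/10\<close>. In the pigeonhole argument it is multiplied by
  \<open>(11/10)^2\<close>, and the product \<open>1331/800\<close> has to stay below 2.\<close>

lemma hamming_ball_card_sixteenth:
  assumes "finite J" "X0 \<subseteq> J"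
  shows "real (card {X. X \<subseteq> J \<and> card (sym_diff X X0) \<le> card J div 16}) \<le> (11/8) ^ card J"
proof -
  let ?c = "real (card {X. X \<subseteq> J \<and> card (sym_diff X X0) \<le> card J div 16})"
  have "(4::real) ^ (card J div 16) \<le> ((11/10) ^ 16) ^ (card J div 16)"
    by (intro power_mono) (auto simp: power_divide)
  also have "\<dots> \<le> (11/10) ^ card J"
    unfolding power_mult[symmetric] by (intro power_increasing) auto
  finally have four: "(4::real) ^ (card J div 16) \<le> (11/10) ^ card J" .
  have "?c * (1/4) ^ (card J div 16) \<le> (1 + 1/4) ^ card J"
    by (intro hamming_ball_card assms) auto
  then have "?c \<le> (5/4) ^ card J * 4 ^ (card J div 16)"
    by (simp add: power_divide field_simps)
  also have "\<dots> \<le> (5/4) ^ card J * (11/10) ^ card J"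
    using four by (intro mult_left_mono) auto
  finally show ?thesis by (simp flip: power_mult_distrib)
qed

text \<open>
Beck's pigeonhole argument, with a fourth moment in place of entropy: rounding the row sums of a sign
vector to multiples of \<open>2 b\<close> gives an integer vector \<open>R\<close> whose mean \<open>l^1\<close> norm is small, so half of the sign
vectors fall into few classes, and the largest class does not fit into a Hamming ball of radius
\<open>card J div 16\<close>.  Half the difference of two distant members is the partial colouring.
\<close>

lemma partial_colouring:
  fixes a :: "'i \<Rightarrow> 'j \<Rightarrow> real"
  assumes fin: "finite J" "finite I" and le: "card J \<le> card I" and n8: "8 \<le> card J"
    and a: "\<And>i j. i \<in> I \<Longrightarrow> j \<in> J \<Longrightarrow> \<bar>a i j\<bar> \<le> 1"
  shows "\<exists>\<xi>. (\<forall>j\<in>J. \<xi> j \<in> {-1, 0, 1}) \<and> 16 * card {j \<in> J. \<xi> j = 0} \<le> 15 * card J \<and>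
    (\<forall>i\<in>I. \<bar>\<Sum>j\<in>J. a i j * \<xi> j\<bar>
      \<le> 7 * (sqrt (card I) * (real (card J) / card I) powr (1/8)))"
proof -
  define n where "n = card J"
  define m where "m = card I"
  define w where "w = (real n / real m) powr (1/8)"
  define b where "b = 7 * (sqrt m * w)"
  have n0: "n \<ge> 8" and m0: "m > 0" "n \<le> m" using n8 le by (auto simp: n_def m_def)
  have w0: "w > 0" using n0 m0 by (simp add: w_def)
  have w8: "w ^ 8 = real n / real m"
    using n0 m0 by (simp add: w_def powr_powr flip: powr_realpow)
  have w1: "w \<le> 1"
    using n0 m0 by (auto simp: w_def intro!: powr_le1)
  have n_eq: "real n = m * w ^ 8" using w8 m0 by simp
  have b0: "b > 0" using m0 w0 by (simp add: b_def)
  have "(sqrt m) ^ 4 = (real m)\<^sup>2"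
    using m0 by (simp add: power4_eq_xxxx power2_eq_square)
  then have b4: "b ^ 4 = 2401 * (real m)\<^sup>2 * w ^ 4"
    by (simp add: b_def power_mult_distrib)
  \<comment> \<open>Twice the bound on the mean \<open>l^1\<close> norm of \<open>R\<close>, so that
    Markov's inequality leaves at least half of the sign vectors in \<open>G\<close>.\<close>
  define \<sigma> where "\<sigma> = 6 * m * w ^ 12 / 2401"
  have \<sigma>0: "\<sigma> > 0" using m0 w0 by (simp add: \<sigma>_def)
  define s where "s = nat \<lfloor>\<sigma>\<rfloor>"
  \<comment> \<open>Proportional to \<open>n / m\<close>, so that the \<open>m\<close> factors
    \<open>exp (3 * \<rho>)\<close> cost only \<open>exp (3/64) ^ n\<close>.\<close>
  define \<rho> where "\<rho> = w ^ 8 / 64"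
  have "w ^ 8 \<le> 1" using w0 w1 by (intro power_le_one) auto
  then have \<rho>: "0 < \<rho>" "\<rho> \<le> 1/64" using w0 by (auto simp: \<rho>_def)
  define L where "L = (\<lambda>i X. \<Sum>j\<in>J. a i j * sg X j)"
  define R where "R = (\<lambda>i X. \<lfloor>L i X / (2 * b) + 1/2\<rfloor>)"
  define G where "G = {X \<in> Pow J. (\<Sum>i\<in>I. nat \<bar>R i X\<bar>) \<le> s}"
  define F where "F = {r \<in> I \<rightarrow>\<^sub>E {- int s..int s}. (\<Sum>i\<in>I. nat \<bar>r i\<bar>) \<le> s}"
  \<comment> \<open>The rounding is 0 where \<open>\<bar>L i X / b\<bar> < 1\<close> and at most
    \<open>\<bar>L i X / b\<bar>\<close> elsewhere; in both cases the fourth power dominates, which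
    brings in the fourth moment.\<close>
  have R: "real (nat \<bar>R i X\<bar>) \<le> (L i X / b) ^ 4" for i X
  proof (cases "\<bar>L i X / b\<bar> < 1")
    case True
    moreover have "L i X / (2 * b) = (L i X / b) / 2" by simp
    ultimately have "R i X = 0" unfolding R_def by linarith
    then show ?thesis by simp
  next
    case False
    define x where "x = \<bar>L i X / b\<bar>"
    have x: "x \<ge> 1" using False by (simp add: x_def)
    have "real (nat \<bar>R i X\<bar>) = \<bar>real_of_int (R i X)\<bar>" by simp
    also have "\<dots> \<le> x"
    proof -
      have "L i X / (2 * b) = (L i X / b) / 2" by simp
      then show ?thesis using x unfolding x_def R_def by linarith
    qed
    also have "x ^ 1 \<le> x ^ 4" using x by (intro power_increasing) auto
    then have "x \<le> x ^ 4" by simp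
    finally show ?thesis by (simp only: x_def power_even_abs_numeral even_numeral)
  qed
  have "(\<Sum>X\<in>Pow J. \<Sum>i\<in>I. real (nat \<bar>R i X\<bar>)) \<le> (\<Sum>X\<in>Pow J. \<Sum>i\<in>I. (L i X / b) ^ 4)"
    by (intro sum_mono R)
  also have "\<dots> = (\<Sum>i\<in>I. (\<Sum>X\<in>Pow J. L i X ^ 4) / b ^ 4)"
    by (subst sum.swap) (simp add: power_divide sum_divide_distrib)
  also have "\<dots> \<le> (\<Sum>i\<in>I. (3 * (real n)\<^sup>2 * 2 ^ n) / b ^ 4)"
    unfolding L_def n_def using fin a b0
    by (intro sum_mono divide_right_mono fourth_moment_signed_sums) auto
  also have "\<dots> = \<sigma> * 2 ^ n / 2"
    unfolding b4 \<sigma>_def n_eq using m0 w0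
    by (simp add: m_def[symmetric] field_simps power2_eq_square)
  finally have total: "(\<Sum>X\<in>Pow J. \<Sum>i\<in>I. real (nat \<bar>R i X\<bar>)) \<le> \<sigma> * 2 ^ n / 2" .
  have finG: "finite G" using fin by (simp add: G_def)
  have "\<sigma> * card (Pow J - G) = (\<Sum>X\<in>Pow J - G. \<sigma>)" by simp
  also have "\<dots> \<le> (\<Sum>X\<in>Pow J - G. \<Sum>i\<in>I. real (nat \<bar>R i X\<bar>))"
  proof (intro sum_mono)
    fix X assume "X \<in> Pow J - G"
    then have "s < (\<Sum>i\<in>I. nat \<bar>R i X\<bar>)" by (auto simp: G_def)
    then have "\<sigma> < real (\<Sum>i\<in>I. nat \<bar>R i X\<bar>)" unfolding s_def by linarith
    then show "\<sigma> \<le> (\<Sum>i\<in>I. real (nat \<bar>R i X\<bar>))" by simp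
  qed
  also have "\<dots> \<le> (\<Sum>X\<in>Pow J. \<Sum>i\<in>I. real (nat \<bar>R i X\<bar>))"
    using fin by (intro sum_mono2) (auto intro: sum_nonneg)
  also note total
  finally have "real (card (Pow J - G)) \<le> 2 ^ n / 2" using \<sigma>0 by simp
  moreover have "card (Pow J) = card G + card (Pow J - G)"
    using fin by (subst card_Un_disjoint[symmetric]) (auto simp: G_def intro!: arg_cong[of _ _ card])
  ultimately have cardG: "2 ^ n / 2 \<le> real (card G)"
    using fin by (simp add: card_Pow n_def flip: of_nat_eq_iff[where ?'a = real])
  have finF: "finite F"
    using finite_PiE[of I "\<lambda>_. {- int s..int s}"] fin unfolding F_def by auto
  have cardF: "real (card F) \<le> (11/10) ^ n * (11/10) ^ n"
  proof -
    have "real (card F) * \<rho> ^ s \<le> ((1 + \<rho>) / (1 - \<rho>)) ^ m"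
      unfolding F_def m_def using fin \<rho> by (intro card_small_int_vectors) auto
    also have "\<dots> \<le> exp (3 * \<rho>) ^ m"
    proof (intro power_mono)
      have "(1 + \<rho>) / (1 - \<rho>) \<le> 1 + 3 * \<rho>"
        using \<rho> mult_left_mono[of \<rho> "1/64" \<rho>] by (simp add: divide_simps algebra_simps)
      also have "\<dots> \<le> exp (3 * \<rho>)" by (rule exp_ge_add_one_self)
      finally show "(1 + \<rho>) / (1 - \<rho>) \<le> exp (3 * \<rho>)" .
    qed (use \<rho> in auto)
    also have "\<dots> = exp (3/64) ^ n"
      unfolding exp_of_nat_mult[symmetric] n_eq by (simp add: \<rho>_def)
    finally have 1: "real (card F) * \<rho> ^ s \<le> exp (3/64) ^ n" .
    have "ln (1 / \<rho>) = 2 * ln (8 / w ^ 4)"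
    proof -
      have "1 / \<rho> = (8 / w ^ 4) ^ 2" by (simp add: \<rho>_def power_divide flip: power_mult)
      then show ?thesis using w0 by (simp add: ln_realpow)
    qed
    also have "\<dots> \<le> 2 * (8 / w ^ 4)" using w0 ln_le_minus_one[of "8 / w ^ 4"] by simp
    finally have lnr: "ln (1 / \<rho>) \<le> 16 / w ^ 4" by simp
    have "(1 / \<rho>) ^ s = exp (s * ln (1 / \<rho>))"
      using \<rho> by (simp add: exp_of_nat_mult)
    also have "\<dots> \<le> exp (\<sigma> * (16 / w ^ 4))"
    proof -
      have "real s \<le> \<sigma>" using \<sigma>0 unfolding s_def by linarith
      then have "real s * ln (1 / \<rho>) \<le> \<sigma> * (16 / w ^ 4)"
        using lnr \<rho> \<sigma>0 by (intro mult_mono) auto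
      then show ?thesis by simp
    qed
    also have "\<sigma> * (16 / w ^ 4) = n * (96/2401)"
      unfolding \<sigma>_def n_eq using w0 by (simp add: field_simps)
    finally have 2: "(1 / \<rho>) ^ s \<le> exp (96/2401) ^ n" by (simp only: exp_of_nat_mult)
    have "real (card F) = real (card F) * \<rho> ^ s * (1 / \<rho>) ^ s"
      using \<rho> by (simp add: power_divide)
    also have "\<dots> \<le> exp (3/64) ^ n * exp (96/2401) ^ n"
      using 1 2 \<rho> by (intro mult_mono) auto
    also have "\<dots> \<le> (11/10) ^ n * (11/10) ^ n"
      using exp_bound[of "3/64"] exp_bound[of "96/2401"]
      by (intro mult_mono power_mono) (auto simp: power2_eq_square)
    finally show ?thesis .
  qed
  have "\<exists>X0\<in>G. \<exists>X1\<in>G. card J div 16 < card (sym_diff X1 X0) \<and> (\<forall>i\<in>I. R i X1 = R i X0)"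
  proof (rule ccontr)
    assume neg: "\<not> ?thesis"
    define \<phi> where "\<phi> = (\<lambda>X. restrict (\<lambda>i. R i X) I)"
    have into: "\<phi> ` G \<subseteq> F"
    proof (clarsimp simp: F_def)
      fix X assume X: "X \<in> G"
      have eq: "(\<Sum>i\<in>I. nat \<bar>\<phi> X i\<bar>) = (\<Sum>i\<in>I. nat \<bar>R i X\<bar>)"
        by (intro sum.cong) (auto simp: \<phi>_def)
      have "R i X \<in> {- int s..int s}" if "i \<in> I" for i
      proof -
        have "nat \<bar>R i X\<bar> \<le> (\<Sum>i\<in>I. nat \<bar>R i X\<bar>)"
          using fin that by (intro member_le_sum) auto
        also have "\<dots> \<le> s" using X by (simp add: G_def)
        finally show ?thesis by auto
      qed
      then show "\<phi> X \<in> I \<rightarrow>\<^sub>E {- int s..int s} \<and> (\<Sum>i\<in>I. nat \<bar>\<phi> X i\<bar>) \<le> s"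
        using X eq by (auto simp: \<phi>_def G_def)
    qed
    have fibre: "real (card {X \<in> G. \<phi> X = r}) \<le> (11/8) ^ n" for r
    proof (cases "{X \<in> G. \<phi> X = r} = {}")
      case False
      then obtain X0 where X0: "X0 \<in> G" "\<phi> X0 = r" by auto
      have "{X \<in> G. \<phi> X = r} \<subseteq> {X. X \<subseteq> J \<and> card (sym_diff X X0) \<le> card J div 16}"
      proof (rule subsetI)
        fix X assume "X \<in> {X \<in> G. \<phi> X = r}"
        then have X: "X \<in> G" "\<phi> X = \<phi> X0" using X0 by auto
        have "R i X = R i X0" if "i \<in> I" for i
          using fun_cong[OF X(2), of i] that by (simp add: \<phi>_def)
        then have "\<not> card J div 16 < card (sym_diff X X0)"
          using neg X(1) X0(1) by blast
        then show "X \<in> {X. X \<subseteq> J \<and> card (sym_diff X X0) \<le> card J div 16}"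
          using X(1) by (simp add: G_def)
      qed
      then have "card {X \<in> G. \<phi> X = r} \<le> card {X. X \<subseteq> J \<and> card (sym_diff X X0) \<le> card J div 16}"
        using fin by (intro card_mono) auto
      also have "real \<dots> \<le> (11/8) ^ n"
        unfolding n_def using fin X0 by (intro hamming_ball_card_sixteenth) (auto simp: G_def)
      finally show ?thesis by simp
    next
      case True
      then show ?thesis by (simp only: card.empty) simp
    qed
    have "real (card G) = (\<Sum>r\<in>F. real (card {X \<in> G. \<phi> X = r}))"
      using sum.group[OF finG finF into, of "\<lambda>_. 1 :: real"] by simp
    also have "\<dots> \<le> (\<Sum>r\<in>F. (11/8) ^ n)" by (intro sum_mono fibre)
    also have "\<dots> \<le> ((11/10) ^ n * (11/10) ^ n) * (11/8) ^ n"
      using cardF by (simp add: mult_right_mono)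
    also have "\<dots> = (1331/800) ^ n" by (simp flip: power_mult_distrib)
    finally have "2 ^ n / 2 \<le> (1331/800 :: real) ^ n" using cardG by linarith
    then have "(2 / (1331/800)) ^ n \<le> (2 :: real)" unfolding power_divide[of 2] by (simp add: field_simps)
    then have "(1600/1331 :: real) ^ n \<le> 2" by simp
    moreover have "(1600/1331 :: real) ^ 8 \<le> (1600/1331) ^ n" using n0 by (intro power_increasing) auto
    moreover have "(1600/1331 :: real) ^ 8 > 2" by (simp add: power_divide)
    ultimately show False by linarith
  qed
  then obtain X0 X1 where X: "X0 \<in> G" "X1 \<in> G" and far: "card J div 16 < card (sym_diff X1 X0)"
    and eq: "\<And>i. i \<in> I \<Longrightarrow> R i X1 = R i X0" by blast
  define \<xi> where "\<xi> = (\<lambda>j. (sg X1 j - sg X0 j) / 2)"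
  have "{j \<in> J. \<xi> j = 0} = J - sym_diff X1 X0"
    using X by (auto simp: \<xi>_def sg_def split: if_splits)
  moreover have "sym_diff X1 X0 \<subseteq> J" using X by (auto simp: G_def)
  ultimately have "card {j \<in> J. \<xi> j = 0} = card J - card (sym_diff X1 X0)"
    using fin card_Diff_subset[of "sym_diff X1 X0" J] finite_subset[of "sym_diff X1 X0" J] by metis
  then have "16 * card {j \<in> J. \<xi> j = 0} \<le> 15 * card J" using far by linarith
  moreover have "\<bar>\<Sum>j\<in>J. a i j * \<xi> j\<bar> \<le> b" if i: "i \<in> I" for i
  proof -
    have "(\<Sum>j\<in>J. a i j * \<xi> j) = (L i X1 - L i X0) / 2"
      by (simp add: \<xi>_def L_def sum_divide_distrib right_diff_distrib diff_divide_distrib sum_subtractf)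
    moreover have "\<bar>L i X1 / (2 * b) - L i X0 / (2 * b)\<bar> < 1"
      using eq[OF i] unfolding R_def by linarith
    then have "\<bar>L i X1 - L i X0\<bar> < 2 * b" using b0 by (simp add: field_simps flip: diff_divide_distrib)
    ultimately show ?thesis by simp
  qed
  moreover have "\<forall>j\<in>J. \<xi> j \<in> {-1, 0, 1}" by (auto simp: \<xi>_def sg_def)
  ultimately show ?thesis unfolding b_def w_def n_def m_def by (intro exI[of _ \<xi>]) blast
qed

section \<open>Iterating the partial colouring\<close>

text \<open>Bernoulli: \<open>(1 - 1/128) ^ 8 \<ge> 1 - 8/128 = 15/16\<close>, the fraction that a
  partial colouring may leave uncoloured.\<close>

lemma powr_eighth_shrink:
  assumes "0 \<le> x" "16 * y \<le> 15 * x" "0 \<le> (y::real)"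
  shows "y powr (1/8) \<le> 127/128 * x powr (1/8)"
proof -
  have "y \<le> (127/128) ^ 8 * x"
    using assms by (simp add: power_divide)
  then have "y powr (1/8) \<le> ((127/128) ^ 8 * x) powr (1/8)"
    using assms by (intro powr_mono2) auto
  also have "\<dots> = 127/128 * x powr (1/8)"
    using assms by (simp add: powr_mult powr_powr flip: powr_numeral)
  finally show ?thesis .
qed

text \<open>Spencer's iteration: recolour the zeros of a partial colouring until none is left. The
  errors decay with ratio \<open>127/128\<close>, whence \<open>896 = 7 * 128\<close>. The factor
  with exponent \<open>1/8\<close> is the gain for few columns against many rows on which
  \<open>bump_signs\<close> relies.\<close>

theorem sign_colouring:
  fixes a :: "'i \<Rightarrow> 'j \<Rightarrow> real"
  assumes "finite J" "finite I" "card J \<le> card I"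
    and "\<And>i j. i \<in> I \<Longrightarrow> j \<in> J \<Longrightarrow> \<bar>a i j\<bar> \<le> 1"
  shows "\<exists>\<xi>. (\<forall>j\<in>J. \<xi> j \<in> {-1, 1}) \<and>
    (\<forall>i\<in>I. \<bar>\<Sum>j\<in>J. a i j * \<xi> j\<bar>
      \<le> 896 * (sqrt (card I) * (real (card J) / card I) powr (1/8)))"
  using assms
proof (induction "card J" arbitrary: J rule: less_induct)
  case less
  note fin = less.prems(1,2) and a = less.prems(4)
  define H where "H = (\<lambda>k. sqrt (card I) * (real k / card I) powr (1/8))"
  have H0: "H k \<ge> 0" for k by (simp add: H_def)
  show ?case
  proof (cases "card J < 8")
    case True
    \<comment> \<open>Too few columns for \<open>partial_colouring\<close>; constant signs suffice
      because \<open>sqrt m * (1 / m) powr (1/8) \<ge> 1\<close> for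
      \<open>m = card I\<close>.\<close>
    have "\<bar>\<Sum>j\<in>J. a i j * 1\<bar> \<le> 896 * H (card J)" if i: "i \<in> I" for i
    proof (cases "card J = 0")
      case True
      then show ?thesis using fin H0 by simp
    next
      case False
      have cI: "real (card I) \<ge> 1" using False less.prems(3) by simp
      have "\<bar>\<Sum>j\<in>J. a i j * 1\<bar> \<le> (\<Sum>j\<in>J. 1)"
        using a i by (intro order_trans[OF sum_abs] sum_mono) auto
      also have "\<dots> \<le> 8 * 1" using True by simp
      also have "1 \<le> sqrt (card I) * (1 / card I) powr (1/8)"
      proof -
        have "sqrt (card I) * (1 / card I) powr (1/8) = real (card I) powr (1/2 - 1/8)"
          using cI unfolding powr_diff by (simp add: powr_half_sqrt powr_divide)
        then show ?thesis using cI by (simp add: ge_one_powr_ge_zero)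
      qed
      also have "\<dots> \<le> H (card J)"
        unfolding H_def using False by (intro mult_left_mono powr_mono2 divide_right_mono) auto
      finally show ?thesis using H0[of "card J"] by simp
    qed
    then show ?thesis unfolding H_def by (intro exI[of _ "\<lambda>_. 1"]) auto
  next
    case False
    have "\<exists>\<xi>. (\<forall>j\<in>J. \<xi> j \<in> {-1, 0, 1}) \<and> 16 * card {j \<in> J. \<xi> j = 0} \<le> 15 * card J \<and>
        (\<forall>i\<in>I. \<bar>\<Sum>j\<in>J. a i j * \<xi> j\<bar> \<le> 7 * H (card J))"
      unfolding H_def using False less.prems(3) by (intro partial_colouring fin a) auto
    then obtain \<xi> where \<xi>: "\<And>j. j \<in> J \<Longrightarrow> \<xi> j \<in> {-1, 0, 1}"
      "16 * card {j \<in> J. \<xi> j = 0} \<le> 15 * card J"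
      "\<And>i. i \<in> I \<Longrightarrow> \<bar>\<Sum>j\<in>J. a i j * \<xi> j\<bar> \<le> 7 * H (card J)" by blast
    define Z where "Z = {j \<in> J. \<xi> j = 0}"
    have Z: "Z \<subseteq> J" "finite Z" using fin by (auto simp: Z_def)
    have "card Z < card J" using \<xi>(2) False by (simp add: Z_def)
    moreover have "card Z \<le> card I" using \<open>card Z < card J\<close> less.prems(3) by simp
    ultimately have "\<exists>\<eta>. (\<forall>j\<in>Z. \<eta> j \<in> {-1, 1}) \<and> (\<forall>i\<in>I. \<bar>\<Sum>j\<in>Z. a i j * \<eta> j\<bar> \<le> 896 * H (card Z))"
      unfolding H_def using Z(1) a by (intro less.hyps Z(2) fin(2)) auto
    then obtain \<eta> where \<eta>: "\<And>j. j \<in> Z \<Longrightarrow> \<eta> j \<in> {-1, 1}"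
      "\<And>i. i \<in> I \<Longrightarrow> \<bar>\<Sum>j\<in>Z. a i j * \<eta> j\<bar> \<le> 896 * H (card Z)" by blast
    have HZ: "H (card Z) \<le> 127/128 * H (card J)"
    proof -
      have "(real (card Z) / card I) powr (1/8) \<le> 127/128 * (real (card J) / card I) powr (1/8)"
        using \<xi>(2) by (intro powr_eighth_shrink) (auto simp: Z_def field_simps divide_right_mono)
      then show ?thesis unfolding H_def
        by (metis mult.left_commute mult_left_mono real_sqrt_ge_zero of_nat_0_le_iff)
    qed
    define \<zeta> where "\<zeta> = (\<lambda>j. if j \<in> Z then \<eta> j else \<xi> j)"
    have "\<bar>\<Sum>j\<in>J. a i j * \<zeta> j\<bar> \<le> 896 * H (card J)" if i: "i \<in> I" for i
    proof -
      have "(\<Sum>j\<in>J. a i j * \<zeta> j) = (\<Sum>j\<in>J. a i j * \<xi> j + (if j \<in> Z then a i j * \<eta> j else 0))"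
        by (intro sum.cong) (auto simp: \<zeta>_def Z_def)
      also have "\<dots> = (\<Sum>j\<in>J. a i j * \<xi> j) + (\<Sum>j\<in>Z. a i j * \<eta> j)"
        using fin Z by (simp add: sum.distrib sum.inter_restrict[symmetric] Int_absorb1)
      finally show ?thesis using \<xi>(3)[OF i] \<eta>(2)[OF i] HZ by linarith
    qed
    moreover have "\<forall>j\<in>J. \<zeta> j \<in> {-1, 1}" using \<xi>(1) \<eta>(1) by (auto simp: \<zeta>_def Z_def)
    ultimately show ?thesis unfolding H_def by blast
  qed
qed

text \<open>The argument of Lovasz, Spencer and Vesztergombi: round away the last binary digit by a colouring.\<close>

lemma dyadic_rounding:
  fixes a :: "'i \<Rightarrow> 'j \<Rightarrow> real" and Y :: "'j \<Rightarrow> nat"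
  assumes "finite J"
    and col: "\<And>K. K \<subseteq> J \<Longrightarrow> \<exists>\<xi>. (\<forall>j\<in>K. \<xi> j \<in> {-1, 1}) \<and> (\<forall>i\<in>I. \<bar>\<Sum>j\<in>K. a i j * \<xi> j\<bar> \<le> H)"
    and "\<And>j. j \<in> J \<Longrightarrow> Y j \<le> 2 ^ k"
  shows "\<exists>\<epsilon>. (\<forall>j\<in>J. \<epsilon> j \<in> {0, 1}) \<and> (\<forall>i\<in>I. \<bar>\<Sum>j\<in>J. a i j * (\<epsilon> j - Y j / 2 ^ k)\<bar> \<le> (1 - 1 / 2 ^ k) * H)"
  using assms(3)
proof (induction k arbitrary: Y)
  case 0
  then have "\<And>j. j \<in> J \<Longrightarrow> Y j = 0 \<or> Y j = 1" by force
  then show ?case by (intro exI[of _ "\<lambda>j. real (Y j)"]) auto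
next
  case (Suc k)
  define K where "K = {j \<in> J. odd (Y j)}"
  obtain \<xi> where \<xi>: "\<And>j. j \<in> K \<Longrightarrow> \<xi> j \<in> {-1, 1::real}" "\<And>i. i \<in> I \<Longrightarrow> \<bar>\<Sum>j\<in>K. a i j * \<xi> j\<bar> \<le> H"
    using col[of K] by (auto simp: K_def)
  \<comment> \<open>An odd numerator moves to a neighbouring even one as \<open>\<xi>\<close>
    prescribes. This level costs \<open>H / 2 ^ Suc k\<close>, and all levels together at most
    \<open>H\<close>.\<close>
  define Y' where "Y' = (\<lambda>j. if j \<in> K \<and> \<xi> j = 1 then Y j div 2 + 1 else Y j div 2)"
  have "Y' j \<le> 2 ^ k" if "j \<in> J" for j
  proof -
    have le: "Y j \<le> 2 * 2 ^ k" using Suc.prems[OF that] by simp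
    show ?thesis
    proof (cases "odd (Y j)")
      case True
      then have "Y j \<noteq> 2 * 2 ^ k" by auto
      then have "Y j div 2 + 1 \<le> 2 ^ k" using le by linarith
      then show ?thesis by (simp add: Y'_def)
    next
      case False
      then show ?thesis using le by (simp add: Y'_def K_def)
    qed
  qed
  with Suc.IH[of Y'] obtain \<epsilon> where \<epsilon>: "\<And>j. j \<in> J \<Longrightarrow> \<epsilon> j \<in> {0, 1::real}"
    "\<And>i. i \<in> I \<Longrightarrow> \<bar>\<Sum>j\<in>J. a i j * (\<epsilon> j - Y' j / 2 ^ k)\<bar> \<le> (1 - 1 / 2 ^ k) * H" by blast
  have step: "real (Y' j) / 2 ^ k - Y j / 2 ^ Suc k = (if j \<in> K then \<xi> j else 0) / 2 ^ Suc k"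
    if "j \<in> J" for j
  proof -
    have "real (2 * Y' j) - Y j = (if j \<in> K then \<xi> j else 0)"
    proof (cases "odd (Y j)")
      case True
      then have "Y j = 2 * (Y j div 2) + 1" by presburger
      then have "real (Y j) = real (2 * (Y j div 2) + 1)" by (rule arg_cong)
      then have "real (Y j) = 2 * real (Y j div 2) + 1" by simp
      then show ?thesis using \<xi>(1)[of j] that True by (auto simp: Y'_def K_def)
    next
      case False
      then have "Y j = 2 * (Y j div 2)" by presburger
      then have "real (Y j) = real (2 * (Y j div 2))" by (rule arg_cong)
      then have "real (Y j) = 2 * real (Y j div 2)" by simp
      then show ?thesis using that False by (auto simp: Y'_def K_def)
    qed
    then show ?thesis by (simp add: field_simps)
  qed
  have "\<bar>\<Sum>j\<in>J. a i j * (\<epsilon> j - Y j / 2 ^ Suc k)\<bar> \<le> (1 - 1 / 2 ^ Suc k) * H" if i: "i \<in> I" for i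
  proof -
    have "(\<Sum>j\<in>J. a i j * (\<epsilon> j - Y j / 2 ^ Suc k))
        = (\<Sum>j\<in>J. a i j * (\<epsilon> j - Y' j / 2 ^ k) + a i j * (real (Y' j) / 2 ^ k - Y j / 2 ^ Suc k))"
      by (intro sum.cong) (auto simp: algebra_simps)
    also have "\<dots> = (\<Sum>j\<in>J. a i j * (\<epsilon> j - Y' j / 2 ^ k)) + (\<Sum>j\<in>J. if j \<in> K then a i j * \<xi> j else 0) / 2 ^ Suc k"
      unfolding sum.distrib sum_divide_distrib using step
      by (intro arg_cong2[of _ _ _ _ "(+)"] sum.cong) auto
    also have "(\<Sum>j\<in>J. if j \<in> K then a i j * \<xi> j else 0) = (\<Sum>j\<in>K. a i j * \<xi> j)"
      using assms(1) by (auto simp: K_def sum.inter_filter intro!: sum.cong)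
    finally have "\<bar>\<Sum>j\<in>J. a i j * (\<epsilon> j - Y j / 2 ^ Suc k)\<bar> \<le> (1 - 1 / 2 ^ k) * H + H / 2 ^ Suc k"
      using \<epsilon>(2)[OF i] divide_right_mono[OF \<xi>(2)[OF i], of "2 ^ Suc k"]
      by (intro order_trans[OF eq_refl[OF arg_cong[of _ _ abs]] order_trans[OF abs_triangle_ineq add_mono]])
        (auto simp: abs_divide)
    then show ?thesis by (simp add: field_simps)
  qed
  then show ?case using \<epsilon>(1) by blast
qed

text \<open>\<open>sign_colouring\<close> bounds every subset of the columns by the same
  \<open>H\<close>, which is the hereditary hypothesis of \<open>dyadic_rounding\<close>. Passing
  from \<open>{0, 1}\<close> to \<open>{-1, 1}\<close> doubles \<open>H\<close> and the truncation
  error 1.\<close>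

theorem sign_rounding:
  fixes a :: "'i \<Rightarrow> 'j \<Rightarrow> real"
  assumes fin: "finite J" "finite I" and le: "card J \<le> card I"
    and a: "\<And>i j. i \<in> I \<Longrightarrow> j \<in> J \<Longrightarrow> \<bar>a i j\<bar> \<le> 1"
    and x: "\<And>j. j \<in> J \<Longrightarrow> \<bar>x j\<bar> \<le> 1"
  shows "\<exists>\<epsilon>. (\<forall>j\<in>J. \<epsilon> j \<in> {-1, 1}) \<and>
    (\<forall>i\<in>I. \<bar>\<Sum>j\<in>J. a i j * (\<epsilon> j - x j)\<bar> \<le> 1792 * sqrt (card I) + 2)"
proof -
  define H where "H = 896 * sqrt (card I)"
  \<comment> \<open>With \<open>card J\<close> binary digits the truncation errors add up to at most
    \<open>k / 2 ^ k \<le> 1\<close>.\<close>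
  define k where "k = card J"
  define Y where "Y = (\<lambda>j. nat \<lfloor>2 ^ k * ((x j + 1) / 2)\<rfloor>)"
  have col: "\<exists>\<xi>. (\<forall>j\<in>K. \<xi> j \<in> {-1, 1}) \<and> (\<forall>i\<in>I. \<bar>\<Sum>j\<in>K. a i j * \<xi> j\<bar> \<le> H)" if K: "K \<subseteq> J" for K
  proof -
    have "card K \<le> card J" using K fin by (simp add: card_mono)
    then have "card K \<le> card I" using le by simp
    moreover have "(real (card K) / card I) powr (1/8) \<le> 1"
      using \<open>card K \<le> card I\<close> by (intro powr_le1) (auto simp: divide_le_eq_1)
    then have "896 * (sqrt (card I) * (real (card K) / card I) powr (1/8)) \<le> H"
      by (simp add: H_def mult_left_le)
    ultimately show ?thesis
      using sign_colouring[of K I a] K finite_subset[OF K fin(1)] fin(2) a by fastforce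
  qed
  have "\<exists>\<epsilon>. (\<forall>j\<in>J. \<epsilon> j \<in> {0, 1}) \<and> (\<forall>i\<in>I. \<bar>\<Sum>j\<in>J. a i j * (\<epsilon> j - Y j / 2 ^ k)\<bar> \<le> (1 - 1 / 2 ^ k) * H)"
  proof (rule dyadic_rounding[OF fin(1) col])
    fix j assume j: "j \<in> J"
    have "2 ^ k * ((x j + 1) / 2) \<le> 2 ^ k * 1" using x[OF j] by (intro mult_left_mono) auto
    moreover have "2 ^ k * ((x j + 1) / 2) \<ge> 0" using x[OF j] by simp
    ultimately have "real (Y j) \<le> 2 ^ k" unfolding Y_def by linarith
    then show "Y j \<le> 2 ^ k" by simp
  qed
  then obtain \<epsilon> where \<epsilon>: "\<And>j. j \<in> J \<Longrightarrow> \<epsilon> j \<in> {0, 1::real}"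
    "\<And>i. i \<in> I \<Longrightarrow> \<bar>\<Sum>j\<in>J. a i j * (\<epsilon> j - Y j / 2 ^ k)\<bar> \<le> (1 - 1 / 2 ^ k) * H" by blast
  have Y: "\<bar>Y j / 2 ^ k - (x j + 1) / 2\<bar> \<le> 1 / 2 ^ k" if j: "j \<in> J" for j
  proof -
    have "2 ^ k * ((x j + 1) / 2) \<ge> 0" using x[OF j] by simp
    then have "\<bar>Y j - 2 ^ k * ((x j + 1) / 2)\<bar> \<le> 1" unfolding Y_def by linarith
    then have "\<bar>Y j - 2 ^ k * ((x j + 1) / 2)\<bar> / 2 ^ k \<le> 1 / 2 ^ k" by (intro divide_right_mono) auto
    moreover have "Y j / 2 ^ k - (x j + 1) / 2 = (Y j - 2 ^ k * ((x j + 1) / 2)) / 2 ^ k"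
      by (simp add: field_simps)
    ultimately show ?thesis by (simp add: abs_divide)
  qed
  have "\<bar>\<Sum>j\<in>J. a i j * (2 * \<epsilon> j - 1 - x j)\<bar> \<le> 1792 * sqrt (card I) + 2" if i: "i \<in> I" for i
  proof -
    have "\<bar>\<Sum>j\<in>J. a i j * (Y j / 2 ^ k - (x j + 1) / 2)\<bar> \<le> (\<Sum>j\<in>J. 1 * (1 / 2 ^ k))"
      using a[OF i] Y unfolding abs_mult
      by (intro order_trans[OF sum_abs] sum_mono) (simp only: abs_mult, intro mult_mono, auto)
    also have "\<dots> \<le> 1"
      using of_nat_less_two_power[of k, where ?'a = real] by (simp add: k_def divide_le_eq_1)
    finally have 1: "\<bar>\<Sum>j\<in>J. a i j * (Y j / 2 ^ k - (x j + 1) / 2)\<bar> \<le> 1" .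
    have "(1 - 1 / 2 ^ k) * H \<le> 1 * H" by (intro mult_right_mono) (auto simp: H_def)
    then have 2: "\<bar>\<Sum>j\<in>J. a i j * (\<epsilon> j - Y j / 2 ^ k)\<bar> \<le> H" using \<epsilon>(2)[OF i] by linarith
    have "(\<Sum>j\<in>J. a i j * (2 * \<epsilon> j - 1 - x j)) = (\<Sum>j\<in>J. 2 * (a i j * (\<epsilon> j - Y j / 2 ^ k))
        + 2 * (a i j * (Y j / 2 ^ k - (x j + 1) / 2)))"
      by (intro sum.cong) (auto simp: algebra_simps)
    also have "\<dots> = 2 * (\<Sum>j\<in>J. a i j * (\<epsilon> j - Y j / 2 ^ k)) + 2 * (\<Sum>j\<in>J. a i j * (Y j / 2 ^ k - (x j + 1) / 2))"
      by (simp add: sum.distrib sum_distrib_left)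
    finally show ?thesis using 1 2 unfolding H_def by linarith
  qed
  moreover have "\<forall>j\<in>J. 2 * \<epsilon> j - 1 \<in> {-1, 1}" using \<epsilon>(1) by auto
  ultimately show ?thesis by (intro exI[of _ "\<lambda>j. 2 * \<epsilon> j - 1"]) blast
qed

section \<open>Fejer kernel\<close>

lemma norm_cis_diff: "cmod (cis x - cis y) = 2 * \<bar>sin ((x - y) / 2)\<bar>"
proof -
  have "cis y * cis (x - y) = cis x" by (simp add: cis_mult)
  then have "cis x - cis y = cis y * (exp (\<i> * of_real (x - y)) - 1)"
    by (simp add: right_diff_distrib cis_conv_exp)
  then show ?thesis by (simp only: norm_mult norm_cis dist_exp_i_1)
qed

lemma norm_cis_diff_le: "cmod (cis x - cis y) \<le> \<bar>x - y\<bar>"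
  using abs_sin_x_le_abs_x[of "(x - y) / 2"] unfolding norm_cis_diff by simp

lemma sin_ge_fifth:
  assumes "0 \<le> x" "x \<le> 3 * pi / 4"
  shows "x / 5 \<le> sin x"
proof (cases "x \<le> pi / 3")
  case True
  have "sin 0 - 0 / 2 \<le> sin x - x / 2"
  proof (rule DERIV_nonneg_imp_nondecreasing[OF assms(1)])
    fix t assume t: "0 \<le> t" "t \<le> x"
    have "cos (pi / 3) \<le> cos t" using t True by (intro cos_monotone_0_pi_le) auto
    then have "0 \<le> cos t - 1 / 2" by (simp add: cos_60)
    moreover have "((\<lambda>t. sin t - t / 2) has_real_derivative cos t - 1 / 2) (at t)"
      by (auto intro!: derivative_eq_intros)
    ultimately show "\<exists>y. ((\<lambda>t. sin t - t / 2) has_real_derivative y) (at t) \<and> 0 \<le> y" by blast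
  qed
  then show ?thesis using assms(1) by simp
next
  case False
  have "sin (pi / 6) \<le> sin (if x \<le> pi / 2 then x else pi - x)"
    using False assms by (intro sin_monotone_2pi_le) auto
  then have "1 / 2 \<le> sin x" by (simp add: sin_30 split: if_splits)
  moreover have "x \<le> 5 / 2" using assms(2) pi_approx by simp
  ultimately show ?thesis by simp
qed

text \<open>The range exceeds a half turn because points of the quarter circle are compared with
  reflected cells up to \<open>3 * pi / 2\<close> away.\<close>

lemma norm_cis_diff_ge:
  assumes "\<bar>x - y\<bar> \<le> 3 * pi / 2"
  shows "\<bar>x - y\<bar> / 5 \<le> cmod (cis x - cis y)"
proof -
  define t where "t = (x - y) / 2"
  have "\<bar>t\<bar> / 5 \<le> sin \<bar>t\<bar>" using assms by (intro sin_ge_fifth) (auto simp: t_def)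
  also have "\<dots> \<le> \<bar>sin t\<bar>" by (auto simp: abs_if)
  finally show ?thesis unfolding norm_cis_diff t_def by simp
qed

text \<open>For positive \<open>m\<close>, the classical Fejer kernel divided by \<open>m\<close>:
  its peak value, not its mean, is 1.\<close>

definition fejer :: "nat \<Rightarrow> real \<Rightarrow> real" where
  "fejer m x = (cmod (\<Sum>a<m. cis (real a * x)))\<^sup>2 / (real m)\<^sup>2"

lemma fejer_nonneg: "0 \<le> fejer m x"
  by (simp add: fejer_def)

lemma fejer_le_1: "fejer m x \<le> 1"
proof -
  have "cmod (\<Sum>a<m. cis (real a * x)) \<le> (\<Sum>a<m. 1)"
    by (rule order_trans[OF norm_sum sum_mono]) auto
  then have "(cmod (\<Sum>a<m. cis (real a * x)))\<^sup>2 \<le> (real m)\<^sup>2" by (intro power_mono) auto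
  then show ?thesis unfolding fejer_def by (intro divide_le_eq_1[THEN iffD2]) (auto simp: sum_power2_gt_zero_iff)
qed

lemma fejer_complex:
  "complex_of_real ((real m)\<^sup>2 * fejer m x) = (\<Sum>a<m. \<Sum>b<m. cis ((real a - real b) * x))"
proof -
  have "complex_of_real ((real m)\<^sup>2 * fejer m x)
      = (\<Sum>a<m. cis (real a * x)) * cnj (\<Sum>a<m. cis (real a * x))"
    unfolding complex_norm_square[symmetric] by (cases "m = 0") (simp_all add: fejer_def)
  also have "\<dots> = (\<Sum>a<m. \<Sum>b<m. cis (real a * x) * cis (- (real b * x)))"
    by (simp add: sum_product cis_cnj)
  also have "\<dots> = (\<Sum>a<m. \<Sum>b<m. cis ((real a - real b) * x))"
    by (simp add: cis_mult algebra_simps)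
  finally show ?thesis .
qed

lemma fejer_double_sum: "(real m)\<^sup>2 * fejer m x = (\<Sum>a<m. \<Sum>b<m. cos ((real a - real b) * x))"
  using arg_cong[OF fejer_complex[of m x], of Re] by (simp add: Re_sum)

lemma fejer_ge_half:
  assumes "m > 0" "real m * \<bar>x\<bar> \<le> pi / 3"
  shows "1 / 2 \<le> fejer m x"
proof -
  have "1 / 2 \<le> cos ((real a - real b) * x)" if "a < m" "b < m" for a b
  proof -
    have "\<bar>real a - real b\<bar> * \<bar>x\<bar> \<le> real m * \<bar>x\<bar>" using that by (intro mult_right_mono) auto
    then have "\<bar>(real a - real b) * x\<bar> \<le> pi / 3" using assms by (simp add: abs_mult)
    then have "cos (pi / 3) \<le> cos \<bar>(real a - real b) * x\<bar>" by (intro cos_monotone_0_pi_le) auto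
    then show ?thesis by (simp add: cos_60)
  qed
  then have "(\<Sum>a<m. \<Sum>b<m. 1 / 2) \<le> (\<Sum>a<m. \<Sum>b<m. cos ((real a - real b) * x))"
    by (intro sum_mono) auto
  then have "(real m)\<^sup>2 * (1 / 2) \<le> (real m)\<^sup>2 * fejer m x"
    unfolding fejer_double_sum by (simp add: power2_eq_square)
  then show ?thesis using assms(1) by (subst (asm) mult_le_cancel_left_pos) auto
qed

text \<open>In the closed form of the geometric sum the numerator is at most 2 and the denominator
  at least \<open>\<bar>x\<bar> / 5\<close>.\<close>

lemma fejer_tail:
  assumes "x \<noteq> 0" "\<bar>x\<bar> \<le> 3 * pi / 2"
  shows "fejer m x \<le> 100 / ((real m)\<^sup>2 * x\<^sup>2)"
proof -
  let ?S = "\<Sum>a<m. cis (real a * x)"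
  have S: "?S = (\<Sum>a<m. cis x ^ a)" by (simp add: Complex.DeMoivre)
  have "(cis x - 1) * ?S = cis x ^ m - 1"
    unfolding S by (simp add: power_diff_1_eq)
  then have "cmod (cis x - 1) * cmod ?S \<le> 2"
    using norm_triangle_ineq4[of "cis x ^ m" 1] by (simp add: norm_power flip: norm_mult)
  moreover have "\<bar>x\<bar> / 5 \<le> cmod (cis x - 1)" using norm_cis_diff_ge[of x 0] assms by simp
  then have "\<bar>x\<bar> / 5 * cmod ?S \<le> cmod (cis x - 1) * cmod ?S" by (intro mult_right_mono) auto
  ultimately have "cmod ?S \<le> 10 / \<bar>x\<bar>" using assms(1) by (simp add: field_simps)
  then have "(cmod ?S)\<^sup>2 \<le> (10 / \<bar>x\<bar>)\<^sup>2" by (intro power_mono) auto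
  then have "(cmod ?S)\<^sup>2 / (real m)\<^sup>2 \<le> (100 / x\<^sup>2) / (real m)\<^sup>2"
    by (intro divide_right_mono) (auto simp: power_divide)
  then show ?thesis by (simp add: fejer_def mult.commute)
qed

lemma double_sum_even_diff:
  fixes f :: "real \<Rightarrow> real"
  assumes "\<And>t. f (- t) = f t"
  shows "(\<Sum>a<m. \<Sum>b<m. f (real a - real b)) = m * f 0 + 2 * (\<Sum>p\<in>{1..<m}. (real m - real p) * f (real p))"
proof (induction m)
  case (Suc m)
  have row: "(\<Sum>a<m. f (real a - real m)) = (\<Sum>p\<in>{1..m}. f (real p))"
  proof -
    have "(\<Sum>a<m. f (real a - real m)) = (\<Sum>a<m. f (real (m - a)))"
      using assms[of "real m - real _"] by (intro sum.cong) (auto simp: of_nat_diff less_imp_le)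
    also have "\<dots> = (\<Sum>p\<in>{1..m}. f (real p))"
      by (rule sum.reindex_bij_witness[of _ "\<lambda>p. m - p" "\<lambda>a. m - a"]) auto
    finally show ?thesis .
  qed
  have col: "(\<Sum>b<m. f (real m - real b)) = (\<Sum>p\<in>{1..m}. f (real p))"
    using row assms[of "real m - real _"] by simp
  have "(\<Sum>a<Suc m. \<Sum>b<Suc m. f (real a - real b))
     = (\<Sum>a<m. \<Sum>b<m. f (real a - real b)) + 2 * (\<Sum>p\<in>{1..m}. f (real p)) + f 0"
    using row col by (simp add: sum.distrib)
  also have "\<dots> = m * f 0 + f 0 + 2 * ((\<Sum>p\<in>{1..<m}. (real m - real p) * f (real p)) + (\<Sum>p\<in>{1..m}. f (real p)))"
    using Suc.IH by simp
  also have "(\<Sum>p\<in>{1..<m}. (real m - real p) * f (real p)) = (\<Sum>p\<in>{1..m}. (real m - real p) * f (real p))"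
    by (cases "m = 0") (auto simp: atLeastLessThanSuc_atLeastAtMost[symmetric] intro!: sum.mono_neutral_left)
  also have "(\<Sum>p\<in>{1..m}. (real m - real p) * f (real p)) + (\<Sum>p\<in>{1..m}. f (real p)) = (\<Sum>p\<in>{1..<Suc m}. (real (Suc m) - real p) * f (real p))"
    unfolding sum.distrib[symmetric] by (intro sum.cong) (auto simp: algebra_simps)
  also have "m * f 0 + f 0 = real (Suc m) * f 0" by (simp add: algebra_simps)
  finally show ?case .
qed simp

lemma fejer_cos_series:
  "(real m)\<^sup>2 * fejer m x = m + 2 * (\<Sum>p\<in>{1..<m}. (real m - real p) * cos (real p * x))"
  unfolding fejer_double_sum using double_sum_even_diff[of "\<lambda>t. cos (t * x)" m] by simp

text \<open>At frequency \<open>p\<close> the first two translates leave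
  \<open>2 sin (p y) sin (p x)\<close>, and the two shifted by \<open>pi\<close> leave
  \<open>- (-1) ^ p\<close> times this. Even frequencies cancel, odd ones double.\<close>

lemma fejer_odd_sine_series:
  "fejer m (x - y) - fejer m (x + y) + fejer m (x + y - pi) - fejer m (x - y + pi)
   = (\<Sum>p\<in>{p\<in>{..<m}. odd p}. 8 * (real m - real p) / (real m)\<^sup>2 * sin (real p * y) * sin (real p * x))"
  (is "?L = _")
proof (cases "m = 0")
  case True
  then show ?thesis by (simp add: fejer_def)
next
  case False
  have four: "cos (real p * (x - y)) - cos (real p * (x + y)) + cos (real p * (x + y - pi)) - cos (real p * (x - y + pi))
      = (if odd p then 4 * sin (real p * y) * sin (real p * x) else 0)" for p :: nat
  proof -
    have c: "cos (real p * pi) = (-1) ^ p" "sin (real p * pi) = 0" by (auto simp: cos_npi sin_npi)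
    have "real p * (x + y - pi) = (real p * x + real p * y) - real p * pi"
      "real p * (x - y + pi) = (real p * x - real p * y) + real p * pi" by (simp_all add: algebra_simps)
    then show ?thesis
      by (simp add: cos_add cos_diff sin_add sin_diff c right_diff_distrib distrib_left)
  qed
  have "(real m)\<^sup>2 * ?L = (real m)\<^sup>2 * fejer m (x - y) - (real m)\<^sup>2 * fejer m (x + y)
        + (real m)\<^sup>2 * fejer m (x + y - pi) - (real m)\<^sup>2 * fejer m (x - y + pi)"
    by (simp add: algebra_simps)
  also have "\<dots> = 2 * (\<Sum>p\<in>{1..<m}. (real m - real p) * (cos (real p * (x - y)) - cos (real p * (x + y)) + cos (real p * (x + y - pi)) - cos (real p * (x - y + pi))))"
    unfolding fejer_cos_series by (simp add: right_diff_distrib distrib_left sum.distrib sum_subtractf)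
  also have "\<dots> = (\<Sum>p\<in>{1..<m}. if odd p then 8 * (real m - real p) * sin (real p * y) * sin (real p * x) else 0)"
    unfolding four sum_distrib_left by (intro sum.cong) auto
  also have "\<dots> = (\<Sum>p\<in>{p\<in>{..<m}. odd p}. 8 * (real m - real p) * sin (real p * y) * sin (real p * x))"
    by (subst sum.inter_filter[symmetric]) (auto intro!: sum.cong elim: oddE)
  finally have "?L = (\<Sum>p\<in>{p\<in>{..<m}. odd p}. 8 * (real m - real p) * sin (real p * y) * sin (real p * x)) / (real m)\<^sup>2"
    using False by (simp add: field_simps)
  then show ?thesis by (simp add: sum_divide_distrib)
qed

section \<open>Fejer sums over equally spaced points\<close>

lemma sum_cis_roots_of_unity:
  assumes "\<bar>d\<bar> < int N" "d \<noteq> 0"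
  shows "(\<Sum>r<N. cis (of_int d * (2 * pi * real r / real N))) = 0"
proof -
  define w where "w = cis (of_int d * (2 * pi / real N))"
  have N: "N > 0" using assms by linarith
  have "w \<noteq> 1"
  proof
    assume "w = 1"
    then obtain j :: int where "of_int d * (2 * pi / real N) = of_int j * 2 * pi"
      using cos_one_2pi_int[of "of_int d * (2 * pi / real N)"] by (auto simp: w_def complex_eq_iff)
    then have "real_of_int d = real_of_int (j * int N)" using N by (simp add: field_simps)
    then have "d = j * int N" by linarith
    then show False using assms dvd_imp_le_int[of d "int N"] by auto
  qed
  moreover have "w ^ N = 1"
    using N cis_multiple_2pi[of "of_int d"] by (simp add: w_def Complex.DeMoivre mult.commute mult.left_commute)
  moreover have "(\<Sum>r<N. cis (of_int d * (2 * pi * real r / real N))) = (\<Sum>r<N. w ^ r)"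
    by (intro sum.cong) (auto simp: w_def Complex.DeMoivre algebra_simps)
  ultimately show ?thesis by (simp add: geometric_sum)
qed

text \<open>Expanding the kernel gives frequencies \<open>k - (a - b)\<close>, smaller than
  \<open>N\<close> in modulus because \<open>k + m \<le> N\<close>. So only the \<open>m - k\<close>
  pairs with \<open>a = b + k\<close> survive the sum over the grid.\<close>

lemma sum_grid_fejer:
  fixes k m N :: nat
  assumes "k \<le> m" "k + m \<le> N" "m > 0"
  shows "(\<Sum>r<N. cis (real k * (2 * pi * r / N)) * (m * fejer m (x - 2 * pi * r / N)))
       = N * (1 - k / m) * cis (real k * x)"
proof -
  let ?t = "\<lambda>r. 2 * pi * real r / real N"
  have "of_nat m * (\<Sum>r<N. cis (real k * ?t r) * (m * fejer m (x - ?t r)))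
      = (\<Sum>r<N. cis (real k * ?t r) * of_real ((real m)\<^sup>2 * fejer m (x - ?t r)))"
    by (simp add: sum_distrib_left power2_eq_square algebra_simps)
  also have "\<dots> = (\<Sum>a<m. \<Sum>b<m. \<Sum>r<N. cis (real k * ?t r) * cis ((real a - real b) * (x - ?t r)))"
    unfolding fejer_complex sum_distrib_left
    by (subst sum.swap, rule sum.cong[OF refl], subst sum.swap, rule refl)
  also have "\<dots> = (\<Sum>a<m. \<Sum>b<m. if a = b + k then of_nat N * cis (real k * x) else 0)"
  proof (intro sum.cong refl)
    fix a b assume ab: "a \<in> {..<m}" "b \<in> {..<m}"
    let ?d = "int k - (int a - int b)"
    have "(\<Sum>r<N. cis (real k * ?t r) * cis ((real a - real b) * (x - ?t r)))
        = cis ((real a - real b) * x) * (\<Sum>r<N. cis (of_int ?d * ?t r))"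
      unfolding sum_distrib_left
      by (intro sum.cong refl) (simp add: cis_mult, intro arg_cong[of _ _ cis], simp add: algebra_simps diff_divide_distrib add_divide_distrib)
    also have "\<dots> = (if a = b + k then of_nat N * cis (real k * x) else 0)"
    proof (cases "a = b + k")
      case False
      then have "?d \<noteq> 0" "\<bar>?d\<bar> < int N" using ab assms by auto
      then show ?thesis using sum_cis_roots_of_unity[of ?d N] False by simp
    qed simp
    finally show "(\<Sum>r<N. cis (real k * ?t r) * cis ((real a - real b) * (x - ?t r)))
      = (if a = b + k then of_nat N * cis (real k * x) else 0)" .
  qed
  also have "\<dots> = (\<Sum>b<m. \<Sum>a<m. if a = b + k then of_nat N * cis (real k * x) else 0)"
    by (rule sum.swap)
  also have "\<dots> = (\<Sum>b<m. if b + k < m then of_nat N * cis (real k * x) else 0)"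
    by (intro sum.cong) (auto simp: sum.delta)
  also have "\<dots> = (\<Sum>b\<in>{..<m - k}. of_nat N * cis (real k * x))"
  proof -
    have "{b \<in> {..<m}. b + k < m} = {..<m - k}" by auto
    then show ?thesis by (subst sum.inter_filter[symmetric]) auto
  qed
  also have "\<dots> = of_nat (m - k) * of_nat N * cis (real k * x)" by simp
  finally show ?thesis using assms by (simp add: field_simps of_nat_diff)
qed

text \<open>The kernel \<open>V = 2 F_2L - F_L\<close> (de la Vallee Poussin) reproduces sine polynomials of degree \<open>L\<close>.\<close>

lemma sine_polynomial_grid_bound:
  fixes L :: nat
  assumes "L > 0" "S \<subseteq> {..L}"
    and grid: "\<And>r. r < 4 * L \<Longrightarrow> \<bar>\<Sum>k\<in>S. y k * sin (real k * (2 * pi * r / (4 * L)))\<bar> \<le> B"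
  shows "\<bar>\<Sum>k\<in>S. y k * sin (real k * x)\<bar> \<le> 3 * B"
proof -
  define N where "N = 4 * L"
  define t where "t = (\<lambda>r. 2 * pi * real r / real N)"
  \<comment> \<open>The weight at frequency \<open>k \<le> L\<close> is
    \<open>2 (1 - k / (2 L)) - (1 - k / L) = 1\<close>. Fejer kernels being nonnegative, the mean of
    \<open>\<bar>V r\<bar>\<close> is at most \<open>2 + 1\<close>, the constant 3 of the
    lemma.\<close>
  define V where "V = (\<lambda>r. 2 * (real (2 * L) * fejer (2 * L) (x - t r)) - real L * fejer L (x - t r))"
  define f where "f = (\<lambda>x. \<Sum>k\<in>S. y k * sin (real k * x))"
  have N0: "real N > 0" using assms(1) by (simp add: N_def)
  have rep: "(\<Sum>r<N. cis (real k * t r) * V r) = of_real N * cis (real k * x)" if "k \<le> L" for k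
  proof -
    have "(\<Sum>r<N. cis (real k * t r) * V r) = 2 * (\<Sum>r<N. cis (real k * t r) * (real (2 * L) * fejer (2 * L) (x - t r)))
        - (\<Sum>r<N. cis (real k * t r) * (real L * fejer L (x - t r)))"
      unfolding V_def by (simp add: sum_subtractf sum_distrib_left algebra_simps)
    also have "\<dots> = 2 * (N * (1 - k / real (2 * L)) * cis (real k * x)) - N * (1 - k / L) * cis (real k * x)"
      using sum_grid_fejer[of k "2 * L" N x] sum_grid_fejer[of k L N x] that assms(1)
      by (simp add: t_def N_def)
    also have "\<dots> = of_real N * cis (real k * x)" using assms(1) by (simp add: field_simps)
    finally show ?thesis .
  qed
  have rep_sin: "(\<Sum>r<N. sin (real k * t r) * V r) = N * sin (real k * x)" if "k \<le> L" for k
    using arg_cong[OF rep[OF that], of Im] by simp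
  have "N * f x = (\<Sum>k\<in>S. y k * (\<Sum>r<N. sin (real k * t r) * V r))"
    unfolding f_def sum_distrib_left[of _ _ S] using assms(2) by (intro sum.cong refl) (auto simp: rep_sin)
  also have "\<dots> = (\<Sum>r<N. f (t r) * V r)"
    unfolding f_def sum_distrib_left sum_distrib_right by (subst sum.swap) (simp add: algebra_simps)
  finally have Nf: "N * \<bar>f x\<bar> = \<bar>\<Sum>r<N. f (t r) * V r\<bar>" by (metis abs_mult abs_of_nat)
  have mass: "(\<Sum>r<N. real m * fejer m (x - t r)) = N" if "0 < m" "m \<le> N" for m
    using arg_cong[OF sum_grid_fejer[of 0 m N x], of Re] that by (simp add: t_def)
  have B: "0 \<le> B" using grid[of 0] assms(1) by linarith
  have "\<bar>\<Sum>r<N. f (t r) * V r\<bar> \<le> (\<Sum>r<N. B * (2 * (real (2 * L) * fejer (2 * L) (x - t r)) + real L * fejer L (x - t r)))"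
  proof (intro order_trans[OF sum_abs] sum_mono)
    fix r assume "r \<in> {..<N}"
    then have "\<bar>f (t r)\<bar> \<le> B" using grid[of r] by (simp add: f_def t_def N_def)
    moreover have "\<bar>V r\<bar> \<le> 2 * (real (2 * L) * fejer (2 * L) (x - t r)) + real L * fejer L (x - t r)"
      unfolding V_def using fejer_nonneg[of "2 * L" "x - t r"] fejer_nonneg[of L "x - t r"]
      by (intro order_trans[OF abs_triangle_ineq4]) (simp add: abs_mult)
    ultimately show "\<bar>f (t r) * V r\<bar> \<le> B * (2 * (real (2 * L) * fejer (2 * L) (x - t r)) + real L * fejer L (x - t r))"
      unfolding abs_mult using B by (intro mult_mono) auto
  qed
  also have "\<dots> = B * (2 * (\<Sum>r<N. real (2 * L) * fejer (2 * L) (x - t r)) + (\<Sum>r<N. real L * fejer L (x - t r)))"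
    by (simp only: sum_distrib_left[symmetric] sum.distrib)
  also have "\<dots> = N * (3 * B)" using assms(1) mass[of "2 * L"] mass[of L] by (simp add: N_def)
  finally have "N * \<bar>f x\<bar> \<le> N * (3 * B)" unfolding Nf .
  then show ?thesis using N0 unfolding f_def by (subst (asm) mult_le_cancel_left_pos)
qed

section \<open>The Rudin-Shapiro cosine polynomial\<close>

text \<open>Divided differences: splitting off the root factor of \<open>u 0\<close> leaves a
  quotient of size at most \<open>2 * \<tau> / s\<close> at the other points. Multiplying back adds
  three terms under the same bound, so each degree costs a factor \<open>6 / s\<close>.\<close>

lemma small_values_imp_small_coeffs:
  fixes p :: "complex poly"
  assumes "degree p \<le> d" "0 < s" "s \<le> 2"
    and "\<And>i. i \<le> d \<Longrightarrow> cmod (u i) \<le> 1" "\<And>i. i \<le> d \<Longrightarrow> cmod (poly p (u i)) \<le> \<tau>"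
    and "\<And>i j. i < j \<Longrightarrow> j \<le> d \<Longrightarrow> s \<le> cmod (u j - u i)"
  shows "cmod (coeff p k) \<le> \<tau> * (6 / s) ^ d"
  using assms
proof (induction d arbitrary: p u \<tau> k)
  case 0
  then obtain c where "p = [:c:]" by (metis degree_eq_zeroE le_zero_eq)
  then show ?case using 0(5)[of 0] 0(4)[of 0] by (auto simp: coeff_pCons intro: order_trans[OF norm_ge_zero] split: nat.split)
next
  case (Suc d)
  define q where "q = synthetic_div p (u 0)"
  define X where "X = (6 / s) ^ d"
  have p: "p = [:- u 0, 1:] * q + [:poly p (u 0):]"
    by (simp only: q_def synthetic_div_correct')
  have \<tau>: "0 \<le> \<tau>" using Suc.prems(5)[of 0] norm_ge_zero order_trans by blast
  have q_small: "cmod (poly q (u (Suc i))) \<le> 2 * \<tau> / s" if "i \<le> d" for i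
  proof -
    have "poly p (u (Suc i)) - poly p (u 0) = (u (Suc i) - u 0) * poly q (u (Suc i))"
      by (subst p) (simp add: algebra_simps)
    then have "cmod (u (Suc i) - u 0) * cmod (poly q (u (Suc i))) = cmod (poly p (u (Suc i)) - poly p (u 0))"
      by (simp add: norm_mult)
    also have "\<dots> \<le> 2 * \<tau>"
      using norm_triangle_ineq4[of "poly p (u (Suc i))" "poly p (u 0)"]
        Suc.prems(5)[of "Suc i"] Suc.prems(5)[of 0] that by simp
    finally have "cmod (u (Suc i) - u 0) * cmod (poly q (u (Suc i))) \<le> 2 * \<tau>" .
    moreover have "s * cmod (poly q (u (Suc i))) \<le> cmod (u (Suc i) - u 0) * cmod (poly q (u (Suc i)))"
      using Suc.prems(6)[of 0 "Suc i"] that by (intro mult_right_mono) auto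
    ultimately show ?thesis using Suc.prems(2) by (simp add: field_simps)
  qed
  have q: "cmod (coeff q l) \<le> 2 * \<tau> / s * X" for l
    unfolding X_def
  proof (rule Suc.IH[of q "\<lambda>i. u (Suc i)"])
    show "degree q \<le> d" using Suc.prems(1) by (simp add: q_def degree_synthetic_div)
  qed (use Suc.prems q_small in auto)
  have X1: "1 \<le> X" unfolding X_def using Suc.prems(2,3) by (intro one_le_power) (simp add: field_simps)
  have "\<tau> * 1 \<le> \<tau> * (2 / s * X)"
    using \<tau> X1 Suc.prems(2,3) mult_mono[of 1 "2 / s" 1 X] by (intro mult_left_mono) auto
  moreover have "cmod (coeff p k) \<le> 2 * \<tau> / s * X + 2 * \<tau> / s * X + \<tau>"
  proof -
    have "coeff p k = (case k of 0 \<Rightarrow> 0 | Suc l \<Rightarrow> coeff q l) - u 0 * coeff q k + (case k of 0 \<Rightarrow> poly p (u 0) | Suc l \<Rightarrow> 0)"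
      by (subst p) (simp add: coeff_pCons split: nat.split)
    moreover have "cmod (case k of 0 \<Rightarrow> 0 | Suc l \<Rightarrow> coeff q l) \<le> 2 * \<tau> / s * X"
      using q \<tau> X1 Suc.prems(2) by (simp split: nat.split)
    moreover have "cmod (u 0 * coeff q k) \<le> 1 * (2 * \<tau> / s * X)"
      unfolding norm_mult using q[of k] Suc.prems(4)[of 0] by (intro mult_mono) auto
    moreover have "cmod (case k of 0 \<Rightarrow> poly p (u 0) | Suc l \<Rightarrow> 0) \<le> \<tau>"
      using \<tau> Suc.prems(5)[of 0] by (simp split: nat.split)
    ultimately show ?thesis
      by (smt (verit) norm_triangle_ineq norm_triangle_ineq4)
  qed
  moreover have "\<tau> * (6 / s) ^ Suc d = 3 * (2 * \<tau> / s * X)" by (simp add: X_def)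
  moreover have "\<tau> * (2 / s * X) = 2 * \<tau> / s * X" by simp
  ultimately show ?case by linarith
qed

section \<open>The Rudin-Shapiro pair\<close>

lemma sum_lessThan_add:
  fixes f :: "nat \<Rightarrow> 'a::comm_monoid_add"
  shows "(\<Sum>k<m + n. f k) = (\<Sum>k<m. f k) + (\<Sum>k<n. f (m + k))"
  by (induction n) (auto simp: add.assoc)

text \<open>The Boolean selects the member of the Rudin-Shapiro pair: \<open>True\<close> for \<open>P\<close>, \<open>False\<close> for \<open>Q\<close>.\<close>

primrec rs_sign :: "nat \<Rightarrow> bool \<Rightarrow> nat \<Rightarrow> int" where
  "rs_sign 0 b k = 1"
| "rs_sign (Suc t) b k =
    (if k < 2 ^ t then rs_sign t True k else (if b then 1 else -1) * rs_sign t False (k - 2 ^ t))"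

lemma rs_sign_cases: "rs_sign t b k = 1 \<or> rs_sign t b k = -1"
  by (induction t arbitrary: b k) auto

definition rs_poly :: "nat \<Rightarrow> bool \<Rightarrow> complex \<Rightarrow> complex" where
  "rs_poly t b z = (\<Sum>k<2 ^ t. of_int (rs_sign t b k) * z ^ k)"

lemma rs_poly_0: "rs_poly 0 b z = 1"
  by (simp add: rs_poly_def)

lemma rs_poly_Suc:
  "rs_poly (Suc t) b z = rs_poly t True z + (if b then 1 else -1) * (z ^ 2 ^ t * rs_poly t False z)"
proof -
  have "rs_poly (Suc t) b z = (\<Sum>k<2 ^ t + 2 ^ t. of_int (rs_sign (Suc t) b k) * z ^ k)"
    by (simp add: rs_poly_def mult_2)
  also have "\<dots> = (\<Sum>k<2 ^ t. of_int (rs_sign (Suc t) b k) * z ^ k)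
      + (\<Sum>k<2 ^ t. of_int (rs_sign (Suc t) b (2 ^ t + k)) * z ^ (2 ^ t + k))"
    by (rule sum_lessThan_add)
  also have "\<dots> = rs_poly t True z + (if b then 1 else -1) * (z ^ 2 ^ t * rs_poly t False z)"
    by (simp add: rs_poly_def sum_distrib_left power_add algebra_simps sum_negf)
  finally show ?thesis .
qed

lemma rs_poly_cnj: "rs_poly t b (cnj z) = cnj (rs_poly t b z)"
  by (simp add: rs_poly_def)

lemma rs_poly_norm_square:
  assumes "cmod z = 1"
  shows "(cmod (rs_poly t True z))\<^sup>2 + (cmod (rs_poly t False z))\<^sup>2 = 2 ^ Suc t"
proof (induction t)
  case (Suc t)
  have par: "(cmod (x + y))\<^sup>2 + (cmod (x - y))\<^sup>2 = 2 * ((cmod x)\<^sup>2 + (cmod y)\<^sup>2)" for x y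
    unfolding cmod_power2 by (simp add: power2_eq_square algebra_simps)
  show ?case
    using Suc.IH par[of "rs_poly t True z" "z ^ 2 ^ t * rs_poly t False z"] assms
    by (simp add: rs_poly_Suc norm_mult norm_power)
qed (simp add: rs_poly_0)

lemma rs_poly_norm_le:
  assumes "cmod z = 1"
  shows "cmod (rs_poly t b z) \<le> sqrt 2 ^ Suc t"
proof (rule power2_le_imp_le)
  have "(cmod (rs_poly t b z))\<^sup>2 \<le> 2 ^ Suc t"
    using rs_poly_norm_square[OF assms, of t]
    by (cases b) (smt (verit) zero_le_power2)+
  also have "\<dots> = (sqrt 2 ^ Suc t)\<^sup>2" by (metis real_sqrt_pow2 zero_le_numeral power_mult mult.commute)
  finally show "(cmod (rs_poly t b z))\<^sup>2 \<le> (sqrt 2 ^ Suc t)\<^sup>2" .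
qed simp

text \<open>A Bernstein-type bound, degree times maximum, by induction along the recursion. Bounding
  the derivative termwise would force \<open>T\<close> far above \<open>4 ^ r\<close>, and
  \<open>2 ^ r\<close> would fall below the order of \<open>sqrt L\<close>.\<close>

lemma rs_poly_lipschitz:
  assumes "cmod z = 1" "cmod w = 1"
  shows "cmod (rs_poly t b z - rs_poly t b w) \<le> 2 * 2 ^ t * sqrt 2 ^ t * cmod (z - w)"
proof (induction t arbitrary: b)
  case (Suc t)
  let ?P = "rs_poly t True" and ?Q = "rs_poly t False" and ?N = "2 ^ t :: nat"
  define Y where "Y = 2 ^ t * sqrt 2 ^ t * cmod (z - w)"
  have Y: "0 \<le> Y" by (simp add: Y_def)
  have "z ^ ?N * ?Q z - w ^ ?N * ?Q w = z ^ ?N * (?Q z - ?Q w) + (z ^ ?N - w ^ ?N) * ?Q w"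
    by (simp add: algebra_simps)
  then have "cmod (z ^ ?N * ?Q z - w ^ ?N * ?Q w) \<le> cmod (?Q z - ?Q w) + cmod (z ^ ?N - w ^ ?N) * cmod (?Q w)"
    using norm_triangle_ineq[of "z ^ ?N * (?Q z - ?Q w)" "(z ^ ?N - w ^ ?N) * ?Q w"] assms
    by (simp add: norm_mult norm_power)
  also have "\<dots> \<le> 2 * 2 ^ t * sqrt 2 ^ t * cmod (z - w) + (?N * cmod (z - w)) * sqrt 2 ^ Suc t"
    using assms norm_power_diff[of z w ?N] by (intro add_mono Suc.IH mult_mono rs_poly_norm_le) auto
  also have "\<dots> = (2 + sqrt 2) * Y" by (simp add: Y_def algebra_simps)
  finally have 1: "cmod (z ^ ?N * ?Q z - w ^ ?N * ?Q w) \<le> (2 + sqrt 2) * Y" .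
  have "rs_poly (Suc t) b z - rs_poly (Suc t) b w
      = (?P z - ?P w) + (if b then 1 else -1) * (z ^ ?N * ?Q z - w ^ ?N * ?Q w)"
    by (simp add: rs_poly_Suc algebra_simps)
  then have "cmod (rs_poly (Suc t) b z - rs_poly (Suc t) b w) \<le> cmod (?P z - ?P w) + cmod (z ^ ?N * ?Q z - w ^ ?N * ?Q w)"
    using norm_triangle_ineq[of "?P z - ?P w" "z ^ ?N * ?Q z - w ^ ?N * ?Q w"]
      norm_triangle_ineq4[of "?P z - ?P w" "z ^ ?N * ?Q z - w ^ ?N * ?Q w"]
    by (cases b) (simp_all only: if_True if_False mult_1 mult_minus1 diff_conv_add_uminus[symmetric] simp_thms)
  also have "\<dots> \<le> 2 * Y + (2 + sqrt 2) * Y"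
    using Suc.IH[of True] 1 by (simp add: Y_def algebra_simps)
  also have "\<dots> = (4 + sqrt 2) * Y" by (simp add: algebra_simps)
  also have "\<dots> \<le> (4 * sqrt 2) * Y"
  proof (intro mult_right_mono Y)
    have "4 / 3 \<le> sqrt 2" by (rule real_le_rsqrt) (simp add: power_divide)
    then show "4 + sqrt 2 \<le> 4 * sqrt 2" by linarith
  qed
  also have "\<dots> = 2 * 2 ^ Suc t * sqrt 2 ^ Suc t * cmod (z - w)" by (simp add: Y_def algebra_simps)
  finally show ?case .
qed (simp add: rs_poly_0)

text \<open>Values for the two ends of the quarter circle, where \<open>z^2\<close> is 1 and -1. At
  -1 the index 0 has to be left out, since both members are the constant 1 there.\<close>

lemma rs_poly_at_1: "rs_poly (2 * r) b 1 = 2 ^ r"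
  by (induction r arbitrary: b) (auto simp: rs_poly_0 rs_poly_Suc)

lemma rs_poly_at_minus_1: "rs_poly (2 * Suc r) b (-1) = (if b then 2 else -2) * 2 ^ r"
proof (induction r arbitrary: b)
  case 0
  then show ?case by (simp add: rs_poly_0 rs_poly_Suc numeral_2_eq_2)
next
  case (Suc r)
  have "rs_poly (2 * Suc (Suc r)) b (-1) = (if b then 2 * rs_poly (2 * Suc r) True (-1) else 2 * rs_poly (2 * Suc r) False (-1))"
    by (simp add: rs_poly_Suc)
  then show ?case unfolding Suc.IH by simp
qed

text \<open>The argument \<open>z^2\<close> makes all frequencies even, so besides conjugation also
  \<open>z\<close> to \<open>- z\<close> is a symmetry, and a quarter circle suffices.\<close>

definition rs_cosine :: "nat \<Rightarrow> nat \<Rightarrow> complex \<Rightarrow> real" where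
  "rs_cosine T t z = Re (z ^ (2 * T) * rs_poly t True (z\<^sup>2) + z ^ (4 * T) * rs_poly t False (z\<^sup>2))"

lemma rs_cosine_minus: "rs_cosine T t (- z) = rs_cosine T t z"
  by (simp add: rs_cosine_def)

lemma rs_cosine_cnj: "rs_cosine T t (cnj z) = rs_cosine T t z"
proof -
  have "(cnj z) ^ (2 * T) * rs_poly t True ((cnj z)\<^sup>2) + (cnj z) ^ (4 * T) * rs_poly t False ((cnj z)\<^sup>2)
    = cnj (z ^ (2 * T) * rs_poly t True (z\<^sup>2) + z ^ (4 * T) * rs_poly t False (z\<^sup>2))"
    by (simp add: rs_poly_cnj flip: complex_cnj_power)
  then show ?thesis by (simp only: rs_cosine_def cnj.sel)
qed

lemma rs_cosine_bound:
  assumes "cmod z = 1"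
  shows "\<bar>rs_cosine T (2 * r) z\<bar> \<le> 3 * 2 ^ r"
proof -
  have sq: "sqrt 2 ^ Suc (2 * r) \<le> 3 / 2 * 2 ^ r"
  proof -
    have "sqrt 2 \<le> 3 / 2" by (rule real_le_lsqrt) (simp_all add: power_divide)
    then show ?thesis by (simp add: power_mult)
  qed
  have "cmod (z\<^sup>2) = 1" using assms by (simp add: norm_power)
  then have "cmod (rs_poly (2 * r) b (z\<^sup>2)) \<le> 3 / 2 * 2 ^ r" for b
    using rs_poly_norm_le[of "z\<^sup>2" "2 * r" b] sq by linarith
  note this[of True] this[of False]
  moreover have "\<bar>rs_cosine T (2 * r) z\<bar> \<le> cmod (z ^ (2 * T) * rs_poly (2 * r) True (z\<^sup>2)) + cmod (z ^ (4 * T) * rs_poly (2 * r) False (z\<^sup>2))"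
    unfolding rs_cosine_def by (intro order_trans[OF abs_Re_le_cmod norm_triangle_ineq])
  ultimately show ?thesis using assms by (simp add: norm_mult norm_power)
qed

text \<open>
The quarter circle \<open>[0, pi / 2]\<close> is cut into \<open>T\<close> windows of \<open>9 A\<close> cells of length \<open>h\<close>.  On one window
the Rudin-Shapiro pair is almost constant while \<open>z ^ (2 T)\<close> runs through a half circle.
\<close>

locale flat_cosine =
  fixes A T r :: nat
  assumes A_pos: "A \<ge> 1" and T_odd: "odd T" and r_pos: "r \<ge> 1"
    and T_large: "112 * (90 * A) ^ 4 * 4 ^ r \<le> T"
begin

definition h :: real where "h = pi / (18 * real A * real T)"
text \<open>Chosen so that \<open>4 * \<eta> * (90 * A) ^ 4 = 1/2\<close>. Here
  \<open>90 * A = 6 / s\<close> for the separation \<open>s = 1 / (15 * A)\<close> of the points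
  \<open>u\<close> fed to \<open>small_values_imp_small_coeffs\<close>.\<close>

definition \<eta> :: real where "\<eta> = 1 / (8 * (90 * real A) ^ 4)"
definition c :: "real \<Rightarrow> real" where "c \<theta> = rs_cosine T (2 * r) (cis \<theta>)"
definition bad :: "nat set" where
  "bad = {j. j < 9 * A * T \<and> (\<exists>\<theta>. j * h \<le> \<theta> \<and> \<theta> \<le> (j + 1) * h \<and> \<bar>c \<theta>\<bar> < \<eta> * 2 ^ r)}"

lemma T_pos: "0 < T"
  using T_odd by (rule odd_pos)

lemma h_pos: "0 < h"
  using A_pos T_pos by (simp add: h_def)

lemma eta_le: "\<eta> \<le> 1 / 8"
proof -
  have "1 \<le> (90 * real A) ^ 4" using A_pos by (intro one_le_power) auto
  then show ?thesis by (simp add: \<eta>_def divide_le_eq)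
qed

lemma c_eq:
  fixes \<theta> :: real
  shows "c \<theta> = Re (cis (2 * T * \<theta>) * rs_poly (2 * r) True (cis (2 * \<theta>))
    + cis (4 * T * \<theta>) * rs_poly (2 * r) False (cis (2 * \<theta>)))"
  by (simp add: c_def rs_cosine_def Complex.DeMoivre)

text \<open>The constant of \<open>T_large\<close> comes from here: \<open>2 * pi \<le> 7\<close>,
  and \<open>7 / 112 = 1/16\<close> is half of the \<open>1/8\<close> in
  \<open>\<eta>\<close>.\<close>

lemma rs_close:
  fixes x y :: real
  assumes "\<bar>x - y\<bar> \<le> pi / (2 * T)"
  shows "cmod (rs_poly (2 * r) b (cis (2 * x)) - rs_poly (2 * r) b (cis (2 * y))) \<le> \<eta> * 2 ^ r / 2"
proof -
  have "cmod (rs_poly (2 * r) b (cis (2 * x)) - rs_poly (2 * r) b (cis (2 * y)))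
      \<le> 2 * 2 ^ (2 * r) * sqrt 2 ^ (2 * r) * cmod (cis (2 * x) - cis (2 * y))"
    by (intro rs_poly_lipschitz) auto
  also have "\<dots> = 2 * 4 ^ r * 2 ^ r * cmod (cis (2 * x) - cis (2 * y))"
    by (simp add: power_mult)
  also have "\<dots> \<le> 2 * 4 ^ r * 2 ^ r * (pi / T)"
    using order_trans[OF norm_cis_diff_le[of "2 * x" "2 * y"]] assms
    by (intro mult_left_mono) (auto simp: field_simps)
  also have "\<dots> = 2 * pi * (4 ^ r / T) * 2 ^ r" by simp
  also have "\<dots> \<le> 7 * (1 / (112 * (90 * real A) ^ 4)) * 2 ^ r"
  proof (intro mult_right_mono mult_mono)
    have "real (112 * (90 * A) ^ 4 * 4 ^ r) \<le> T" using T_large by (rule of_nat_mono)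
    then show "4 ^ r / real T \<le> 1 / (112 * (90 * real A) ^ 4)"
      using T_pos A_pos by (simp add: field_simps)
  qed (use pi_approx in auto)
  also have "\<dots> = \<eta> * 2 ^ r / 2" by (simp add: \<eta>_def)
  finally show ?thesis .
qed

text \<open>
With \<open>P\<close>, \<open>Q\<close> frozen and \<open>u = z ^ (2 T)\<close>, the cosine polynomial is \<open>Re (u P + u\<^sup>2 Q)\<close>, and \<open>2 u\<^sup>2\<close> times this
real part is a polynomial of degree 4 in \<open>u\<close> with coefficients \<open>P\<close> and \<open>Q\<close>, one of which is large.
\<close>

lemma no_five_separated_small_values:
  fixes x :: "nat \<Rightarrow> real" and x0 :: real
  assumes x: "\<And>i. i \<le> 4 \<Longrightarrow> x0 \<le> x i \<and> x i \<le> x0 + pi / (2 * T)"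
    and sep: "\<And>i j. i < j \<Longrightarrow> j \<le> 4 \<Longrightarrow> h \<le> \<bar>x i - x j\<bar>"
    and small: "\<And>i. i \<le> 4 \<Longrightarrow> \<bar>c (x i)\<bar> < \<eta> * 2 ^ r"
  shows False
proof -
  define P where "P = rs_poly (2 * r) True (cis (2 * x0))"
  define Q where "Q = rs_poly (2 * r) False (cis (2 * x0))"
  define p where "p = [:cnj Q, cnj P, 0, P, Q:]"
  define u where "u = (\<lambda>i. cis (2 * T * x i))"
  have poly_p: "cmod (poly p (u i)) \<le> 4 * (\<eta> * 2 ^ r)" if i: "i \<le> 4" for i
  proof -
    have u1: "u i * cnj (u i) = 1" by (simp add: u_def cis_cnj cis_mult)
    define w where "w = u i * P + (u i)\<^sup>2 * Q"
    have "poly p (u i) = (u i)\<^sup>2 * (w + cnj w)"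
    proof -
      have "(u i)\<^sup>2 * cnj w = u i * (u i * cnj (u i)) * cnj P + (u i * cnj (u i))\<^sup>2 * cnj Q"
        by (simp add: w_def power2_eq_square algebra_simps)
      then have "(u i)\<^sup>2 * cnj w = u i * cnj P + cnj Q" by (simp add: u1)
      then show ?thesis by (simp add: p_def w_def power2_eq_square algebra_simps)
    qed
    also have "w + cnj w = of_real (2 * Re w)" by (rule complex_add_cnj)
    finally have "cmod (poly p (u i)) = 2 * \<bar>Re w\<bar>"
      by (simp add: norm_mult norm_power u_def)
    moreover have "\<bar>Re w\<bar> \<le> \<bar>c (x i)\<bar> + \<eta> * 2 ^ r"
    proof -
      let ?P = "rs_poly (2 * r) True (cis (2 * x i))" and ?Q = "rs_poly (2 * r) False (cis (2 * x i))"
      have near: "\<bar>x i - x0\<bar> \<le> pi / (2 * T)" using x[OF i] by auto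
      have sq: "(u i)\<^sup>2 = cis (4 * T * x i)" by (simp add: u_def power2_eq_square cis_mult mult.assoc)
      have "Re w - c (x i) = Re (u i * (P - ?P) + (u i)\<^sup>2 * (Q - ?Q))"
        unfolding c_eq w_def sq by (simp add: u_def algebra_simps)
      also have "\<bar>\<dots>\<bar> \<le> cmod (u i * (P - ?P)) + cmod ((u i)\<^sup>2 * (Q - ?Q))"
        by (intro order_trans[OF abs_Re_le_cmod norm_triangle_ineq])
      also have "\<dots> = cmod (?P - P) + cmod (?Q - Q)"
        by (simp add: norm_mult norm_power u_def norm_minus_commute)
      also have "\<dots> \<le> \<eta> * 2 ^ r / 2 + \<eta> * 2 ^ r / 2"
        unfolding P_def Q_def by (intro add_mono rs_close near)
      finally show ?thesis by simp
    qed
    ultimately show ?thesis using small[OF i] by linarith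
  qed
  have sep_u: "1 / (15 * real A) \<le> cmod (u j - u i)" if ij: "i < j" "j \<le> 4" for i j
  proof -
    have "2 * T * x j - 2 * T * x i = 2 * T * (x j - x i)" by (simp add: algebra_simps)
    then have scale: "\<bar>2 * T * x j - 2 * T * x i\<bar> = 2 * T * \<bar>x j - x i\<bar>" by (simp add: abs_mult)
    have "1 / (15 * real A) \<le> 2 * T * h / 5"
    proof -
      have e: "2 * T * h / 5 = (pi / 3) / (15 * real A)" using T_pos by (simp add: h_def)
      have "1 / (15 * real A) \<le> (pi / 3) / (15 * real A)" using pi_gt3 by (intro divide_right_mono) auto
      then show ?thesis unfolding e .
    qed
    also have "\<dots> \<le> \<bar>2 * T * x j - 2 * T * x i\<bar> / 5"
      unfolding scale using sep[OF ij] by (intro divide_right_mono mult_left_mono) auto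
    also have "\<dots> \<le> cmod (u j - u i)"
      unfolding u_def
    proof (rule norm_cis_diff_ge)
      have "\<bar>x j - x i\<bar> \<le> pi / (2 * T)" using x[of i] x[of j] ij by (simp add: abs_le_iff)
      then have "2 * T * \<bar>x j - x i\<bar> \<le> 2 * T * (pi / (2 * T))" by (intro mult_left_mono) auto
      then have "2 * T * \<bar>x j - x i\<bar> \<le> pi" using T_pos by simp
      then show "\<bar>2 * T * x j - 2 * T * x i\<bar> \<le> 3 * pi / 2"
        unfolding scale using pi_gt_zero by linarith
    qed
    finally show ?thesis .
  qed
  have \<eta>A: "\<eta> * (6 / (1 / (15 * real A))) ^ 4 = 1 / 8"
  proof -
    have "6 / (1 / (15 * real A)) = 90 * real A" by simp
    then show ?thesis using A_pos by (simp only: \<eta>_def) simp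
  qed
  have s2: "1 / (15 * real A) \<le> 2" using A_pos by (simp add: divide_le_eq)
  have coeffs: "cmod (coeff p k) \<le> 4 * (\<eta> * 2 ^ r) * (6 / (1 / (15 * real A))) ^ 4" for k
  proof (rule small_values_imp_small_coeffs[where p = p and u = u])
    show "degree p \<le> 4" by (simp add: p_def)
    show "cmod (u i) \<le> 1" for i by (simp add: u_def)
  qed (use A_pos s2 poly_p sep_u in auto)
  have "4 * (\<eta> * 2 ^ r) * (6 / (1 / (15 * real A))) ^ 4 = 4 * 2 ^ r * (\<eta> * (6 / (1 / (15 * real A))) ^ 4)"
    by (simp only: mult_ac)
  then have "4 * (\<eta> * 2 ^ r) * (6 / (1 / (15 * real A))) ^ 4 = 2 ^ r / 2"
    unfolding \<eta>A by simp
  then have "cmod (coeff p k) \<le> 2 ^ r / 2" for k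
    using coeffs[of k] by linarith
  note this[of 3] this[of 4]
  then have "cmod P \<le> 2 ^ r / 2" "cmod Q \<le> 2 ^ r / 2"
    by (simp_all add: p_def coeff_pCons numeral_eq_Suc)
  \<comment> \<open>The two squares should add up to \<open>2 * 4 ^ r\<close> by
    \<open>rs_poly_norm_square\<close>.\<close>
  then have "(cmod P)\<^sup>2 + (cmod Q)\<^sup>2 \<le> (2 ^ r / 2)\<^sup>2 + (2 ^ r / 2)\<^sup>2"
    by (intro add_mono power_mono) auto
  also have "\<dots> = 2 ^ (2 * r) / 2" by (simp add: power_divide power_mult mult.commute)
  finally have "(2::real) ^ Suc (2 * r) \<le> 2 ^ (2 * r) / 2"
    unfolding P_def Q_def by (subst (asm) rs_poly_norm_square) auto
  then show False by simp
qed

text \<open>Distinct cells of equal parity are not adjacent, so points chosen in them are at least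
  \<open>h\<close> apart, as \<open>no_five_separated_small_values\<close> demands.\<close>

lemma card_ge_nine_imp_five_same_parity:
  assumes "finite (B :: nat set)" "card B \<ge> 9"
  shows "\<exists>e. inj_on e {..4::nat} \<and> e ` {..4} \<subseteq> B \<and> (\<forall>i\<le>4. \<forall>j\<le>4. even (e i + e j))"
proof -
  have "B = {b \<in> B. even b} \<union> {b \<in> B. odd b}" by auto
  then have "card B \<le> card {b \<in> B. even b} + card {b \<in> B. odd b}" by (metis card_Un_le)
  then have "5 \<le> card {b \<in> B. even b} \<or> 5 \<le> card {b \<in> B. odd b}" using assms(2) by linarith
  then have "\<exists>C\<subseteq>B. 5 \<le> card C \<and> (\<forall>a\<in>C. \<forall>b\<in>C. even (a + b))"
  proof
    assume "5 \<le> card {b \<in> B. even b}"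
    then show ?thesis by (intro exI[of _ "{b \<in> B. even b}"]) auto
  next
    assume "5 \<le> card {b \<in> B. odd b}"
    then show ?thesis by (intro exI[of _ "{b \<in> B. odd b}"]) auto
  qed
  then obtain C where C: "C \<subseteq> B" "card C \<ge> 5" "\<And>a b. a \<in> C \<Longrightarrow> b \<in> C \<Longrightarrow> even (a + b)"
    by blast
  then obtain e where "inj_on e {..4::nat}" "e ` {..4} \<subseteq> C"
    using card_le_inj[of "{..4::nat}" C] finite_subset[OF C(1) assms(1)] by auto
  with C show ?thesis by (intro exI[of _ e]) (simp add: image_subset_iff subset_iff)
qed

lemma card_bad_window:
  assumes "w < T"
  shows "card (bad \<inter> {9 * A * w..<9 * A * Suc w}) \<le> 8"
proof (rule ccontr)
  let ?B = "bad \<inter> {9 * A * w..<9 * A * Suc w}"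
  assume "\<not> ?thesis"
  then have "9 \<le> card ?B" by simp
  then obtain e where e: "inj_on e {..4::nat}" "e ` {..4} \<subseteq> ?B"
    and par: "\<forall>i\<le>4. \<forall>j\<le>4. even (e i + e j)"
    using card_ge_nine_imp_five_same_parity[of ?B] by auto
  have "\<exists>\<theta>. e i * h \<le> \<theta> \<and> \<theta> \<le> (e i + 1) * h \<and> \<bar>c \<theta>\<bar> < \<eta> * 2 ^ r" if "i \<le> 4" for i
    using e(2) that by (auto simp: bad_def)
  then obtain x where x: "\<And>i. i \<le> 4 \<Longrightarrow> e i * h \<le> x i \<and> x i \<le> (e i + 1) * h \<and> \<bar>c (x i)\<bar> < \<eta> * 2 ^ r"
    by metis
  have far: "h \<le> x j - x i" if "e i < e j" "i \<le> 4" "j \<le> 4" for i j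
  proof -
    have "e i + 2 \<le> e j" using par[rule_format, of i j] that by presburger
    then have "(e i + 2) * h \<le> e j * h" using h_pos by (intro mult_right_mono) auto
    then show ?thesis using x[of i] x[of j] that by (simp add: algebra_simps)
  qed
  show False
  proof (rule no_five_separated_small_values[of "9 * A * w * h" x])
    fix i :: nat assume i: "i \<le> 4"
    then have "9 * A * w \<le> e i" "e i + 1 \<le> 9 * A * Suc w" using e(2) by (fastforce simp: image_subset_iff)+
    then have "real (9 * A * w) * h \<le> e i * h" "real (e i + 1) * h \<le> real (9 * A * Suc w) * h"
      using h_pos by (auto intro!: mult_right_mono simp del: of_nat_Suc of_nat_add of_nat_mult)
    moreover have "real (9 * A * Suc w) * h = 9 * A * w * h + pi / (2 * T)"
      using A_pos T_pos by (simp add: h_def field_simps)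
    ultimately show "9 * A * w * h \<le> x i \<and> x i \<le> 9 * A * w * h + pi / (2 * T)"
      using x[OF i] by (simp add: algebra_simps)
  next
    fix i j :: nat assume ij: "i < j" "j \<le> 4"
    then have "e i \<noteq> e j" using e(1) by (auto simp: inj_on_def)
    then show "h \<le> \<bar>x i - x j\<bar>" using far[of i j] far[of j i] ij by (auto simp: neq_iff)
  qed (use x in auto)
qed

text \<open>At 0 both members equal \<open>2 ^ r\<close> and both modulations are 1; up to
  \<open>A * h = pi / (18 * T)\<close> the phases stay below \<open>pi / 3\<close>. So bad cells
  keep away from 0, where a bump would meet its reflection of opposite sign.\<close>

lemma c_large_near_0:
  fixes x :: real
  assumes "0 \<le> x" "x \<le> A * h"
  shows "\<eta> * 2 ^ r \<le> \<bar>c x\<bar>"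
proof -
  let ?P = "rs_poly (2 * r) True (cis (2 * x))" and ?Q = "rs_poly (2 * r) False (cis (2 * x))"
  have Ah: "A * h = pi / (18 * T)" using A_pos by (simp add: h_def)
  then have "\<bar>x - 0\<bar> \<le> pi / (2 * T)" using assms by (auto intro: order_trans frac_le)
  then have close: "cmod (?P - 2 ^ r) \<le> \<eta> * 2 ^ r / 2" "cmod (?Q - 2 ^ r) \<le> \<eta> * 2 ^ r / 2"
    using rs_close[of x 0 True] rs_close[of x 0 False] by (simp_all add: rs_poly_at_1)
  have half: "1 / 2 \<le> cos y" if "0 \<le> y" "y \<le> pi / 3" for y
    using cos_monotone_0_pi_le[of y "pi / 3"] that by (simp add: cos_60)
  have "T * x \<le> pi / 18" using mult_left_mono[OF assms(2), of T] T_pos by (simp add: Ah)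
  then have "1 / 2 \<le> cos (2 * T * x)" "1 / 2 \<le> cos (4 * T * x)"
    using mult_nonneg_nonneg[OF of_nat_0_le_iff[of T], of x] assms(1) by (intro half; simp only: of_nat_mult of_nat_numeral; linarith)+
  then have main: "2 ^ r * 1 \<le> 2 ^ r * (cos (2 * T * x) + cos (4 * T * x))" by (intro mult_left_mono) auto
  have "c x - 2 ^ r * (cos (2 * T * x) + cos (4 * T * x))
      = Re (cis (2 * T * x) * (?P - 2 ^ r) + cis (4 * T * x) * (?Q - 2 ^ r))"
    unfolding c_eq by (simp add: algebra_simps)
  also have "\<bar>\<dots>\<bar> \<le> cmod (cis (2 * T * x) * (?P - 2 ^ r)) + cmod (cis (4 * T * x) * (?Q - 2 ^ r))"
    by (intro order_trans[OF abs_Re_le_cmod norm_triangle_ineq])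
  also have "\<dots> \<le> \<eta> * 2 ^ r" using close by (simp add: norm_mult)
  finally have "2 ^ r - \<eta> * 2 ^ r \<le> c x" using main by linarith
  moreover have "\<eta> * 2 ^ r \<le> 1 / 8 * 2 ^ r" using eta_le by (intro mult_right_mono) auto
  ultimately show ?thesis by linarith
qed

text \<open>Here \<open>T\<close> must be odd: at \<open>pi / 2\<close> the pair is
  \<open>2 ^ r\<close>, \<open>- 2 ^ r\<close> and the modulations are
  \<open>cos (T * pi) = -1\<close> and \<open>cos (2 * T * pi) = 1\<close>, so the terms reinforce
  each other. For even \<open>T\<close> they would cancel.\<close>

lemma c_large_near_half_pi:
  fixes x :: real
  assumes "pi / 2 - A * h \<le> x" "x \<le> pi / 2"
  shows "\<eta> * 2 ^ r \<le> \<bar>c x\<bar>"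
proof -
  define y where "y = pi / 2 - x"
  let ?P = "rs_poly (2 * r) True (cis (2 * x))" and ?Q = "rs_poly (2 * r) False (cis (2 * x))"
  have Ah: "A * h = pi / (18 * T)" using A_pos by (simp add: h_def)
  have y: "0 \<le> y" "y \<le> pi / (18 * T)" using assms Ah by (auto simp: y_def)
  have "\<bar>x - pi / 2\<bar> \<le> pi / (18 * T)" using y by (auto simp: y_def)
  also have "\<dots> \<le> pi / (2 * T)" using T_pos by (intro frac_le) auto
  finally have near: "\<bar>x - pi / 2\<bar> \<le> pi / (2 * T)" .
  obtain q where q: "r = Suc q" using r_pos by (cases r) auto
  have close: "cmod (?P - 2 ^ r) \<le> \<eta> * 2 ^ r / 2" "cmod (?Q + 2 ^ r) \<le> \<eta> * 2 ^ r / 2"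
    using rs_close[OF near, of True] rs_close[OF near, of False] rs_poly_at_minus_1[of q True] rs_poly_at_minus_1[of q False]
    by (simp_all add: q)
  have half: "1 / 2 \<le> cos y" if "0 \<le> y" "y \<le> pi / 3" for y
    using cos_monotone_0_pi_le[of y "pi / 3"] that by (simp add: cos_60)
  have "T * y \<le> pi / 18" using mult_left_mono[OF y(2), of T] T_pos by simp
  then have "1 / 2 \<le> cos (2 * T * y)" "1 / 2 \<le> cos (4 * T * y)"
    using mult_nonneg_nonneg[OF of_nat_0_le_iff[of T], of y] y(1) by (intro half; simp only: of_nat_mult of_nat_numeral; linarith)+
  then have main: "2 ^ r * 1 \<le> 2 ^ r * (cos (2 * T * y) + cos (4 * T * y))" by (intro mult_left_mono) auto
  have "2 * T * x = T * pi - 2 * T * y" "4 * T * x = (2 * T) * pi - 4 * T * y"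
    by (simp_all add: y_def algebra_simps)
  then have cs: "cos (2 * T * x) = - cos (2 * T * y)" "cos (4 * T * x) = cos (4 * T * y)"
    using T_odd cos_npi[of T] sin_npi[of T] cos_npi[of "2 * T"] sin_npi[of "2 * T"]
    by (simp_all only: cos_diff) simp_all
  have "c x - 2 ^ r * (cos (2 * T * x) - cos (4 * T * x))
      = Re (cis (2 * T * x) * (?P - 2 ^ r) + cis (4 * T * x) * (?Q + 2 ^ r))"
    unfolding c_eq by (simp add: algebra_simps)
  also have "\<bar>\<dots>\<bar> \<le> cmod (cis (2 * T * x) * (?P - 2 ^ r)) + cmod (cis (4 * T * x) * (?Q + 2 ^ r))"
    by (intro order_trans[OF abs_Re_le_cmod norm_triangle_ineq])
  also have "\<dots> \<le> \<eta> * 2 ^ r" using close by (simp add: norm_mult)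
  finally have "c x \<le> \<eta> * 2 ^ r - 2 ^ r" using main unfolding cs by (simp add: algebra_simps)
  moreover have "\<eta> * 2 ^ r \<le> 1 / 8 * 2 ^ r" using eta_le by (intro mult_right_mono) auto
  ultimately show ?thesis by linarith
qed

lemma bad_inner:
  assumes "j \<in> bad"
  shows "A \<le> j" "j + A < 9 * A * T"
proof -
  obtain x where x: "j * h \<le> x" "x \<le> (j + 1) * h" "\<bar>c x\<bar> < \<eta> * 2 ^ r" and j: "j < 9 * A * T"
    using assms by (auto simp: bad_def)
  have half_pi: "real (9 * A * T) * h = pi / 2" using A_pos T_pos by (simp add: h_def)
  have x0: "0 \<le> x" using x(1) h_pos by (auto intro: order_trans[rotated])
  have "real (j + 1) * h \<le> real (9 * A * T) * h"
    using j h_pos by (intro mult_right_mono of_nat_mono) auto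
  then have x1: "x \<le> pi / 2" using x(2) half_pi by (simp add: algebra_simps)
  show "A \<le> j"
  proof (rule ccontr)
    assume "\<not> A \<le> j"
    then have "real (j + 1) * h \<le> A * h" using h_pos by (intro mult_right_mono) auto
    then show False using c_large_near_0[of x] x x0 by (simp add: algebra_simps)
  qed
  show "j + A < 9 * A * T"
  proof (rule ccontr)
    assume "\<not> j + A < 9 * A * T"
    then have "real (9 * A * T) * h \<le> real (j + A) * h" using h_pos by (intro mult_right_mono of_nat_mono) auto
    then show False using c_large_near_half_pi[of x] x x1 half_pi by (simp add: algebra_simps)
  qed
qed

end

section \<open>Bumps on the bad cells\<close>

text \<open>Telescoping, from \<open>(k - 1/2)^2 \<ge> (k - 1) * k\<close>. The half is the offset
  of a point from the midpoint of its cell.\<close>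

lemma sum_inverse_square_tail:
  assumes "2 \<le> d"
  shows "(\<Sum>k\<in>{d..n::nat}. 1 / (real k - 1 / 2)\<^sup>2) \<le> 1 / (real d - 1)"
proof -
  \<comment> \<open>The subtracted term carries the telescoping; for \<open>n < d\<close> it makes
    the bound 0, the value of the empty sum.\<close>
  have "(\<Sum>k\<in>{d..n}. 1 / (real k - 1 / 2)\<^sup>2) \<le> 1 / (real d - 1) - (if d \<le> n then 1 / real n else 1 / (real d - 1))"
  proof (induction n)
    case 0
    then show ?case using assms by auto
  next
    case (Suc n)
    have step: "1 / (real (Suc n) - 1 / 2)\<^sup>2 \<le> 1 / real n - 1 / real (Suc n)" if "n \<ge> 1"
    proof -
      have "1 / (real (Suc n) - 1 / 2)\<^sup>2 \<le> 1 / (real n * real (Suc n))"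
        using that by (intro frac_le) (auto simp: power2_eq_square algebra_simps intro!: add_pos_nonneg)
      then show ?thesis using that by (simp add: field_simps)
    qed
    consider "d \<le> n" | "d = Suc n" | "d > Suc n" by linarith
    then show ?case
    proof cases
      case 1
      then show ?thesis using Suc.IH step assms by simp
    next
      case 2
      then show ?thesis using step assms by simp
    qed auto
  qed
  also have "\<dots> \<le> 1 / (real d - 1)" using assms by auto
  finally show ?thesis .
qed

lemma sum_inverse_square_dist:
  fixes S :: "int set" and i :: int
  assumes "finite S" "2 \<le> d" "\<And>j. j \<in> S \<Longrightarrow> int d \<le> \<bar>i - j\<bar>"
  shows "(\<Sum>j\<in>S. 1 / (\<bar>real_of_int (i - j)\<bar> - 1 / 2)\<^sup>2) \<le> 2 / (real d - 1)"
proof -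
  let ?f = "\<lambda>j. 1 / (\<bar>real_of_int (i - j)\<bar> - 1 / 2)\<^sup>2"
  obtain n where n: "\<And>j. j \<in> S \<Longrightarrow> nat \<bar>i - j\<bar> \<le> n"
    using finite_nat_set_iff_bounded_le[of "(\<lambda>j. nat \<bar>i - j\<bar>) ` S"] assms(1) by auto
  have half: "(\<Sum>j\<in>S'. ?f j) \<le> 1 / (real d - 1)" if S': "S' \<subseteq> S" "inj_on (\<lambda>j. nat \<bar>i - j\<bar>) S'" for S'
  proof -
    have "(\<Sum>j\<in>S'. ?f j) = (\<Sum>k\<in>(\<lambda>j. nat \<bar>i - j\<bar>) ` S'. 1 / (real k - 1 / 2)\<^sup>2)"
      using S'(2) by (simp add: sum.reindex)
    also have "\<dots> \<le> (\<Sum>k\<in>{d..n}. 1 / (real k - 1 / 2)\<^sup>2)"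
      using n assms(3) S'(1) by (intro sum_mono2) (auto simp: nat_le_iff subset_iff le_nat_iff)
    also have "\<dots> \<le> 1 / (real d - 1)" by (rule sum_inverse_square_tail[OF assms(2)])
    finally show ?thesis .
  qed
  have "(\<Sum>j\<in>S. ?f j) = (\<Sum>j\<in>{j\<in>S. j \<le> i}. ?f j) + (\<Sum>j\<in>{j\<in>S. \<not> j \<le> i}. ?f j)"
    using assms(1) by (subst sum.union_disjoint[symmetric]) (auto intro!: sum.cong)
  also have "\<dots> \<le> 1 / (real d - 1) + 1 / (real d - 1)"
    by (intro add_mono half) (auto simp: inj_on_def)
  finally show ?thesis by simp
qed

context flat_cosine
begin

text \<open>The factor 12 gives \<open>m * h = 2 * pi / 3\<close>, so that
  \<open>fejer_ge_half\<close> covers exactly the cell around the centre of a bump.\<close>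

definition m :: nat where "m = 12 * A * T"
definition cells :: nat where "cells = 9 * A * T"
text \<open>Integer indices, because the reflection of a cell can have a negative index.\<close>

definition mid :: "int \<Rightarrow> real" where "mid j = (real_of_int j + 1 / 2) * h"

lemma m_pos: "0 < m"
  using A_pos T_pos by (simp add: m_def)

lemma mh: "m * h = 2 * pi / 3"
  using A_pos T_pos by (simp add: m_def h_def)

lemma cells_h: "cells * h = pi / 2"
  using A_pos T_pos by (simp add: cells_def h_def)

lemma finite_bad: "finite bad"
  by (simp add: bad_def)

lemma bad_less_cells: "j \<in> bad \<Longrightarrow> j < cells"
  by (simp add: bad_def cells_def)

lemma mid_reflect:
  "mid (-1 - j) = - mid j" "mid (2 * int cells - 1 - j) = pi - mid j" "mid (j - 2 * int cells) = mid j - pi"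
  using cells_h by (simp_all add: mid_def algebra_simps)

lemma mid_bounds: "j < cells \<Longrightarrow> 0 \<le> mid j \<and> mid j \<le> pi / 2"
proof -
  assume "j < cells"
  then have "(real j + 1 / 2) * h \<le> cells * h" using h_pos by (intro mult_right_mono) auto
  then show ?thesis using cells_h h_pos by (simp add: mid_def)
qed

text \<open>At distance \<open>k * h\<close> the tail bound is at most
  \<open>100 / (2 * k)^2 = 25 / k^2\<close> because \<open>m * h \<ge> 2\<close>; summing over both
  sides gives \<open>25 * 2 / (d - 1)\<close>.\<close>

lemma fejer_far_sum:
  assumes "finite S" "2 \<le> d" "\<And>j. j \<in> S \<Longrightarrow> int d \<le> \<bar>i - j\<bar>"
    and x: "real_of_int i * h \<le> x" "x \<le> (real_of_int i + 1) * h"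
    and range: "\<And>j. j \<in> S \<Longrightarrow> \<bar>x - mid j\<bar> \<le> 3 * pi / 2"
  shows "(\<Sum>j\<in>S. fejer m (x - mid j)) \<le> 50 / (real d - 1)"
proof -
  have "(\<Sum>j\<in>S. fejer m (x - mid j)) \<le> (\<Sum>j\<in>S. 25 * (1 / (\<bar>real_of_int (i - j)\<bar> - 1 / 2)\<^sup>2))"
  proof (intro sum_mono)
    fix j assume j: "j \<in> S"
    define k where "k = \<bar>real_of_int (i - j)\<bar> - 1 / 2"
    have "2 \<le> \<bar>i - j\<bar>" using assms(2) assms(3)[OF j] by linarith
    then have k: "1 \<le> k" unfolding k_def by linarith
    have "\<bar>x - (real_of_int i + 1 / 2) * h\<bar> \<le> h / 2" using x unfolding abs_le_iff distrib_right by linarith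
    moreover have "(real_of_int i + 1 / 2) * h - mid j = real_of_int (i - j) * h" by (simp add: mid_def algebra_simps)
    then have "\<bar>(real_of_int i + 1 / 2) * h - mid j\<bar> = \<bar>real_of_int (i - j)\<bar> * h" using h_pos by (simp add: abs_mult)
    ultimately have far: "k * h \<le> \<bar>x - mid j\<bar>" unfolding k_def left_diff_distrib by linarith
    have kh: "0 < k * h" using k h_pos by simp
    have "fejer m (x - mid j) \<le> 100 / ((real m)\<^sup>2 * (x - mid j)\<^sup>2)"
      using far kh range[OF j] by (intro fejer_tail) auto
    also have "\<dots> \<le> 100 / ((real m)\<^sup>2 * (k * h)\<^sup>2)"
    proof (intro frac_le mult_left_mono mult_pos_pos zero_less_power)
      show "(k * h)\<^sup>2 \<le> (x - mid j)\<^sup>2"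
        using power_mono[OF far, of 2] kh by simp
    qed (use k h_pos m_pos in auto)
    also have "(real m)\<^sup>2 * (k * h)\<^sup>2 = (2 * pi / 3)\<^sup>2 * k\<^sup>2"
      unfolding mh[symmetric] by (simp add: power_mult_distrib)
    also have "100 / ((2 * pi / 3)\<^sup>2 * k\<^sup>2) \<le> 100 / (2\<^sup>2 * k\<^sup>2)"
      using k pi_gt3 by (intro divide_left_mono mult_right_mono power_mono mult_pos_pos) auto
    finally show "fejer m (x - mid j) \<le> 25 * (1 / k\<^sup>2)" by simp
  qed
  also have "\<dots> \<le> 25 * (2 / (real d - 1))"
    unfolding sum_distrib_left[symmetric] by (intro mult_left_mono sum_inverse_square_dist assms) auto
  finally show ?thesis by simp
qed

text \<open>
The images of a cell index under the symmetries of the circle, wrapped so that \<open>x - mid (\<sigma> j)\<close> stays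
within \<open>3 pi / 2\<close> for \<open>x\<close> in the quarter circle.
\<close>

definition reflections :: "(int \<Rightarrow> int) set" where
  "reflections = {\<lambda>j. j, \<lambda>j. -1 - j, \<lambda>j. 2 * int cells - 1 - j, \<lambda>j. j - 2 * int cells}"

lemma reflections_inj: "\<sigma> \<in> reflections \<Longrightarrow> inj \<sigma>"
  by (auto simp: reflections_def inj_def)

lemma reflections_range:
  assumes "\<sigma> \<in> reflections" "j < cells" "0 \<le> x" "x \<le> pi / 2"
  shows "\<bar>x - mid (\<sigma> (int j))\<bar> \<le> 3 * pi / 2"
proof -
  have "mid (\<sigma> (int j)) = mid j \<or> mid (\<sigma> (int j)) = - mid j \<or> mid (\<sigma> (int j)) = pi - mid j \<or>
      mid (\<sigma> (int j)) = mid j - pi"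
    using assms(1) mid_reflect by (auto simp: reflections_def)
  then show ?thesis using mid_bounds[OF assms(2)] assms(3,4) by (elim disjE) linarith+
qed

lemma cell_range:
  assumes "i < cells" "real i * h \<le> x" "x \<le> (real i + 1) * h"
  shows "0 \<le> x" "x \<le> pi / 2"
proof -
  show "0 \<le> x" using assms(2) h_pos by (auto intro: order_trans[rotated])
  have "(real i + 1) * h \<le> cells * h" using assms(1) h_pos by (intro mult_right_mono) auto
  then show "x \<le> pi / 2" using assms(3) cells_h by simp
qed

lemma fejer_reflected_far_sum:
  assumes "\<sigma> \<in> reflections" "B \<subseteq> bad" "2 \<le> d" "\<And>j. j \<in> B \<Longrightarrow> int d \<le> \<bar>int i - \<sigma> (int j)\<bar>"
    and x: "i < cells" "real i * h \<le> x" "x \<le> (real i + 1) * h"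
  shows "(\<Sum>j\<in>B. fejer m (x - mid (\<sigma> (int j)))) \<le> 50 / (real d - 1)"
proof -
  have inj: "inj_on (\<lambda>j. \<sigma> (int j)) B"
    by (auto intro!: inj_onI dest: injD[OF reflections_inj[OF assms(1)]])
  have "(\<Sum>j\<in>B. fejer m (x - mid (\<sigma> (int j)))) = (\<Sum>k\<in>(\<lambda>j. \<sigma> (int j)) ` B. fejer m (x - mid k))"
    using inj by (simp add: sum.reindex)
  also have "\<dots> \<le> 50 / (real d - 1)"
  proof (rule fejer_far_sum[of _ _ "int i"])
    show "finite ((\<lambda>j. \<sigma> (int j)) ` B)" using finite_subset[OF assms(2) finite_bad] by simp
    show "\<bar>x - mid k\<bar> \<le> 3 * pi / 2" if "k \<in> (\<lambda>j. \<sigma> (int j)) ` B" for k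
      using that assms(2) bad_less_cells cell_range[OF x] reflections_range[OF assms(1)] by blast
  qed (use assms(3,4) x in auto)
  finally show ?thesis .
qed

text \<open>At most three bumps are centred within one cell of \<open>i\<close>, each at most 1; the
  others add at most \<open>50 / (2 - 1)\<close>.\<close>

lemma fejer_reflected_sum:
  assumes "\<sigma> \<in> reflections"
    and x: "i < cells" "real i * h \<le> x" "x \<le> (real i + 1) * h"
  shows "(\<Sum>j\<in>bad. fejer m (x - mid (\<sigma> (int j)))) \<le> 53"
proof -
  let ?N = "{j \<in> bad. \<bar>int i - \<sigma> (int j)\<bar> < 2}" and ?F = "{j \<in> bad. \<not> \<bar>int i - \<sigma> (int j)\<bar> < 2}"
  have inj: "inj_on (\<lambda>j. \<sigma> (int j)) ?N"
    by (auto intro!: inj_onI dest: injD[OF reflections_inj[OF assms(1)]])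
  have "card ?N \<le> card {int i - 1..int i + 1}"
    by (rule card_inj_on_le[OF inj]) auto
  then have "card ?N \<le> 3" by simp
  have "(\<Sum>j\<in>?N. fejer m (x - mid (\<sigma> (int j)))) \<le> (\<Sum>j\<in>?N. 1)" by (intro sum_mono fejer_le_1)
  also have "\<dots> \<le> 3" using \<open>card ?N \<le> 3\<close> by simp
  finally have N: "(\<Sum>j\<in>?N. fejer m (x - mid (\<sigma> (int j)))) \<le> 3" .
  have F: "(\<Sum>j\<in>?F. fejer m (x - mid (\<sigma> (int j)))) \<le> 50 / (real 2 - 1)"
    by (rule fejer_reflected_far_sum[OF assms(1) _ _ _ x]) auto
  have "(\<Sum>j\<in>bad. fejer m (x - mid (\<sigma> (int j))))
    = (\<Sum>j\<in>?N. fejer m (x - mid (\<sigma> (int j)))) + (\<Sum>j\<in>?F. fejer m (x - mid (\<sigma> (int j))))"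
    using finite_bad by (subst sum.union_disjoint[symmetric]) (auto intro!: sum.cong)
  with N F show ?thesis by simp
qed

section \<open>Clusters of bad cells and their signs\<close>

text \<open>A window splits into nine runs of \<open>A\<close> cells but has at most 8 bad
  cells.\<close>

lemma good_run:
  assumes "w < T"
  shows "\<exists>q. 9 * A * w \<le> q \<and> q + A \<le> 9 * A * Suc w \<and> bad \<inter> {q..<q + A} = {}"
proof (rule ccontr)
  assume neg: "\<not> ?thesis"
  have "\<exists>b\<in>bad. 9 * A * w + A * v \<le> b \<and> b < 9 * A * w + A * v + A" if v: "v < 9" for v
  proof -
    have "A * v + A \<le> 9 * A" using mult_le_mono2[of "Suc v" 9 A] v by simp
    then have "9 * A * w + A * v + A \<le> 9 * A * Suc w" by simp
    then have "bad \<inter> {9 * A * w + A * v..<9 * A * w + A * v + A} \<noteq> {}"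
      using neg le_add1[of "9 * A * w" "A * v"] by blast
    then show ?thesis by auto
  qed
  then obtain b where b: "\<And>v. v < 9 \<Longrightarrow> b v \<in> bad \<and> 9 * A * w + A * v \<le> b v \<and> b v < 9 * A * w + A * v + A"
    by metis
  have less: "b u < b v" if "u < v" "v < 9" for u v
  proof -
    have "A * Suc u \<le> A * v" using that by (intro mult_le_mono2) auto
    then show ?thesis using b[of u] b[of v] that by simp
  qed
  have "inj_on b {..<9}" by (rule linorder_inj_onI) (use less in force)+
  then have "card (b ` {..<9}) = 9" by (simp add: card_image)
  moreover have "b ` {..<9} \<subseteq> bad \<inter> {9 * A * w..<9 * A * Suc w}"
  proof (rule image_subsetI)
    fix v :: nat assume "v \<in> {..<9}"
    then have v: "v < 9" by simp
    have "A * v + A \<le> 9 * A" using mult_le_mono2[of "Suc v" 9 A] v by simp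
    moreover have "9 * A * Suc w = 9 * A * w + 9 * A" by simp
    ultimately have "b v < 9 * A * Suc w" "9 * A * w \<le> b v" using b[OF v] by linarith+
    then show "b v \<in> bad \<inter> {9 * A * w..<9 * A * Suc w}" using b[OF v] by simp
  qed
  then have "card (b ` {..<9}) \<le> 8"
    using card_bad_window[OF assms] finite_bad by (meson card_mono finite_Int order_trans)
  ultimately show False by simp
qed

text \<open>
Every window contains a run of \<open>A\<close> good cells, starting at \<open>cut w\<close>; a block reaches from one cut to the
next, so bad cells of different blocks are at least \<open>A\<close> cells apart.
\<close>

definition cut :: "nat \<Rightarrow> nat" where
  "cut w = (SOME q. 9 * A * w \<le> q \<and> q + A \<le> 9 * A * Suc w \<and> bad \<inter> {q..<q + A} = {})"

definition block :: "nat \<Rightarrow> nat" where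
  "block j = (if j < cut (j div (9 * A)) then j div (9 * A) else Suc (j div (9 * A)))"

lemma cut:
  assumes "w < T"
  shows "9 * A * w \<le> cut w" "cut w + A \<le> 9 * A * Suc w" "bad \<inter> {cut w..<cut w + A} = {}"
  using someI_ex[OF good_run[OF assms]] unfolding cut_def[symmetric] by auto

lemma bad_window_less: "j \<in> bad \<Longrightarrow> j div (9 * A) < T"
  using A_pos by (auto simp: bad_def less_mult_imp_div_less mult.commute mult.left_commute)

lemma window_bounds: "9 * A * (j div (9 * A)) \<le> j" "j < 9 * A * Suc (j div (9 * A))"
  using A_pos dividend_less_times_div[of "9 * A" j] by (auto simp: times_div_less_eq_dividend)

text \<open>Some cut separates \<open>i\<close> from \<open>j\<close>, and the \<open>A\<close>
  cells after a cut are good. If \<open>i\<close> lies before the cut of its window, that cut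
  serves, otherwise the next one.\<close>

lemma block_separation:
  assumes "i \<in> bad" "j \<in> bad" "i < j" "block i \<noteq> block j"
  shows "i + A \<le> j"
proof -
  define v where "v = i div (9 * A)"
  define w where "w = j div (9 * A)"
  have vw: "v \<le> w" unfolding v_def w_def using assms(3) by (intro div_le_mono) auto
  have wT: "w < T" using bad_window_less[OF assms(2)] by (simp add: w_def)
  have across: "i + A \<le> j" if "u < T" "i < cut u" "cut u \<le> j" for u
    using cut(3)[OF that(1)] that assms(2) by (auto simp: disjoint_iff)
  have bi: "block i = (if i < cut v then v else Suc v)" and bj: "block j = (if j < cut w then w else Suc w)"
    by (simp_all add: block_def v_def w_def)
  have jw: "9 * A * w \<le> j" using window_bounds(1)[of j] by (simp add: w_def)
  have less_window: "u' < Suc u" if "9 * A * u' < 9 * A * Suc u" for u u' :: nat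
    using that mult_less_cancel1 by blast
  show ?thesis
  proof (cases "i < cut v")
    case True
    have "cut v \<le> j"
    proof (rule ccontr)
      assume "\<not> cut v \<le> j"
      moreover then have "w < Suc v"
        using cut(2)[of v] vw wT jw by (intro less_window) linarith
      then have "w = v" using vw by simp
      ultimately show False using assms(4) True bi bj by simp
    qed
    then show ?thesis using across[of v] True vw wT by simp
  next
    case False
    have "w \<noteq> v" using False assms(3,4) bi bj by auto
    then have v: "Suc v \<le> w" using vw by simp
    then have "i < cut (Suc v)" using window_bounds(2)[of i] cut(1)[of "Suc v"] wT by (simp add: v_def)
    moreover have "cut (Suc v) \<le> j"
    proof (rule ccontr)
      assume "\<not> cut (Suc v) \<le> j"
      moreover then have "w < Suc (Suc v)"
        using cut(2)[of "Suc v"] v wT jw by (intro less_window) linarith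
      then have "w = Suc v" using v by simp
      ultimately show False using assms(4) False bi bj by simp
    qed
    ultimately show ?thesis using across[of "Suc v"] v wT by simp
  qed
qed

lemma card_block: "card {j \<in> bad. block j = v} \<le> 16"
proof -
  have W: "card {j \<in> bad. j div (9 * A) = w} \<le> 8" for w
  proof (cases "w < T")
    case True
    have "{j \<in> bad. j div (9 * A) = w} \<subseteq> bad \<inter> {9 * A * w..<9 * A * Suc w}"
      using window_bounds by auto
    then show ?thesis using card_bad_window[OF True] finite_bad by (meson card_mono finite_Int order_trans)
  next
    case False
    then have "{j \<in> bad. j div (9 * A) = w} = {}" using bad_window_less by auto
    then show ?thesis by (simp only: card.empty)
  qed
  \<comment> \<open>A block meets at most two windows; for \<open>v = 0\<close> the truncated
    \<open>v - 1\<close> merely repeats window 0.\<close>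
  have "{j \<in> bad. block j = v} \<subseteq> {j \<in> bad. j div (9 * A) = v} \<union> {j \<in> bad. j div (9 * A) = v - 1}"
    by (auto simp: block_def split: if_splits)
  then have "card {j \<in> bad. block j = v} \<le> card ({j \<in> bad. j div (9 * A) = v} \<union> {j \<in> bad. j div (9 * A) = v - 1})"
    using finite_bad by (intro card_mono) auto
  also have "\<dots> \<le> 8 + 8" by (intro order_trans[OF card_Un_le] add_mono W)
  finally show ?thesis by simp
qed

text \<open>Blocks, not cells, are coloured: \<open>T + 1\<close> columns against
  \<open>12 * A * T\<close> rows, a ratio of at most \<open>1 / (6 * A)\<close>. Dividing by the
  block bound 16 brings the entries into \<open>[-1, 1]\<close>; hence
  \<open>14336 = 16 * 896\<close>.\<close>

lemma bump_signs:
  "\<exists>\<beta>. (\<forall>j\<in>bad. \<beta> j \<in> {-1, 1 :: real}) \<and>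
    (\<forall>i\<in>bad. \<forall>j\<in>bad. \<bar>int i - int j\<bar> < A \<longrightarrow> \<beta> i = \<beta> j) \<and>
    (\<forall>p<m. \<bar>\<Sum>j\<in>bad. \<beta> j * sin (p * mid j)\<bar> \<le> 14336 * (sqrt m * (1 / (6 * A)) powr (1 / 8)))"
proof -
  define a where "a = (\<lambda>p v. (\<Sum>j\<in>{j \<in> bad. block j = v}. sin (real p * mid j)) / 16)"
  have a: "\<bar>a p v\<bar> \<le> 1" for p v
  proof -
    have "\<bar>\<Sum>j\<in>{j \<in> bad. block j = v}. sin (real p * mid j)\<bar> \<le> (\<Sum>j\<in>{j \<in> bad. block j = v}. 1)"
      by (intro order_trans[OF sum_abs] sum_mono) auto
    also have "\<dots> \<le> 16" using card_block[of v] by simp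
    finally show ?thesis by (simp add: a_def)
  qed
  have "12 * 1 * T \<le> m" unfolding m_def using A_pos by (intro mult_le_mono) auto
  then have "Suc T \<le> m" using T_pos by simp
  then obtain \<xi> where \<xi>: "\<forall>v\<in>{..T}. \<xi> v \<in> {-1, 1}"
    and disc: "\<forall>p\<in>{..<m}. \<bar>\<Sum>v\<in>{..T}. a p v * \<xi> v\<bar>
      \<le> 896 * (sqrt (card {..<m}) * (real (card {..T}) / card {..<m}) powr (1 / 8))"
    using sign_colouring[of "{..T}" "{..<m}" a] a by auto
  have block_le: "block j \<le> T" if "j \<in> bad" for j
    using bad_window_less[OF that] by (auto simp: block_def)
  define \<beta> where "\<beta> = (\<lambda>j. \<xi> (block j))"
  have "\<bar>\<Sum>j\<in>bad. \<beta> j * sin (p * mid j)\<bar> \<le> 14336 * (sqrt m * (1 / (6 * A)) powr (1 / 8))" if p: "p < m" for p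
  proof -
    have "(\<Sum>j\<in>bad. \<beta> j * sin (p * mid j)) = (\<Sum>v\<in>{..T}. \<Sum>j\<in>{j \<in> bad. block j = v}. \<beta> j * sin (p * mid j))"
      using finite_bad block_le by (intro sum.group[symmetric]) auto
    also have "\<dots> = (\<Sum>v\<in>{..T}. 16 * (a p v * \<xi> v))"
      unfolding a_def \<beta>_def by (intro sum.cong) (auto simp: sum_distrib_left sum_divide_distrib mult.commute)
    finally have "\<bar>\<Sum>j\<in>bad. \<beta> j * sin (p * mid j)\<bar> = 16 * \<bar>\<Sum>v\<in>{..T}. a p v * \<xi> v\<bar>"
      by (simp add: abs_mult flip: sum_distrib_left)
    also have "\<dots> \<le> 16 * (896 * (sqrt m * (real (Suc T) / m) powr (1 / 8)))"
      using disc p by (intro mult_left_mono) auto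
    also have "\<dots> \<le> 16 * (896 * (sqrt m * (1 / (6 * A)) powr (1 / 8)))"
    proof (intro mult_left_mono powr_mono2)
      have "real (Suc T) / m \<le> (2 * real T) / m" using T_pos by (intro divide_right_mono) auto
      then show "real (Suc T) / m \<le> 1 / (6 * A)" using T_pos A_pos by (simp add: m_def)
    qed auto
    finally show ?thesis by simp
  qed
  moreover have "\<beta> i = \<beta> j" if "i \<in> bad" "j \<in> bad" "\<bar>int i - int j\<bar> < A" for i j
  proof (rule ccontr)
    assume "\<beta> i \<noteq> \<beta> j"
    then have "block i \<noteq> block j" by (auto simp: \<beta>_def)
    then show False using block_separation[of i j] block_separation[of j i] that by (cases i j rule: linorder_cases) auto
  qed
  moreover have "\<forall>j\<in>bad. \<beta> j \<in> {-1, 1}"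
    using \<xi> block_le unfolding \<beta>_def by blast
  ultimately show ?thesis by (intro exI[of _ \<beta>] conjI ballI allI impI) (assumption | drule (1) bspec)+
qed

end

section \<open>The odd sine polynomial made of bumps\<close>

context flat_cosine
begin

lemma exists_cell:
  assumes "0 \<le> x" "x \<le> pi / 2"
  obtains i where "i < cells" "real i * h \<le> x" "x \<le> (real i + 1) * h"
proof -
  \<comment> \<open>The minimum matters only at \<open>x = pi / 2\<close>, the right end of the last
    cell.\<close>
  define i where "i = min (nat \<lfloor>x / h\<rfloor>) (cells - 1)"
  have cells: "0 < cells" using A_pos T_pos by (simp add: cells_def)
  have xh: "0 \<le> x / h" using assms(1) h_pos by simp
  then have fl: "real (nat \<lfloor>x / h\<rfloor>) \<le> x / h" "x / h \<le> real (nat \<lfloor>x / h\<rfloor>) + 1" by linarith+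
  have "real i \<le> x / h" using fl(1) by (simp add: i_def min_def)
  then have 1: "real i * h \<le> x" using h_pos by (simp add: field_simps)
  have "x / h \<le> cells" using assms(2) cells_h h_pos by (simp add: field_simps)
  then have "x / h \<le> real i + 1" using fl(2) cells by (auto simp: i_def min_def of_nat_diff)
  then have 2: "x \<le> (real i + 1) * h" using h_pos by (simp add: field_simps)
  have "i < cells" using cells by (auto simp: i_def)
  with 1 2 that show thesis by blast
qed

text \<open>
The reflections make a bump odd about \<open>0\<close> and symmetric about \<open>pi / 2\<close>, so that it has only odd sine
frequencies, which the cosine part does not use.
\<close>

definition bump :: "nat \<Rightarrow> real \<Rightarrow> real" where
  "bump j x = fejer m (x - mid j) - fejer m (x + mid j) + fejer m (x + mid j - pi) - fejer m (x - mid j + pi)"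

lemma bump_reflections:
  "bump j x = fejer m (x - mid j) - fejer m (x - mid (-1 - int j))
    + fejer m (x - mid (2 * int cells - 1 - int j)) - fejer m (x - mid (int j - 2 * int cells))"
  unfolding bump_def mid_reflect by (simp add: algebra_simps)

lemma bump_sum_upper:
  assumes \<beta>: "\<And>j. j \<in> bad \<Longrightarrow> \<bar>\<beta> j\<bar> \<le> 1" and x: "i < cells" "real i * h \<le> x" "x \<le> (real i + 1) * h"
  shows "\<bar>\<Sum>j\<in>bad. \<beta> j * bump j x\<bar> \<le> 212"
proof -
  have "\<bar>\<Sum>j\<in>bad. \<beta> j * bump j x\<bar> \<le> (\<Sum>j\<in>bad. fejer m (x - mid j) + fejer m (x - mid (-1 - int j))
    + fejer m (x - mid (2 * int cells - 1 - int j)) + fejer m (x - mid (int j - 2 * int cells)))"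
  proof (intro order_trans[OF sum_abs] sum_mono)
    fix j assume "j \<in> bad"
    then have "\<bar>\<beta> j * bump j x\<bar> \<le> 1 * \<bar>bump j x\<bar>"
      unfolding abs_mult using \<beta> by (intro mult_right_mono) auto
    also have "\<dots> \<le> fejer m (x - mid j) + fejer m (x - mid (-1 - int j))
      + fejer m (x - mid (2 * int cells - 1 - int j)) + fejer m (x - mid (int j - 2 * int cells))"
    proof -
      have "1 * \<bar>a - b + c - d\<bar> \<le> a + b + c + d" if "0 \<le> a" "0 \<le> b" "0 \<le> c" "0 \<le> d" for a b c d :: real
        using that by (simp add: abs_le_iff)
      then show ?thesis unfolding bump_reflections using fejer_nonneg by blast
    qed
    finally show "\<bar>\<beta> j * bump j x\<bar> \<le> \<dots>" .
  qed
  also have "\<dots> \<le> 53 + 53 + 53 + 53"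
    unfolding sum.distrib
    using fejer_reflected_sum[of "\<lambda>j. j", OF _ x] fejer_reflected_sum[of "\<lambda>j. -1 - j", OF _ x]
      fejer_reflected_sum[of "\<lambda>j. 2 * int cells - 1 - j", OF _ x] fejer_reflected_sum[of "\<lambda>j. j - 2 * int cells", OF _ x]
    by (intro add_mono) (simp_all add: reflections_def)
  finally show ?thesis by simp
qed

lemma abs_sum_weighted_le:
  assumes "\<And>j. j \<in> B \<Longrightarrow> \<bar>\<beta> j\<bar> \<le> (1::real)" "\<And>j. j \<in> B \<Longrightarrow> 0 \<le> f j" "(\<Sum>j\<in>B. f j) \<le> K"
  shows "\<bar>\<Sum>j\<in>B. \<beta> j * f j\<bar> \<le> K"
proof -
  have "\<bar>\<Sum>j\<in>B. \<beta> j * f j\<bar> \<le> (\<Sum>j\<in>B. 1 * f j)"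
    using assms(1,2) by (intro order_trans[OF sum_abs] sum_mono) (auto simp: abs_mult intro!: mult_left_le_one_le)
  with assms(3) show ?thesis by simp
qed

text \<open>The bump of the cell itself gives at least 1/2, and bumps less than \<open>A\<close>
  cells away have the same sign. Far bumps and the three reflected families, kept away by
  \<open>bad_inner\<close>, add at most \<open>4 * 50 / (A - 1) \<le> 1/4\<close>; hence
  801.\<close>

lemma bump_sum_lower:
  assumes A: "801 \<le> A" and \<beta>: "\<And>j. j \<in> bad \<Longrightarrow> \<beta> j \<in> {-1, 1}"
    and same: "\<And>i j. i \<in> bad \<Longrightarrow> j \<in> bad \<Longrightarrow> \<bar>int i - int j\<bar> < A \<Longrightarrow> \<beta> i = \<beta> j"
    and i: "i \<in> bad" and x: "real i * h \<le> x" "x \<le> (real i + 1) * h"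
  shows "1 / 4 \<le> \<bar>\<Sum>j\<in>bad. \<beta> j * bump j x\<bar>"
proof -
  define \<epsilon> where "\<epsilon> = 50 / (real A - 1)"
  have \<epsilon>: "\<epsilon> \<le> 1 / 16" using A by (simp add: \<epsilon>_def field_simps)
  have ic: "i < cells" using bad_less_cells[OF i] .
  have \<beta>1: "\<bar>\<beta> j\<bar> \<le> 1" if "j \<in> bad" for j using \<beta>[OF that] by auto
  have refl: "\<bar>\<Sum>j\<in>bad. \<beta> j * fejer m (x - mid (\<sigma> (int j)))\<bar> \<le> \<epsilon>"
    if \<sigma>: "\<sigma> \<in> reflections" "\<And>j. j \<in> bad \<Longrightarrow> int A \<le> \<bar>int i - \<sigma> (int j)\<bar>" for \<sigma>
    unfolding \<epsilon>_def using A \<beta>1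
    by (intro abs_sum_weighted_le fejer_reflected_far_sum[OF \<sigma>(1) _ _ \<sigma>(2) ic x] fejer_nonneg) auto
  have inner: "A \<le> j \<and> j + A < cells" if "j \<in> bad" for j
    using bad_inner[OF that] by (simp add: cells_def)
  have R: "\<bar>\<Sum>j\<in>bad. \<beta> j * fejer m (x - mid (-1 - int j))\<bar> \<le> \<epsilon>"
    "\<bar>\<Sum>j\<in>bad. \<beta> j * fejer m (x - mid (2 * int cells - 1 - int j))\<bar> \<le> \<epsilon>"
    "\<bar>\<Sum>j\<in>bad. \<beta> j * fejer m (x - mid (int j - 2 * int cells))\<bar> \<le> \<epsilon>"
    using refl[of "\<lambda>j. -1 - j"] refl[of "\<lambda>j. 2 * int cells - 1 - j"] refl[of "\<lambda>j. j - 2 * int cells"] inner inner[OF i]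
    by (force simp: reflections_def)+
  let ?N = "{j \<in> bad. \<bar>int i - int j\<bar> < A}" and ?F = "{j \<in> bad. \<not> \<bar>int i - int j\<bar> < A}"
  have F: "\<bar>\<Sum>j\<in>?F. \<beta> j * fejer m (x - mid j)\<bar> \<le> \<epsilon>"
    unfolding \<epsilon>_def using A \<beta>1
    by (intro abs_sum_weighted_le fejer_reflected_far_sum[of "\<lambda>j. j", OF _ _ _ _ ic x] fejer_nonneg)
      (auto simp: reflections_def)
  have "\<bar>x - mid i\<bar> \<le> h / 2" using x unfolding abs_le_iff mid_def distrib_right by simp
  then have "real m * \<bar>x - mid i\<bar> \<le> real m * (h / 2)" by (intro mult_left_mono) auto
  then have "real m * \<bar>x - mid i\<bar> \<le> pi / 3" using mh by simp
  then have "1 / 2 \<le> fejer m (x - mid i)" using m_pos by (intro fejer_ge_half) auto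
  also have "\<dots> \<le> (\<Sum>j\<in>?N. fejer m (x - mid j))"
    using i A finite_bad by (intro member_le_sum fejer_nonneg) auto
  finally have N: "1 / 2 \<le> (\<Sum>j\<in>?N. fejer m (x - mid j))" .
  have "(\<Sum>j\<in>?N. \<beta> j * fejer m (x - mid j)) = \<beta> i * (\<Sum>j\<in>?N. fejer m (x - mid j))"
    unfolding sum_distrib_left using same[OF i] by (intro sum.cong) auto
  then have N': "1 / 2 \<le> \<bar>\<Sum>j\<in>?N. \<beta> j * fejer m (x - mid j)\<bar>"
    using N \<beta>[OF i] by (auto simp: abs_mult)
  have "(\<Sum>j\<in>bad. \<beta> j * fejer m (x - mid j))
    = (\<Sum>j\<in>?N. \<beta> j * fejer m (x - mid j)) + (\<Sum>j\<in>?F. \<beta> j * fejer m (x - mid j))"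
    using finite_bad by (subst sum.union_disjoint[symmetric]) (auto intro!: sum.cong)
  moreover have "(\<Sum>j\<in>bad. \<beta> j * bump j x) = (\<Sum>j\<in>bad. \<beta> j * fejer m (x - mid j))
      - (\<Sum>j\<in>bad. \<beta> j * fejer m (x - mid (-1 - int j)))
      + (\<Sum>j\<in>bad. \<beta> j * fejer m (x - mid (2 * int cells - 1 - int j)))
      - (\<Sum>j\<in>bad. \<beta> j * fejer m (x - mid (int j - 2 * int cells)))"
    unfolding bump_reflections by (simp add: right_diff_distrib distrib_left sum.distrib sum_subtractf)
  ultimately show ?thesis using N' F R \<epsilon> by linarith
qed

text \<open>As \<open>A\<close> grows the coefficients shrink while the bounds 212 and
  \<open>1/4\<close> on the values stay fixed; this leaves room for scaling the bumps up. The
  constant is \<open>114688 = 8 * 14336\<close>.\<close>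

lemma bump_polynomial:
  assumes A: "801 \<le> A"
  shows "\<exists>e. (\<forall>p<m. \<bar>e p\<bar> \<le> 114688 * (1 / (6 * A)) powr (1 / 8) / sqrt m) \<and>
    (\<forall>x. 0 \<le> x \<and> x \<le> pi / 2 \<longrightarrow>
       \<bar>\<Sum>p\<in>{p\<in>{..<m}. odd p}. e p * sin (p * x)\<bar> \<le> 212 \<and>
       (\<bar>c x\<bar> < \<eta> * 2 ^ r \<longrightarrow> 1 / 4 \<le> \<bar>\<Sum>p\<in>{p\<in>{..<m}. odd p}. e p * sin (p * x)\<bar>))"
proof -
  obtain \<beta> where \<beta>: "\<forall>j\<in>bad. \<beta> j \<in> {-1, 1 :: real}"
    and same: "\<forall>i\<in>bad. \<forall>j\<in>bad. \<bar>int i - int j\<bar> < A \<longrightarrow> \<beta> i = \<beta> j"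
    and coef: "\<forall>p<m. \<bar>\<Sum>j\<in>bad. \<beta> j * sin (p * mid j)\<bar> \<le> 14336 * (sqrt m * (1 / (6 * A)) powr (1 / 8))"
    using bump_signs by blast
  define e where "e = (\<lambda>p. 8 * (real m - real p) / (real m)\<^sup>2 * (\<Sum>j\<in>bad. \<beta> j * sin (real p * mid j)))"
  have series: "(\<Sum>p\<in>{p\<in>{..<m}. odd p}. e p * sin (real p * x)) = (\<Sum>j\<in>bad. \<beta> j * bump j x)" for x
  proof -
    have "(\<Sum>p\<in>{p\<in>{..<m}. odd p}. e p * sin (real p * x))
      = (\<Sum>p\<in>{p\<in>{..<m}. odd p}. \<Sum>j\<in>bad. \<beta> j * (8 * (real m - real p) / (real m)\<^sup>2 * sin (real p * mid j) * sin (real p * x)))"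
      unfolding e_def sum_distrib_left sum_distrib_right by (intro sum.cong) auto
    also have "\<dots> = (\<Sum>j\<in>bad. \<beta> j * (\<Sum>p\<in>{p\<in>{..<m}. odd p}. 8 * (real m - real p) / (real m)\<^sup>2 * sin (real p * mid j) * sin (real p * x)))"
      unfolding sum_distrib_left by (rule sum.swap)
    finally show ?thesis unfolding bump_def fejer_odd_sine_series .
  qed
  have "\<bar>e p\<bar> \<le> 114688 * (1 / (6 * A)) powr (1 / 8) / sqrt m" if p: "p < m" for p
  proof -
    have "\<bar>8 * (real m - real p) / (real m)\<^sup>2\<bar> \<le> 8 * real m / (real m)\<^sup>2"
      using p by (simp add: abs_mult divide_right_mono)
    then have "\<bar>e p\<bar> \<le> 8 * real m / (real m)\<^sup>2 * (14336 * (sqrt m * (1 / (6 * A)) powr (1 / 8)))"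
      unfolding e_def abs_mult[of "8 * (real m - real p) / (real m)\<^sup>2"] using coef p by (intro mult_mono) auto
    also have "8 * real m / (real m)\<^sup>2 = 8 / (sqrt m * sqrt m)"
      using m_pos by (simp add: power2_eq_square)
    also have "8 / (sqrt m * sqrt m) * (14336 * (sqrt m * (1 / (6 * A)) powr (1 / 8)))
       = 114688 * (1 / (6 * A)) powr (1 / 8) / sqrt m"
    proof -
      have "8 / (s * s) * (14336 * (s * y)) = 114688 * y / s" if "s > 0" for s y :: real
        using that by (simp add: field_simps)
      note key = this
      show ?thesis by (rule key) (use m_pos in simp)
    qed
    finally show ?thesis .
  qed
  moreover have "\<bar>\<Sum>j\<in>bad. \<beta> j * bump j x\<bar> \<le> 212 \<and> (\<bar>c x\<bar> < \<eta> * 2 ^ r \<longrightarrow> 1 / 4 \<le> \<bar>\<Sum>j\<in>bad. \<beta> j * bump j x\<bar>)"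
    if range: "0 \<le> x \<and> x \<le> pi / 2" for x
  proof -
    obtain i where i: "i < cells" "real i * h \<le> x" "x \<le> (real i + 1) * h"
      using exists_cell range by blast
    have "\<bar>\<Sum>j\<in>bad. \<beta> j * bump j x\<bar> \<le> 212" using \<beta> by (intro bump_sum_upper[OF _ i]) auto
    moreover have "1 / 4 \<le> \<bar>\<Sum>j\<in>bad. \<beta> j * bump j x\<bar>" if "\<bar>c x\<bar> < \<eta> * 2 ^ r"
    proof -
      have ib: "i \<in> bad" using i that by (auto simp: bad_def cells_def add.commute)
      show ?thesis by (rule bump_sum_lower[OF A _ _ ib i(2,3)]) (use \<beta> same in blast)+
    qed
    ultimately show ?thesis by blast
  qed
  ultimately show ?thesis unfolding series[symmetric] by (intro exI[of _ e]) blast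
qed

end

section \<open>Assembling the polynomial\<close>

lemma unit_circle_quadrant:
  assumes "cmod z = 1"
  obtains x where "0 \<le> x" "x \<le> pi / 2" "z = cis x \<or> z = cnj (cis x) \<or> z = - cis x \<or> z = - cnj (cis x)"
proof -
  define x where "x = arccos \<bar>Re z\<bar>"
  have re: "\<bar>Re z\<bar> \<le> 1" using abs_Re_le_cmod[of z] assms by simp
  have sum1: "(Re z)\<^sup>2 + (Im z)\<^sup>2 = 1" using assms cmod_power2[of z] by simp
  have cosx: "cos x = \<bar>Re z\<bar>" unfolding x_def using re by (intro cos_arccos) auto
  have "sin x = sqrt (1 - \<bar>Re z\<bar>\<^sup>2)" unfolding x_def using re by (intro sin_arccos) auto
  also have "1 - \<bar>Re z\<bar>\<^sup>2 = (Im z)\<^sup>2" using sum1 by simp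
  finally have sinx: "sin x = \<bar>Im z\<bar>" by simp
  have "0 \<le> x" unfolding x_def using re by (intro arccos_lbound) auto
  moreover have "x \<le> pi / 2" unfolding x_def by (rule arccos_le_pi2) (use re in auto)
  moreover have "z = cis x \<or> z = cnj (cis x) \<or> z = - cis x \<or> z = - cnj (cis x)"
    using cosx sinx by (auto simp: complex_eq_iff abs_if split: if_splits)
  ultimately show thesis using that by blast
qed

lemma odd_sine_polynomial_reflect:
  assumes "\<And>p. p \<in> B \<Longrightarrow> odd p" "z = w \<or> z = cnj w \<or> z = - w \<or> z = - cnj w"
  shows "\<bar>\<Sum>p\<in>B. e p * Im (z ^ p)\<bar> = \<bar>\<Sum>p\<in>B. (e p :: real) * Im (w ^ p)\<bar>"
proof -
  have "(\<Sum>p\<in>B. e p * Im (z ^ p)) = (\<Sum>p\<in>B. e p * Im (w ^ p)) \<or>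
      (\<Sum>p\<in>B. e p * Im (z ^ p)) = (\<Sum>p\<in>B. - (e p * Im (w ^ p)))"
  proof -
    have "(\<forall>p\<in>B. Im (z ^ p) = Im (w ^ p)) \<or> (\<forall>p\<in>B. Im (z ^ p) = - Im (w ^ p))"
      using assms by (auto simp: power_minus_odd simp flip: complex_cnj_power)
    then show ?thesis by auto
  qed
  then show ?thesis by (auto simp: sum_negf)
qed

context flat_cosine
begin

definition cosine_freqs :: "nat set" where
  "cosine_freqs = (\<lambda>k. 2 * (T + k)) ` {..<4 ^ r} \<union> (\<lambda>k. 2 * (2 * T + k)) ` {..<4 ^ r}"

text \<open>The threshold \<open>4 * T\<close> tells the two frequency ranges apart because
  \<open>4 ^ r < T\<close>.\<close>

definition cosine_sign :: "nat \<Rightarrow> int" where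
  "cosine_sign j = (if j < 4 * T then rs_sign (2 * r) True (j div 2 - T) else rs_sign (2 * r) False (j div 2 - 2 * T))"

lemma four_power_less: "4 ^ r < T"
proof -
  have "1 \<le> (90 * A) ^ 4" using A_pos by (intro one_le_power) simp
  then have "1 < 112 * (90 * A) ^ 4" by linarith
  then have "1 * 4 ^ r < 112 * (90 * A) ^ 4 * 4 ^ r" by (intro mult_strict_right_mono) auto
  then show ?thesis using T_large by linarith
qed

lemma cosine_sum: "(\<Sum>j\<in>cosine_freqs. of_int (cosine_sign j) * z ^ j)
    = z ^ (2 * T) * rs_poly (2 * r) True (z\<^sup>2) + z ^ (4 * T) * rs_poly (2 * r) False (z\<^sup>2)"
proof -
  let ?f = "\<lambda>j. of_int (cosine_sign j) * z ^ j"
  have four: "(2::nat) ^ (2 * r) = 4 ^ r" by (simp add: power_mult)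
  have "(\<Sum>j\<in>cosine_freqs. ?f j) = (\<Sum>j\<in>(\<lambda>k. 2 * (T + k)) ` {..<4 ^ r}. ?f j) + (\<Sum>j\<in>(\<lambda>k. 2 * (2 * T + k)) ` {..<4 ^ r}. ?f j)"
    unfolding cosine_freqs_def using four_power_less by (intro sum.union_disjoint) auto
  also have "\<dots> = (\<Sum>k<4 ^ r. ?f (2 * (T + k))) + (\<Sum>k<4 ^ r. ?f (2 * (2 * T + k)))"
    by (simp add: sum.reindex inj_on_def)
  also have "(\<Sum>k<4 ^ r. ?f (2 * (T + k))) = z ^ (2 * T) * rs_poly (2 * r) True (z\<^sup>2)"
  proof -
    have "z ^ (2 * (T + k)) = z ^ (2 * T) * (z\<^sup>2) ^ k" for k
      by (simp add: power_add flip: power_mult)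
    then show ?thesis unfolding rs_poly_def four sum_distrib_left using four_power_less
      by (intro sum.cong) (auto simp: cosine_sign_def)
  qed
  also have "(\<Sum>k<4 ^ r. ?f (2 * (2 * T + k))) = z ^ (4 * T) * rs_poly (2 * r) False (z\<^sup>2)"
  proof -
    have "z ^ (2 * (2 * T + k)) = z ^ (4 * T) * (z\<^sup>2) ^ k" for k
      by (simp add: power_add flip: power_mult)
    then show ?thesis unfolding rs_poly_def four sum_distrib_left
      by (intro sum.cong) (auto simp: cosine_sign_def)
  qed
  finally show ?thesis .
qed

lemma cosine_freqs_even: "j \<in> cosine_freqs \<Longrightarrow> even j"
  by (auto simp: cosine_freqs_def)

lemma cosine_freqs_bounds:
  assumes "j \<in> cosine_freqs"
  shows "1 \<le> j" "j \<le> m"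
proof -
  show "1 \<le> j" using assms T_pos by (auto simp: cosine_freqs_def)
  have "j \<le> 6 * T" using assms four_power_less by (auto simp: cosine_freqs_def)
  also have "\<dots> \<le> m" using A_pos by (simp add: m_def)
  finally show "j \<le> m" .
qed

lemma sine_signs:
  assumes A: "10 ^ 80 \<le> A" and L: "m \<le> L" "L \<le> 4 * m"
  shows "\<exists>s. (\<forall>k\<in>{1..L} - cosine_freqs. s k \<in> {-1, 1 :: real}) \<and>
    (\<forall>z. cmod z = 1 \<longrightarrow>
       \<bar>\<Sum>k\<in>{1..L} - cosine_freqs. s k * Im (z ^ k)\<bar> \<le> 10 ^ 7 * sqrt L \<and>
       (\<bar>rs_cosine T (2 * r) z\<bar> < \<eta> * 2 ^ r \<longrightarrow> sqrt L \<le> \<bar>\<Sum>k\<in>{1..L} - cosine_freqs. s k * Im (z ^ k)\<bar>))"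
proof -
  define S where "S = {1..L} - cosine_freqs"
  define B where "B = {p\<in>{..<m}. odd p}"
  have finS: "finite S" and SL: "S \<subseteq> {..L}" by (auto simp: S_def)
  have BS: "B \<subseteq> S" using L(1) cosine_freqs_even by (auto simp: B_def S_def elim: oddE)
  have L1: "1 \<le> L" using L(1) m_pos by linarith
  have A801: "801 \<le> A" using A by simp
  then obtain e where e: "\<forall>p<m. \<bar>e p\<bar> \<le> 114688 * (1 / (6 * A)) powr (1 / 8) / sqrt m"
    and G: "\<forall>x::real. 0 \<le> x \<and> x \<le> pi / 2 \<longrightarrow> \<bar>\<Sum>p\<in>B. e p * sin (p * x)\<bar> \<le> 212 \<and>
       (\<bar>c x\<bar> < \<eta> * 2 ^ r \<longrightarrow> 1 / 4 \<le> \<bar>\<Sum>p\<in>B. e p * sin (p * x)\<bar>)"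
    using bump_polynomial[OF A801, folded B_def] by (elim exE conjE) (rule that)
  \<comment> \<open>On bad points \<open>K / 4\<close> has to exceed the rounding error
    \<open>10758 * sqrt L\<close> by \<open>sqrt L\<close>, and
    \<open>43036 = 4 * 10759\<close>.\<close>
  define K where "K = 43036 * sqrt L"
  define ehat where "ehat = (\<lambda>k. if k \<in> B then K * e k else 0)"
  have ehat: "\<bar>ehat k\<bar> \<le> 1" for k
  proof (cases "k \<in> B")
    case True
    have sL: "sqrt L \<le> 2 * sqrt m"
    proof -
      have "real L \<le> real (4 * m)" using L(2) by (rule of_nat_mono)
      then have "sqrt L \<le> sqrt (4 * real m)" by (intro real_sqrt_le_mono) simp
      then show ?thesis by (simp add: real_sqrt_mult)
    qed
    \<comment> \<open>This dictates the size of \<open>A\<close>: with an eighth root of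
      \<open>10 ^ 80\<close> the product \<open>43036 * 2 * 114688 / 10 ^ 10\<close> is just below
      1.\<close>
    have powr: "(1 / (6 * real A)) powr (1 / 8) \<le> 1 / 10 ^ 10"
    proof -
      have "(10::real) ^ 80 \<le> real A" using A by (metis of_nat_le_iff of_nat_numeral of_nat_power)
      then have "1 / (6 * real A) \<le> 1 / 10 ^ 80" by (intro divide_left_mono) auto
      then have "(1 / (6 * real A)) powr (1 / 8) \<le> (1 / 10 ^ 80) powr (1 / 8)" by (intro powr_mono2) auto
      also have "(1 / 10 ^ 80 :: real) = (1 / 10 ^ 10) ^ 8" by (simp add: power_divide flip: power_mult)
      also have "((1 / 10 ^ 10 :: real) ^ 8) powr (1 / 8) = 1 / 10 ^ 10"
        by (simp add: powr_powr flip: powr_numeral)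
      finally show ?thesis .
    qed
    have "\<bar>ehat k\<bar> = K * \<bar>e k\<bar>" using True by (simp add: ehat_def K_def abs_mult)
    also have "\<dots> \<le> (43036 * (2 * sqrt m)) * (114688 * (1 / 10 ^ 10) / sqrt m)"
    proof (rule mult_mono)
      have "\<bar>e k\<bar> \<le> 114688 * (1 / (6 * A)) powr (1 / 8) / sqrt m" using e True by (auto simp: B_def)
      also have "\<dots> \<le> 114688 * (1 / 10 ^ 10) / sqrt m" using powr by (intro divide_right_mono mult_left_mono) auto
      finally show "\<bar>e k\<bar> \<le> 114688 * (1 / 10 ^ 10) / sqrt m" .
    qed (use sL in \<open>auto simp: K_def\<close>)
    also have "\<dots> \<le> 1" using m_pos by simp
    finally show ?thesis .
  qed (simp add: ehat_def)
  have "card S \<le> card {1..L}" unfolding S_def by (intro card_mono) auto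
  then have cardS: "card S \<le> card {..<4 * L}" by simp
  \<comment> \<open>The rows are the \<open>4 * L\<close> grid points from which
    \<open>sine_polynomial_grid_bound\<close> recovers the whole circle.\<close>
  obtain s where s: "\<forall>k\<in>S. s k \<in> {-1, 1 :: real}"
    and disc: "\<forall>q\<in>{..<4 * L}. \<bar>\<Sum>k\<in>S. sin (real k * (2 * pi * real q / (4 * real L))) * (s k - ehat k)\<bar> \<le> 1792 * sqrt (card {..<4 * L}) + 2"
    using sign_rounding[of S "{..<4 * L}" "\<lambda>q k. sin (real k * (2 * pi * real q / (4 * real L)))" ehat] finS cardS ehat by auto
  have close: "\<bar>(\<Sum>k\<in>S. s k * Im (z ^ k)) - K * (\<Sum>p\<in>B. e p * Im (z ^ p))\<bar> \<le> 10758 * sqrt L" if z: "cmod z = 1" for z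
  proof -
    define x where "x = Arg z"
    have "z \<noteq> 0" using z by auto
    then have x: "z = cis x" using cis_Arg[of z] z by (simp add: x_def sgn_div_norm)
    have "\<bar>\<Sum>k\<in>S. (s k - ehat k) * sin (k * x)\<bar> \<le> 3 * (1792 * sqrt (4 * L) + 2)"
      using L1 SL disc by (intro sine_polynomial_grid_bound) (auto simp: mult.commute)
    \<comment> \<open>\<open>3 * 1792 * 2 = 10752\<close>, and the remaining 6 is absorbed by
      \<open>sqrt L \<ge> 1\<close>.\<close>
    also have "\<dots> \<le> 10758 * sqrt L"
    proof -
      have "1 \<le> sqrt L" using L1 by simp
      moreover have four: "sqrt (4 * L) = 2 * sqrt L" by (simp add: real_sqrt_mult)
      ultimately show ?thesis unfolding four by (simp add: algebra_simps)
    qed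
    also have "(\<Sum>k\<in>S. (s k - ehat k) * sin (k * x)) = (\<Sum>k\<in>S. s k * Im (z ^ k)) - (\<Sum>k\<in>S. ehat k * Im (z ^ k))"
      by (simp add: x Complex.DeMoivre left_diff_distrib sum_subtractf)
    also have "(\<Sum>k\<in>S. ehat k * Im (z ^ k)) = (\<Sum>k\<in>B. K * (e k * Im (z ^ k)))"
      using finS BS by (intro sum.mono_neutral_cong_right) (auto simp: ehat_def)
    also have "\<dots> = K * (\<Sum>p\<in>B. e p * Im (z ^ p))" by (simp add: sum_distrib_left)
    finally show ?thesis .
  qed
  have "\<bar>\<Sum>k\<in>S. s k * Im (z ^ k)\<bar> \<le> 10 ^ 7 * sqrt L \<and>
       (\<bar>rs_cosine T (2 * r) z\<bar> < \<eta> * 2 ^ r \<longrightarrow> sqrt L \<le> \<bar>\<Sum>k\<in>S. s k * Im (z ^ k)\<bar>)" if z: "cmod z = 1" for z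
  proof -
    obtain x where x: "0 \<le> x" "x \<le> pi / 2" and zx: "z = cis x \<or> z = cnj (cis x) \<or> z = - cis x \<or> z = - cnj (cis x)"
      using unit_circle_quadrant[OF z] by blast
    have cz: "rs_cosine T (2 * r) z = c x"
      using zx rs_cosine_minus rs_cosine_cnj unfolding c_def by metis
    define g where "g = \<bar>\<Sum>p\<in>B. e p * Im (z ^ p)\<bar>"
    have "g = \<bar>\<Sum>p\<in>B. e p * Im (cis x ^ p)\<bar>"
      unfolding g_def by (rule odd_sine_polynomial_reflect[OF _ zx]) (simp add: B_def)
    then have "g = \<bar>\<Sum>p\<in>B. e p * sin (p * x)\<bar>" by (simp add: Complex.DeMoivre)
    then have g: "g \<le> 212" "\<bar>c x\<bar> < \<eta> * 2 ^ r \<longrightarrow> 1 / 4 \<le> g" using G x by auto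
    have K0: "0 \<le> K" by (simp add: K_def)
    have Kg: "\<bar>K * (\<Sum>p\<in>B. e p * Im (z ^ p))\<bar> = K * g" using K0 by (simp add: abs_mult g_def)
    have "K * g \<le> K * 212" using g(1) K0 by (rule mult_left_mono)
    then have "\<bar>\<Sum>k\<in>S. s k * Im (z ^ k)\<bar> \<le> 10758 * sqrt L + 212 * (43036 * sqrt L)"
      using close[OF z] Kg unfolding K_def by linarith
    also have "\<dots> \<le> 10 ^ 7 * sqrt L" by simp
    finally have 1: "\<bar>\<Sum>k\<in>S. s k * Im (z ^ k)\<bar> \<le> 10 ^ 7 * sqrt L" .
    have "sqrt L \<le> \<bar>\<Sum>k\<in>S. s k * Im (z ^ k)\<bar>" if "\<bar>c x\<bar> < \<eta> * 2 ^ r"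
    proof -
      have "K * (1 / 4) \<le> K * g" using g(2) that K0 by (intro mult_left_mono) auto
      then show ?thesis using close[OF z] Kg unfolding K_def by linarith
    qed
    with 1 show ?thesis by (simp add: cz)
  qed
  with s show ?thesis unfolding S_def by blast
qed

end

section \<open>Coefficients arranged around the middle degree\<close>

text \<open>Only the middle coefficient and, for odd \<open>n\<close>, the top one escape the
  pairing of \<open>L + j\<close> with \<open>L - j\<close>; each contributes modulus 1, hence the
  error 2.\<close>

lemma symmetric_littlewood:
  fixes a s :: "nat \<Rightarrow> int"
  assumes C: "C \<subseteq> {1..L}" and a: "\<And>k. k \<in> C \<Longrightarrow> a k \<in> {-1, 1}"
    and s: "\<And>k. k \<in> {1..L} - C \<Longrightarrow> s k \<in> {-1, 1}" and n: "n = 2 * L \<or> n = 2 * L + 1"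
  shows "\<exists>eps. littlewood_signs n eps \<and> (\<forall>z. cmod z = 1 \<longrightarrow>
    \<bar>cmod (littlewood_eval n eps z)
      - cmod (Complex (2 * Re (\<Sum>k\<in>C. of_int (a k) * z ^ k)) (2 * (\<Sum>k\<in>{1..L} - C. s k * Im (z ^ k))))\<bar> \<le> 2)"
proof -
  define t where "t = (\<lambda>j. if j \<in> C then a j else s j)"
  define u where "u = (\<lambda>j. if j \<in> C then a j else - s j)"
  define eps where "eps = (\<lambda>k. if k = L \<or> 2 * L < k then 1 else if L < k then t (k - L) else u (L - k))"
  have tu: "t j \<in> {-1, 1} \<and> u j \<in> {-1, 1}" if "1 \<le> j" "j \<le> L" for j
    using a[of j] s[of j] that by (cases "j \<in> C") (auto simp: t_def u_def)
  have "littlewood_signs n eps"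
    unfolding littlewood_signs_def
  proof (intro allI impI)
    fix k assume "k \<le> n"
    show "eps k = 1 \<or> eps k = -1"
      using tu[of "k - L"] tu[of "L - k"] by (auto simp: eps_def)
  qed
  moreover have "\<bar>cmod (littlewood_eval n eps z)
      - cmod (Complex (2 * Re (\<Sum>k\<in>C. of_int (a k) * z ^ k)) (2 * (\<Sum>k\<in>{1..L} - C. s k * Im (z ^ k))))\<bar> \<le> 2"
    if z: "cmod z = 1" for z
  proof -
    define W where "W = Complex (2 * Re (\<Sum>k\<in>C. of_int (a k) * z ^ k)) (2 * (\<Sum>k\<in>{1..L} - C. s k * Im (z ^ k)))"
    have zc: "z * cnj z = 1" using z complex_norm_square[of z] by simp
    have low: "z ^ (L - j) = z ^ L * cnj (z ^ j)" if "j \<le> L" for j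
    proof -
      have "z ^ L * cnj (z ^ j) = z ^ (L - j) * (z ^ j * cnj (z ^ j))"
        using that by (simp flip: power_add mult.assoc)
      also have "z ^ j * cnj (z ^ j) = (z * cnj z) ^ j" by (simp add: power_mult_distrib)
      finally show ?thesis by (simp add: zc)
    qed
    have "(\<Sum>k\<le>2 * L. of_int (eps k) * z ^ k) = (\<Sum>k<L + Suc L. of_int (eps k) * z ^ k)"
      by (intro sum.cong) auto
    also have "\<dots> = (\<Sum>k<L. of_int (eps k) * z ^ k) + (z ^ L + (\<Sum>k<L. of_int (eps (L + Suc k)) * z ^ (L + Suc k)))"
      unfolding sum_lessThan_add sum.lessThan_Suc_shift by (simp add: eps_def)
    also have "(\<Sum>k<L. of_int (eps k) * z ^ k) = (\<Sum>j\<in>{1..L}. of_int (u j) * z ^ (L - j))"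
      by (rule sum.reindex_bij_witness[of _ "\<lambda>j. L - j" "\<lambda>k. L - k"]) (auto simp: eps_def)
    also have "(\<Sum>k<L. of_int (eps (L + Suc k)) * z ^ (L + Suc k)) = (\<Sum>j\<in>{1..L}. of_int (t j) * z ^ (L + j))"
      by (rule sum.reindex_bij_witness[of _ "\<lambda>j. j - 1" Suc]) (auto simp: eps_def)
    finally have "(\<Sum>k\<le>2 * L. of_int (eps k) * z ^ k)
        = (\<Sum>j\<in>{1..L}. of_int (u j) * z ^ (L - j)) + (z ^ L + (\<Sum>j\<in>{1..L}. of_int (t j) * z ^ (L + j)))" .
    also have "\<dots> = z ^ L * (1 + (\<Sum>j\<in>{1..L}. of_int (t j) * z ^ j + of_int (u j) * cnj (z ^ j)))"
      using low by (simp add: sum.distrib sum_distrib_left distrib_left power_add mult_ac)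
    also have "(\<Sum>j\<in>{1..L}. of_int (t j) * z ^ j + of_int (u j) * cnj (z ^ j)) = W"
    proof -
      have "(\<Sum>j\<in>{1..L}. of_int (t j) * z ^ j + of_int (u j) * cnj (z ^ j))
        = (\<Sum>j\<in>{1..L} - C. of_int (t j) * z ^ j + of_int (u j) * cnj (z ^ j)) + (\<Sum>j\<in>C. of_int (t j) * z ^ j + of_int (u j) * cnj (z ^ j))"
        using C by (intro sum.subset_diff) auto
      also have "(\<Sum>j\<in>C. of_int (t j) * z ^ j + of_int (u j) * cnj (z ^ j)) = (\<Sum>j\<in>C. of_real (2 * (a j * Re (z ^ j))))"
      proof (intro sum.cong refl)
        fix j assume "j \<in> C"
        then have "of_int (t j) * z ^ j + of_int (u j) * cnj (z ^ j) = of_int (a j) * (z ^ j + cnj (z ^ j))"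
          by (simp add: t_def u_def distrib_left)
        also have "\<dots> = of_int (a j) * of_real (2 * Re (z ^ j))" by (simp only: complex_add_cnj)
        finally show "of_int (t j) * z ^ j + of_int (u j) * cnj (z ^ j) = of_real (2 * (a j * Re (z ^ j)))" by simp
      qed
      also have "(\<Sum>j\<in>{1..L} - C. of_int (t j) * z ^ j + of_int (u j) * cnj (z ^ j)) = (\<Sum>j\<in>{1..L} - C. \<i> * of_real (2 * (s j * Im (z ^ j))))"
      proof (intro sum.cong refl)
        fix j assume "j \<in> {1..L} - C"
        then have "of_int (t j) * z ^ j + of_int (u j) * cnj (z ^ j) = of_int (s j) * (z ^ j - cnj (z ^ j))"
          by (simp add: t_def u_def right_diff_distrib)
        also have "\<dots> = of_int (s j) * (of_real (2 * Im (z ^ j)) * \<i>)" by (simp only: complex_diff_cnj)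
        finally show "of_int (t j) * z ^ j + of_int (u j) * cnj (z ^ j) = \<i> * of_real (2 * (s j * Im (z ^ j)))" by simp
      qed
      finally show ?thesis unfolding W_def by (simp add: complex_eq_iff sum_distrib_left mult_ac)
    qed
    finally have even: "(\<Sum>k\<le>2 * L. of_int (eps k) * z ^ k) = z ^ L * (1 + W)" .
    obtain y where y: "littlewood_eval n eps z = z ^ L * (1 + W) + y" "cmod y \<le> 1"
    proof (cases "n = 2 * L")
      case True
      then show thesis using that[of 0] even by (simp add: littlewood_eval_def)
    next
      case False
      then have "n = Suc (2 * L)" using n by simp
      then show thesis using that[of "z ^ Suc (2 * L)"] even z by (simp add: littlewood_eval_def eps_def norm_mult norm_power)
    qed
    have "cmod (z ^ L * W) = cmod W" using z by (simp add: norm_mult norm_power)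
    moreover have "littlewood_eval n eps z = z ^ L * W + (z ^ L + y)" by (simp add: y(1) algebra_simps)
    moreover have "cmod (z ^ L + y) \<le> 2"
      using norm_triangle_ineq[of "z ^ L" y] y(2) z by (simp add: norm_power)
    ultimately have "\<bar>cmod (littlewood_eval n eps z) - cmod W\<bar> \<le> 2"
      using norm_triangle_ineq3[of "z ^ L * W + (z ^ L + y)" "z ^ L * W"] by simp
    then show ?thesis unfolding W_def .
  qed
  ultimately show ?thesis by blast
qed

lemma (in flat_cosine) flat_littlewood:
  assumes A: "10 ^ 80 \<le> A" and L: "m \<le> L" "L \<le> 4 * m" and n: "n = 2 * L \<or> n = 2 * L + 1"
  shows "\<exists>eps. littlewood_signs n eps \<and> (\<forall>z. cmod z = 1 \<longrightarrow>
    2 * min (\<eta> * 2 ^ r) (sqrt L) - 2 \<le> cmod (littlewood_eval n eps z) \<and>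
    cmod (littlewood_eval n eps z) \<le> 2 * (3 * 2 ^ r + 10 ^ 7 * sqrt L) + 2)"
proof -
  obtain s where s: "\<forall>k\<in>{1..L} - cosine_freqs. s k \<in> {-1, 1 :: real}"
    and sine: "\<forall>z. cmod z = 1 \<longrightarrow>
       \<bar>\<Sum>k\<in>{1..L} - cosine_freqs. s k * Im (z ^ k)\<bar> \<le> 10 ^ 7 * sqrt L \<and>
       (\<bar>rs_cosine T (2 * r) z\<bar> < \<eta> * 2 ^ r \<longrightarrow> sqrt L \<le> \<bar>\<Sum>k\<in>{1..L} - cosine_freqs. s k * Im (z ^ k)\<bar>)"
    using sine_signs[OF A L] by (elim exE conjE) (rule that)
  define s' where "s' = (\<lambda>k. if s k = 1 then 1 else -1 :: int)"
  have s': "(\<Sum>k\<in>{1..L} - cosine_freqs. s' k * Im (z ^ k)) = (\<Sum>k\<in>{1..L} - cosine_freqs. s k * Im (z ^ k))" for z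
  proof (intro sum.cong refl)
    fix k assume "k \<in> {1..L} - cosine_freqs"
    then have "s k = -1 \<or> s k = 1" using s by blast
    then show "s' k * Im (z ^ k) = s k * Im (z ^ k)" by (auto simp: s'_def)
  qed
  have C: "cosine_freqs \<subseteq> {1..L}" using cosine_freqs_bounds L(1) by fastforce
  have signs: "cosine_sign k \<in> {-1, 1}" "s' k \<in> {-1, 1}" for k
    using rs_sign_cases[of "2 * r" True "k div 2 - T"] rs_sign_cases[of "2 * r" False "k div 2 - 2 * T"]
    by (simp_all add: cosine_sign_def s'_def disj_commute)
  obtain eps where eps: "littlewood_signs n eps" and close: "\<forall>z. cmod z = 1 \<longrightarrow>
    \<bar>cmod (littlewood_eval n eps z)
      - cmod (Complex (2 * Re (\<Sum>k\<in>cosine_freqs. of_int (cosine_sign k) * z ^ k)) (2 * (\<Sum>k\<in>{1..L} - cosine_freqs. s' k * Im (z ^ k))))\<bar> \<le> 2"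
    using symmetric_littlewood[where a = cosine_sign and s = s', OF C signs n] by (elim exE conjE) (rule that)
  have "2 * min (\<eta> * 2 ^ r) (sqrt L) - 2 \<le> cmod (littlewood_eval n eps z) \<and>
    cmod (littlewood_eval n eps z) \<le> 2 * (3 * 2 ^ r + 10 ^ 7 * sqrt L) + 2" if z: "cmod z = 1" for z
  proof -
    define X where "X = rs_cosine T (2 * r) z"
    define Y where "Y = (\<Sum>k\<in>{1..L} - cosine_freqs. s k * Im (z ^ k))"
    have cl: "\<bar>cmod (littlewood_eval n eps z) - cmod (Complex (2 * X) (2 * Y))\<bar> \<le> 2"
      using close z unfolding cosine_sum s' X_def Y_def rs_cosine_def by blast
    have "\<bar>2 * X\<bar> \<le> cmod (Complex (2 * X) (2 * Y))" "\<bar>2 * Y\<bar> \<le> cmod (Complex (2 * X) (2 * Y))"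
      using abs_Re_le_cmod[of "Complex (2 * X) (2 * Y)"] abs_Im_le_cmod[of "Complex (2 * X) (2 * Y)"] by simp_all
    moreover have "cmod (Complex (2 * X) (2 * Y)) \<le> \<bar>2 * X\<bar> + \<bar>2 * Y\<bar>"
      using cmod_le[of "Complex (2 * X) (2 * Y)"] by simp
    moreover have "\<bar>X\<bar> \<le> 3 * 2 ^ r" unfolding X_def by (rule rs_cosine_bound[OF z])
    moreover have "\<bar>Y\<bar> \<le> 10 ^ 7 * sqrt L" "\<bar>X\<bar> < \<eta> * 2 ^ r \<longrightarrow> sqrt L \<le> \<bar>Y\<bar>"
      using sine z unfolding X_def Y_def by blast+
    ultimately show ?thesis using cl unfolding min_def abs_mult by (auto split: if_splits)
  qed
  with eps show ?thesis by blast
qed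

section \<open>Choice of parameters for large degrees\<close>

lemma flat_littlewood_eventually:
  "\<exists>\<delta>>0. \<exists>N. \<forall>n\<ge>N. \<exists>eps. littlewood_signs n eps \<and> (\<forall>z. cmod z = 1 \<longrightarrow>
    \<delta> * sqrt n \<le> cmod (littlewood_eval n eps z) \<and> cmod (littlewood_eval n eps z) \<le> 10 ^ 8 * sqrt n)"
proof -
  define A :: nat where "A = 10 ^ 80"
  define B :: nat where "B = 112 * (90 * A) ^ 4"
  define \<eta> :: real where "\<eta> = 1 / (8 * (90 * real A) ^ 4)"
  \<comment> \<open>From \<open>L \<le> 48 * A * T\<close> and \<open>T < 4 * B * 4 ^ r\<close>,
    that is \<open>L \<le> 192 * A * B * 4 ^ r\<close>.\<close>
  define \<delta>0 where "\<delta>0 = \<eta> / sqrt (real (192 * A * B))"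
  define \<delta> where "\<delta> = \<delta>0 / 2"
  have A: "0 < A" by (simp add: A_def)
  have B: "0 < B" using A by (simp add: B_def)
  have \<eta>: "0 < \<eta>" "\<eta> \<le> 1"
  proof -
    have "1 \<le> (90 * real A) ^ 4" using A by (intro one_le_power) simp
    moreover have "0 < 1 / (8 * K) \<and> 1 / (8 * K) \<le> 1" if "1 \<le> K" for K :: real
      using that by (simp add: divide_le_eq)
    ultimately show "0 < \<eta>" "\<eta> \<le> 1" unfolding \<eta>_def by blast+
  qed
  have \<delta>0: "0 < \<delta>0" using \<eta> A B by (simp add: \<delta>0_def)
  have \<delta>01: "\<delta>0 \<le> 1"
  proof -
    have "1 \<le> 192 * A * B" using A B by (simp add: Suc_le_eq)
    then have "real 1 \<le> real (192 * A * B)" by (rule of_nat_mono)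
    then have "1 \<le> sqrt (real (192 * A * B))" by (intro real_le_rsqrt) simp
    then have "\<delta>0 \<le> \<eta> / 1" unfolding \<delta>0_def using \<eta> by (intro divide_left_mono) auto
    then show ?thesis using \<eta> by simp
  qed
  \<comment> \<open>The first entry ensures \<open>T \<ge> 4 * B\<close> and thus
    \<open>r \<ge> 1\<close>; the second ensures \<open>\<delta>0 * sqrt n \<ge> 8\<close>, so that
    halving \<open>\<delta>0\<close> pays for the error 2.\<close>
  define N where "N = max (24 * A * (4 * B + 1) + 2) (nat \<lceil>(8 / \<delta>0)\<^sup>2\<rceil>)"
  have "\<exists>eps. littlewood_signs n eps \<and> (\<forall>z. cmod z = 1 \<longrightarrow>
    \<delta> * sqrt n \<le> cmod (littlewood_eval n eps z) \<and> cmod (littlewood_eval n eps z) \<le> 10 ^ 8 * sqrt n)"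
    if nN: "N \<le> n" for n
  proof -
    define L where "L = n div 2"
    define q where "q = L div (12 * A)"
    define T where "T = (if odd q then q else q - 1)"
    have n: "n = 2 * L \<or> n = 2 * L + 1" unfolding L_def by linarith
    have n2: "24 * A * (4 * B + 1) + 2 \<le> n" using nN by (simp add: N_def)
    then have "12 * A * (4 * B + 1) \<le> L" unfolding L_def by simp
    then have "(12 * A * (4 * B + 1)) div (12 * A) \<le> q" unfolding q_def by (rule div_le_mono)
    then have q: "4 * B + 1 \<le> q" using A by simp
    have T: "odd T" "4 * B \<le> T" "q \<le> T + 1" "T \<le> q" using q by (auto simp: T_def)
    have mL: "12 * A * T \<le> L"
    proof -
      have "12 * A * T \<le> 12 * A * q" using T by simp
      also have "\<dots> \<le> L" unfolding q_def by (rule times_div_less_eq_dividend)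
      finally show ?thesis .
    qed
    have Lm: "L \<le> 4 * (12 * A * T)"
    proof -
      have "L < 12 * A * Suc q" unfolding q_def using A dividend_less_times_div[of "12 * A" L] by simp
      also have "\<dots> \<le> 12 * A * (4 * T)" using T B by (intro mult_le_mono) auto
      finally show ?thesis by simp
    qed
    have "4 * B div B \<le> T div B" using T by (intro div_le_mono) auto
    then have TB: "4 \<le> T div B" using B by simp
    \<comment> \<open>The largest \<open>r\<close> that \<open>T_large\<close> permits; maximality
      keeps \<open>2 ^ r\<close> of the order of \<open>sqrt L\<close>.\<close>
    then obtain r where r: "4 ^ r \<le> T div B" "T div B < 4 ^ (r + 1)"
      using ex_power_ivl1[of 4 "T div B"] by auto
    then have "4 ^ 1 < (4::nat) ^ (r + 1)" using TB by simp
    then have r1: "1 \<le> r" by (subst (asm) power_strict_increasing_iff) auto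
    have rT: "B * 4 ^ r \<le> T"
      using mult_le_mono2[OF r(1), of B] times_div_less_eq_dividend[of B T] by linarith
    have Tr: "T < B * 4 ^ (r + 1)"
      using r(2) B by (simp add: div_less_iff_less_mult mult.commute)
    interpret F: flat_cosine A T r
      using A T r1 rT by unfold_locales (auto simp: B_def)
    have A80: "10 ^ 80 \<le> A" by (simp add: A_def)
    have F\<eta>: "F.\<eta> = \<eta>" by (simp only: F.\<eta>_def \<eta>_def)
    obtain eps where eps: "littlewood_signs n eps" and bounds: "\<forall>z. cmod z = 1 \<longrightarrow>
      2 * min (\<eta> * 2 ^ r) (sqrt L) - 2 \<le> cmod (littlewood_eval n eps z) \<and>
      cmod (littlewood_eval n eps z) \<le> 2 * (3 * 2 ^ r + 10 ^ 7 * sqrt L) + 2"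
      using F.flat_littlewood[unfolded F\<eta> F.m_def, OF A80 mL Lm n] by (elim exE conjE) (rule that)
    have pow: "(2::real) ^ r = sqrt (4 ^ r)"
      by (simp add: real_sqrt_power)
    have upr: "(2::real) ^ r \<le> sqrt L"
    proof -
      have "1 * T \<le> 12 * A * T" "1 * 4 ^ r \<le> B * 4 ^ r" using A B by (intro mult_le_mono1; simp)+
      then have "4 ^ r \<le> L" using rT mL by linarith
      then have "(4::real) ^ r \<le> real L" by (metis of_nat_le_iff of_nat_numeral of_nat_power)
      then show ?thesis unfolding pow by simp
    qed
    have low: "\<delta>0 * sqrt L \<le> \<eta> * 2 ^ r"
    proof -
      have "L \<le> 192 * A * B * 4 ^ r"
      proof -
        have "L \<le> 48 * A * T" using Lm by simp
        also have "\<dots> \<le> 48 * A * (B * 4 ^ (r + 1))" using Tr by (intro mult_le_mono) auto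
        also have "\<dots> = 192 * A * B * 4 ^ r" by simp
        finally show ?thesis .
      qed
      then have "real L \<le> real (192 * A * B * 4 ^ r)" by (rule of_nat_mono)
      then have "real L \<le> real (192 * A * B) * 4 ^ r" by simp
      then have "sqrt L \<le> sqrt (real (192 * A * B)) * 2 ^ r" unfolding pow real_sqrt_mult[symmetric] by simp
      then have "\<delta>0 * sqrt L \<le> \<delta>0 * (sqrt (real (192 * A * B)) * 2 ^ r)" using \<delta>0 by (intro mult_left_mono) auto
      also have "\<dots> = \<eta> * 2 ^ r" using A B by (simp add: \<delta>0_def)
      finally show ?thesis .
    qed
    have n4: "real n \<le> 4 * real L" "2 * real L \<le> real n" using n n2 by auto
    have snL: "sqrt n \<le> 2 * sqrt L"
    proof -
      have "sqrt n \<le> sqrt (4 * real L)" using n4 by simp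
      then show ?thesis by (simp add: real_sqrt_mult)
    qed
    have sLn: "sqrt L \<le> sqrt n" using n4 by simp
    have big: "8 \<le> \<delta>0 * sqrt n"
    proof -
      have "(8 / \<delta>0)\<^sup>2 \<le> real n" using nN unfolding N_def by linarith
      then have "8 / \<delta>0 \<le> sqrt n" by (rule real_le_rsqrt)
      then show ?thesis using \<delta>0 by (simp add: field_simps)
    qed
    have "\<delta> * sqrt n \<le> cmod (littlewood_eval n eps z) \<and> cmod (littlewood_eval n eps z) \<le> 10 ^ 8 * sqrt n"
      if z: "cmod z = 1" for z
    proof
      have "\<delta>0 * sqrt L \<le> 1 * sqrt L" using \<delta>01 by (intro mult_right_mono) auto
      then have "\<delta>0 * sqrt L \<le> min (\<eta> * 2 ^ r) (sqrt L)" using low by simp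
      moreover have "\<delta>0 * sqrt n \<le> \<delta>0 * (2 * sqrt L)" using snL \<delta>0 by (intro mult_left_mono) auto
      moreover have "2 * min (\<eta> * 2 ^ r) (sqrt L) - 2 \<le> cmod (littlewood_eval n eps z)"
        using bounds z by blast
      ultimately show "\<delta> * sqrt n \<le> cmod (littlewood_eval n eps z)"
        using big unfolding \<delta>_def by linarith
      have powers: "(10::real) ^ 7 = 10000000" "(10::real) ^ 8 = 100000000" by simp_all
      have "1 \<le> sqrt n" using n2 by simp
      moreover have "cmod (littlewood_eval n eps z) \<le> 2 * (3 * 2 ^ r + 10 ^ 7 * sqrt L) + 2"
        using bounds z by blast
      moreover have "x \<le> 100000000 * u" if "1 \<le> u" "x \<le> 2 * (3 * p + 10000000 * l) + 2" "p \<le> l" "l \<le> u"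
        for x u p l :: real
        using that unfolding distrib_left by linarith
      ultimately show "cmod (littlewood_eval n eps z) \<le> 10 ^ 8 * sqrt n"
        using upr sLn unfolding powers by blast
    qed
    with eps show ?thesis by blast
  qed
  then show ?thesis using \<delta>0 by (intro exI[of _ \<delta>] exI[of _ N]) (auto simp: \<delta>_def)
qed

section \<open>Small degrees and conclusion\<close>

lemma littlewood_nonvanishing:
  assumes "2 \<le> n" "cmod z = 1"
  shows "littlewood_eval n (\<lambda>k. if k = 0 then -1 else 1) z \<noteq> 0"
proof
  let ?P = "littlewood_eval n (\<lambda>k. if k = 0 then -1 else 1) z"
  assume "?P = 0"
  have "?P = (\<Sum>k\<le>n. z ^ k + (if k = 0 then -2 else 0))"
    unfolding littlewood_eval_def by (intro sum.cong) auto
  also have "\<dots> = (\<Sum>k\<le>n. z ^ k) - 2" by (simp add: sum.distrib)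
  finally have P: "?P = (\<Sum>k\<le>n. z ^ k) - 2" .
  show False
  proof (cases "z = 1")
    case True
    \<comment> \<open>The value at 1 is \<open>n - 1\<close>, so degree 1 would fail.\<close>
    then have "complex_of_nat (n + 1) = complex_of_nat 2" using P \<open>?P = 0\<close> by simp
    then show False using assms(1) by (simp only: of_nat_eq_iff)
  next
    case False
    \<comment> \<open>A zero satisfies \<open>z ^ Suc n = 2 * z - 1\<close>, and \<open>1\<close> is the only point of the unit circle with \<open>cmod (2 * z - 1) = 1\<close>.\<close>
    have "(z - 1) * (\<Sum>k\<le>n. z ^ k) = z ^ Suc n - 1" by (simp only: power_diff_1_eq lessThan_Suc_atMost)
    then have "z ^ Suc n = 2 * z - 1" using P \<open>?P = 0\<close> by (simp add: algebra_simps)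
    then have "cmod (2 * z - 1) = 1" using assms(2) by (metis norm_power power_one)
    then have "(cmod (2 * z - 1))\<^sup>2 = 1" by simp
    moreover have "(Re z)\<^sup>2 + (Im z)\<^sup>2 = 1" using assms(2) cmod_power2[of z] by simp
    ultimately have "Re z = 1" unfolding cmod_power2 by (simp add: power2_eq_square algebra_simps)
    moreover from this have "Im z = 0" using \<open>(Re z)\<^sup>2 + (Im z)\<^sup>2 = 1\<close> by simp
    ultimately show False using False by (simp add: complex_eq_iff)
  qed
qed

text \<open>Compactness of the circle turns nonvanishing into a positive minimum; the constants
  depend on \<open>n\<close>, which is harmless for finitely many degrees.\<close>

lemma littlewood_bounds_fixed_degree:
  assumes "2 \<le> n"
  shows "\<exists>\<delta> \<Delta>. 0 < \<delta> \<and> (\<exists>eps. littlewood_signs n eps \<and> (\<forall>z. cmod z = 1 \<longrightarrow>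
    \<delta> * sqrt n \<le> cmod (littlewood_eval n eps z) \<and> cmod (littlewood_eval n eps z) \<le> \<Delta> * sqrt n))"
proof -
  define eps :: "nat \<Rightarrow> int" where "eps = (\<lambda>k. if k = 0 then -1 else 1)"
  define f where "f = (\<lambda>z. cmod (littlewood_eval n eps z))"
  have cont: "continuous_on (sphere 0 1) f"
    unfolding f_def littlewood_eval_def by (intro continuous_intros)
  have ne: "sphere (0::complex) 1 \<noteq> {}" by simp
  obtain z0 where z0: "z0 \<in> sphere 0 1" "\<forall>z\<in>sphere 0 1. f z0 \<le> f z"
    using continuous_attains_inf[OF compact_sphere ne cont] by blast
  obtain z1 where z1: "\<forall>z\<in>sphere 0 1. f z \<le> f z1"
    using continuous_attains_sup[OF compact_sphere ne cont] by blast
  have "0 < f z0" using z0(1) littlewood_nonvanishing[OF assms, of z0] by (simp add: f_def eps_def)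
  moreover have "littlewood_signs n eps" by (simp add: littlewood_signs_def eps_def)
  ultimately show ?thesis using z0(2) z1 assms
    by (intro exI[of _ "f z0 / sqrt n"] exI[of _ "f z1 / sqrt n"] conjI exI[of _ eps]) (auto simp: f_def)
qed

theorem theorem1p1:
  shows "\<exists>\<delta> \<Delta> :: real. \<Delta> > \<delta> \<and> \<delta> > 0 \<and>
    (\<forall>n::nat. n \<ge> 2 \<longrightarrow> (\<exists>eps. littlewood_signs n eps \<and>
       (\<forall>z::complex. norm z = 1 \<longrightarrow>
          \<delta> * sqrt (real n) \<le> norm (littlewood_eval n eps z) \<and>
          norm (littlewood_eval n eps z) \<le> \<Delta> * sqrt (real n))))"
proof -
  define good where "good = (\<lambda>\<delta> \<Delta> n. \<exists>eps. littlewood_signs n eps \<and> (\<forall>z. cmod z = 1 \<longrightarrow>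
    \<delta> * sqrt n \<le> cmod (littlewood_eval n eps z) \<and> cmod (littlewood_eval n eps z) \<le> \<Delta> * sqrt (real n)))"
  have mono: "good \<delta>' \<Delta>' n" if "good \<delta> \<Delta> n" "\<delta>' \<le> \<delta>" "\<Delta> \<le> \<Delta>'" for \<delta> \<delta>' \<Delta> \<Delta>' n
  proof -
    have "\<delta>' * sqrt n \<le> \<delta> * sqrt n" "\<Delta> * sqrt n \<le> \<Delta>' * sqrt n"
      using that(2,3) by (auto intro!: mult_right_mono)
    then show ?thesis using that(1) unfolding good_def by (meson order_trans)
  qed
  obtain \<delta>1 N where \<delta>1: "0 < \<delta>1" "\<And>n. N \<le> n \<Longrightarrow> good \<delta>1 (10 ^ 8) n"
    using flat_littlewood_eventually unfolding good_def by blast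
  have "\<forall>n. \<exists>\<delta> \<Delta>. 2 \<le> n \<longrightarrow> 0 < \<delta> \<and> good \<delta> \<Delta> n"
    using littlewood_bounds_fixed_degree unfolding good_def by blast
  then obtain d D where dD: "\<And>n. 2 \<le> n \<Longrightarrow> 0 < d n \<and> good (d n) (D n) n"
    by metis
  define \<delta> where "\<delta> = Min (insert \<delta>1 (d ` {2..N}))"
  \<comment> \<open>The entry \<open>\<delta> + 1\<close> is there for the strict inequality between
    the two constants.\<close>
  define \<Delta> where "\<Delta> = Max (insert (10 ^ 8) (insert (\<delta> + 1) (D ` {2..N})))"
  have "0 < \<delta>" unfolding \<delta>_def using \<delta>1(1) dD by (subst Min_gr_iff) auto
  moreover have "\<delta> < \<Delta>"
  proof -
    have "\<delta> + 1 \<le> \<Delta>" unfolding \<Delta>_def by (intro Max_ge) auto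
    then show ?thesis by simp
  qed
  moreover have "good \<delta> \<Delta> n" if "2 \<le> n" for n
  proof (cases "N \<le> n")
    case True
    show ?thesis by (rule mono[OF \<delta>1(2)[OF True]]) (auto simp: \<delta>_def \<Delta>_def)
  next
    case False
    then have n: "n \<in> {2..N}" using that by simp
    have "\<delta> \<le> d n" unfolding \<delta>_def by (rule Min_le) (use n in auto)
    moreover have "D n \<le> \<Delta>" unfolding \<Delta>_def by (rule Max_ge) (use n in auto)
    ultimately show ?thesis by (rule mono[OF conjunct2[OF dD[OF that]]])
  qed
  ultimately show ?thesis unfolding good_def by blast
qed

end
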